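(* Let $d,n,m\in\mathbb{N}$, let $U\subset\mathbb{R}^d$ be open, let $f_1,\dots,f_n\in C^m(U)$ be real-valued functions such that $\mathbf{f}=(f_1,\dots,f_n):U\to\mathbb{R}^n$ is a $C^m$ embedding, and let $M=\{\mathbf{f}(\mathbf{x})\mid \mathbf{x}\in U\}$. Suppose that almost every point of $M$ is nondegenerate. Then $M$ is strongly extremal, that is, almost every $\mathbf{y}\in M$ is not very well multiplicatively approximable.
   Context: "Almost every point of $M$" refers to the natural measure class on $M$, i.e. the image of Lebesgue measure on $U$ under $\mathbf{f}$. For $l\le m$ a point $\mathbf{y}=\mathbf{f}(\mathbf{x})$ of $M$ is $l$-nondegenerate if $\mathbb{R}^n$ is spanned by the partial derivatives $\partial_\beta\mathbf{f}(\mathbf{x})$, $1\le|\beta|\le l$. It is nondegenerate if it is $l$-nondegenerate for some $l\le m$. For $x\in\mathbb{R}$ put $|x|_+=\max(|x|,1)$, and for $\mathbf{x}\in\mathbb{R}^n$ put $\Pi_+(\mathbf{x})=\prod_{i=1}^n|x_i|_+$. Write $\mathbf{q}\cdot\mathbf{y}=\sum_i q_iy_i$. A vector $\mathbf{y}\in\mathbb{R}^n$ is very well multiplicatively approximable (VWMA) if for some $\varepsilon>0$ there are infinitely many $\mathbf{q}\in\mathbb{Z}^n$ such that $$|\mathbf{q}\cdot\mathbf{y}+p|\cdot\Pi_+(\mathbf{q})\le\Pi_+(\mathbf{q})^{-\varepsilon}$$ for some $p\in\mathbb{Z}$. A submanifold $M\subset\mathbb{R}^n$ is strongly extremal if almost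 all $\mathbf{y}\in M$ are not VWMA. *)

theory Defs
  imports "HOL-Analysis.Analysis"
begin

definition partial_deriv ::
  "'d::finite \<Rightarrow> (real ^ 'd \<Rightarrow> 'b::real_normed_vector) \<Rightarrow> real ^ 'd \<Rightarrow> 'b" where
  "partial_deriv i f x = vector_derivative (\<lambda>t. f (x + t *\<^sub>R axis i 1)) (at 0)"

text \<open>
  \<open>Ck_on k U f\<close>, for open \<open>U\<close>: all partial derivatives of \<open>f\<close> of order at most \<open>k\<close>
  exist on \<open>U\<close> and are continuous there.
\<close>
fun Ck_on :: "nat \<Rightarrow> (real ^ 'd::finite) set \<Rightarrow> (real ^ 'd \<Rightarrow> 'b::real_normed_vector) \<Rightarrow> bool" where
  "Ck_on 0 U f \<longleftrightarrow> continuous_on U f"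
| "Ck_on (Suc k) U f \<longleftrightarrow> continuous_on U f \<and>
     (\<forall>i. (\<forall>x\<in>U. (\<lambda>t. f (x + t *\<^sub>R axis i 1)) differentiable at 0) \<and>
          Ck_on k U (partial_deriv i f))"

definition Ck_embedding ::
  "nat \<Rightarrow> (real ^ 'd::finite) set \<Rightarrow> (real ^ 'd \<Rightarrow> real ^ 'n::finite) \<Rightarrow> bool" where
  "Ck_embedding k U f \<longleftrightarrow>
     Ck_on k U f \<and>
     (\<forall>x\<in>U. inj (frechet_derivative f (at x))) \<and>
     (\<exists>g. homeomorphism U (f ` U) f g)"

text \<open>
  A multi-index is a function \<open>\<beta> :: 'd \<Rightarrow> nat\<close>, and \<open>multi_deriv \<beta> f\<close> applies \<open>partial_deriv i\<close>
  exactly \<open>\<beta> i\<close> times for each \<open>i\<close>. Since the index type carries no order, the order of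
  differentiation is chosen arbitrarily; for \<open>f\<close> of class \<open>C\<^sup>k\<close> on an open set and \<open>|\<beta>| \<le> k\<close>
  the value on that set does not depend on the choice.
\<close>
definition multi_deriv ::
  "('d::finite \<Rightarrow> nat) \<Rightarrow> (real ^ 'd \<Rightarrow> 'b::real_normed_vector) \<Rightarrow> real ^ 'd \<Rightarrow> 'b" where
  "multi_deriv \<beta> f = foldr partial_deriv (SOME is. \<forall>i. count_list is i = \<beta> i) f"

definition l_nondegenerate ::
  "nat \<Rightarrow> (real ^ 'd::finite) set \<Rightarrow> (real ^ 'd \<Rightarrow> real ^ 'n::finite) \<Rightarrow> real ^ 'n \<Rightarrow> bool" where
  "l_nondegenerate l U f y \<longleftrightarrow>
     (\<exists>x\<in>U. y = f x \<and>
        span {multi_deriv \<beta> f x | \<beta>. 1 \<le> (\<Sum>i\<in>UNIV. \<beta> i) \<and> (\<Sum>i\<in>UNIV. \<beta> i) \<le> l} = UNIV)"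

definition nondegenerate ::
  "nat \<Rightarrow> (real ^ 'd::finite) set \<Rightarrow> (real ^ 'd \<Rightarrow> real ^ 'n::finite) \<Rightarrow> real ^ 'n \<Rightarrow> bool" where
  "nondegenerate m U f y \<longleftrightarrow> (\<exists>l\<le>m. l_nondegenerate l U f y)"

text \<open>
  The image of Lebesgue measure on \<open>U\<close> under \<open>f\<close>, as a measure whose space is the
  submanifold \<open>f ` U\<close>; ``almost every point of \<open>f ` U\<close>'' refers to this measure.
\<close>
definition image_measure ::
  "(real ^ 'd::finite) set \<Rightarrow> (real ^ 'd \<Rightarrow> real ^ 'n::finite) \<Rightarrow> (real ^ 'n) measure" where
  "image_measure U f = distr (lebesgue_on U) (restrict_space borel (f ` U)) f"

definition Pi_plus :: "real ^ 'n::finite \<Rightarrow> real" where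
  "Pi_plus x = (\<Prod>i\<in>UNIV. max \<bar>x $ i\<bar> 1)"

definition real_vec :: "int ^ 'n::finite \<Rightarrow> real ^ 'n" where
  "real_vec q = (\<chi> i. real_of_int (q $ i))"

definition VWMA :: "real ^ 'n::finite \<Rightarrow> bool" where
  "VWMA y \<longleftrightarrow>
     (\<exists>\<epsilon>>0. infinite {q :: int ^ 'n. \<exists>p :: int.
        \<bar>real_vec q \<bullet> y + real_of_int p\<bar> * Pi_plus (real_vec q)
          \<le> Pi_plus (real_vec q) powr (- \<epsilon>)})"

definition strongly_extremal ::
  "(real ^ 'd::finite) set \<Rightarrow> (real ^ 'd \<Rightarrow> real ^ 'n::finite) \<Rightarrow> bool" where
  "strongly_extremal U f \<longleftrightarrow> (AE y in image_measure U f. \<not> VWMA y)"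

end

theory Submission
  imports Defs
begin

text \<open>
  The proof follows the dynamical approach of Kleinbock and Margulis.  If \<open>y\<close> is very well
  multiplicatively approximable, then for infinitely many \<open>T\<close> there are exponents \<open>t\<^sub>i\<close> with
  \<open>\<Sum>t\<^sub>i = T\<close> such that the map \<open>flow t y\<close>, which sends \<open>(p, q)\<close> to
  \<open>(2\<^sup>T (p + q \<bullet> y), 2\<^bsup>-t i\<^esup> q\<^sub>i)\<close>, takes a nonzero integer vector to a vector of length
  exponentially small in \<open>T\<close> (\<open>VWMA_imp_short\<close>).  By Borel and Cantelli it is enough that, in a
  neighbourhood of a nondegenerate point, the set of \<open>x\<close> for which this happens with
  \<open>y = f x\<close> has measure exponentially small in \<open>T\<close>, uniformly in \<open>t\<close>; at most
  \<open>(T + 1)\<^sup>n\<close> choices of \<open>t\<close> belong to a given \<open>T\<close>.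

  This uniform bound is quantitative nondivergence (\<open>nondivergence\<close>, \<open>short_vectors_small\<close>).
  For a nonzero rational subspace \<open>W\<close>, the covolume \<open>covol (flow t (f x)) W\<close> is the largest of finitely
  many functions \<open>\<bar>c\<^sub>0 + c \<bullet> f x\<bar>\<close>, and one of these has a coefficient of size at least 1
  because minors of integer vectors are integers.  If along some flag of rational subspaces the
  covolumes are moderate, while all other subspaces compatible with the flag have large covolume,
  then no integer vector is mapped to a short one (\<open>marked_imp_no_short_vector\<close>).  Such flags are
  found for most \<open>x\<close> by a stopping time argument on dyadic cells: a maximal cell on which
  some covolume is small has a parent on which all covolumes are large, so on the cell itself
  they are still comparably large, and the subspace that triggered the stop becomes a member of
  the flag.  Maximal cells are disjoint, so the estimates on them add up.

  All that this requires of the functions \<open>F = c\<^sub>0 + c \<bullet> f\<close> is that they do not drop too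
  much from a cell to a child (\<open>doubling\<close>) and that they are rarely small compared with their
  size on a cell (\<open>good\<close>).  Both hold for functions that are almost polynomial at every scale.  Near
  a nondegenerate point a cell of side \<open>s\<close> contains a point with \<open>\<bar>F\<bar> \<ge> A \<bar>c\<bar> s\<^sup>m\<close>, as
  some mixed difference of order at most \<open>m\<close> is that large, whereas the differences of order
  \<open>m + 1\<close> are at most a small multiple of \<open>\<bar>c\<bar> s\<^sup>m\<close>, by continuity of the derivatives
  of order \<open>m\<close>.  A function whose differences of order \<open>m + 1\<close> are negligible at the scale of
  its own size is controlled along arithmetic progressions just as a polynomial is.
\<close>

section \<open>Dyadic cells\<close>

text \<open>
  The half-open dyadic cube of side \<open>2\<^bsup>-j\<^esup>\<close> that contains \<open>x\<close>.  Indexing cubes by their points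
  makes the parent of \<open>cell (Suc j) x\<close> simply \<open>cell j x\<close>.
\<close>

definition cell :: "nat \<Rightarrow> real ^ 'd \<Rightarrow> (real ^ 'd::finite) set" where
  "cell j x = {y. \<forall>i. \<lfloor>2 ^ j * y $ i\<rfloor> = \<lfloor>2 ^ j * x $ i\<rfloor>}"

lemma cell_self [simp]: "x \<in> cell j x"
  by (simp add: cell_def)

lemma cell_eq: "y \<in> cell j x \<Longrightarrow> cell j y = cell j x"
  by (simp add: cell_def)

lemma cell_Suc_subset: "cell (Suc j) x \<subseteq> cell j x"
proof -
  have *: "\<lfloor>2 ^ j * a\<rfloor> = \<lfloor>2 ^ Suc j * a\<rfloor> div 2" for a :: real
    using floor_divide_real_eq_div[of 2 "2 ^ Suc j * a"] by simp
  show ?thesis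
    by (auto simp: cell_def * simp del: power_Suc)
qed

lemma cell_mono: "j \<le> k \<Longrightarrow> cell k x \<subseteq> cell j x"
  by (induction k rule: dec_induct) (use cell_Suc_subset in blast)+

lemma cell_conv:
  "cell j x = {y. \<forall>i. of_int \<lfloor>2 ^ j * x $ i\<rfloor> / 2 ^ j \<le> y $ i \<and>
                      y $ i < (of_int \<lfloor>2 ^ j * x $ i\<rfloor> + 1) / 2 ^ j}"
  by (auto simp: cell_def floor_eq_iff field_simps)

lemma cell_corner:
  obtains p :: "real ^ 'd::finite"
  where "cell j x = {y. \<forall>i. p $ i \<le> y $ i \<and> y $ i < p $ i + 1 / 2 ^ j}"
proof
  show "cell j x = {y. \<forall>i. (\<chi> i. of_int \<lfloor>2 ^ j * x $ i\<rfloor> / 2 ^ j) $ i \<le> y $ i \<and>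
          y $ i < (\<chi> i. of_int \<lfloor>2 ^ j * x $ i\<rfloor> / 2 ^ j) $ i + 1 / 2 ^ j}"
    unfolding cell_conv by (simp add: add_divide_distrib)
qed

lemma cell_dist_less:
  assumes "y \<in> cell j x" "y' \<in> cell j x"
  shows "\<bar>y $ i - y' $ i\<bar> < 1 / 2 ^ j"
proof -
  obtain p where p: "cell j x = {y. \<forall>i. p $ i \<le> y $ i \<and> y $ i < p $ i + 1 / 2 ^ j}"
    by (rule cell_corner)
  have "p $ i \<le> y $ i" "y $ i < p $ i + 1 / 2 ^ j" "p $ i \<le> y' $ i" "y' $ i < p $ i + 1 / 2 ^ j"
    using assms unfolding p by auto
  then show ?thesis by linarith
qed

lemma convex_cell: "convex (cell j x)"
proof -
  have "cell j x = (\<Inter>i. {y. y \<bullet> axis i 1 \<ge> of_int \<lfloor>2 ^ j * x $ i\<rfloor> / 2 ^ j} \<inter>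
          {y. y \<bullet> axis i 1 < (of_int \<lfloor>2 ^ j * x $ i\<rfloor> + 1) / 2 ^ j})"
    unfolding cell_conv by (auto simp: inner_axis)
  also have "convex \<dots>"
    by (intro convex_INT convex_Int) (simp_all add: inner_commute[of _ "axis _ _"] convex_halfspace_ge convex_halfspace_lt)
  finally show ?thesis .
qed

lemma sets_cell [measurable, simp]: "cell j x \<in> sets borel"
  unfolding cell_conv by measurable

text \<open>
  The cell lies between an open and a closed box of the same volume.
\<close>

lemma emeasure_cell:
  "emeasure lborel (cell j (x :: real ^ 'd::finite)) = ennreal ((1 / 2 ^ j) ^ CARD('d))"
proof -
  obtain p where p: "cell j x = {y. \<forall>i. p $ i \<le> y $ i \<and> y $ i < p $ i + 1 / 2 ^ j}"
    by (rule cell_corner)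
  define q where "q = p + (\<chi> i. 1 / 2 ^ j)"
  have le: "p \<bullet> b \<le> q \<bullet> b" if "b \<in> Basis" for b
    using that by (auto simp: q_def Basis_vec_def inner_axis inner_add_left)
  have "(\<Prod>b\<in>Basis. (q - p) \<bullet> b) = (1 / 2 ^ j) ^ CARD('d)"
  proof -
    have "(\<Prod>b\<in>Basis. (q - p) \<bullet> b) = (\<Prod>b\<in>(Basis :: (real ^ 'd) set). 1 / 2 ^ j)"
      by (rule prod.cong) (auto simp: q_def Basis_vec_def inner_axis)
    then show ?thesis by simp
  qed
  then have 1: "emeasure lborel (box p q) = ennreal ((1 / 2 ^ j) ^ CARD('d))"
    and 2: "emeasure lborel (cbox p q) = ennreal ((1 / 2 ^ j) ^ CARD('d))"
    using emeasure_lborel_box[of p q] emeasure_lborel_cbox[of p q] le by auto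
  have "box p q \<subseteq> cell j x" "cell j x \<subseteq> cbox p q"
    unfolding p by (auto simp: mem_box_cart q_def less_imp_le)
  then show ?thesis
    using 1 2 emeasure_mono[of "box p q" "cell j x" lborel] emeasure_mono[of "cell j x" "cbox p q" lborel]
    by (simp add: order_antisym)
qed

lemma cell_in_ball:
  fixes x :: "real ^ 'd::finite"
  assumes "e > 0"
  obtains k where "\<And>j. j \<ge> k \<Longrightarrow> cell j x \<subseteq> ball x e"
proof -
  obtain k where k: "real CARD('d) / e < 2 ^ k"
    using real_arch_pow[of 2 "real CARD('d) / e"] by auto
  have "cell j x \<subseteq> ball x e" if "k \<le> j" for j
  proof
    fix y assume "y \<in> cell j x"
    then have *: "\<bar>(x - y) $ i\<bar> \<le> 1 / 2 ^ j" for i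
      using cell_dist_less[of x j x y i] by (simp add: less_imp_le)
    have "norm (x - y) \<le> (\<Sum>i\<in>UNIV. \<bar>(x - y) $ i\<bar>)"
      by (rule norm_le_l1_cart)
    also have "\<dots> \<le> real CARD('d) * (1 / 2 ^ j)"
      using sum_bounded_above[of UNIV "\<lambda>i. \<bar>(x - y) $ i\<bar>" "1 / 2 ^ j"] * by simp
    also have "\<dots> \<le> real CARD('d) * (1 / 2 ^ k)"
      using that by (intro mult_left_mono) (auto simp: field_simps)
    also have "\<dots> < e"
      using k \<open>e > 0\<close> by (simp add: field_simps)
    finally show "y \<in> ball x e" by (simp add: dist_norm)
  qed
  then show ?thesis by (rule that)
qed

lemma countable_cells: "countable (range (\<lambda>(j, x :: real ^ 'd::finite). cell j x))"
proof -
  have "range (\<lambda>(j, x :: real ^ 'd). cell j x) \<subseteq>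
      range (\<lambda>(j, z :: 'd \<Rightarrow> int). {y. \<forall>i. \<lfloor>2 ^ j * y $ i\<rfloor> = z i})"
  proof clarsimp
    fix j and x :: "real ^ 'd"
    show "cell j x \<in> range (\<lambda>(j, z :: 'd \<Rightarrow> int). {y. \<forall>i. \<lfloor>2 ^ j * y $ i\<rfloor> = z i})"
      by (rule range_eqI[of _ _ "(j, \<lambda>i. \<lfloor>2 ^ j * x $ i\<rfloor>)"]) (simp add: cell_def)
  qed
  moreover have "countable (range (\<lambda>(j :: nat, z :: 'd \<Rightarrow> int). {y. \<forall>i. \<lfloor>2 ^ j * y $ i\<rfloor> = z i}))"
    by (rule countable_image) simp
  ultimately show ?thesis by (rule countable_subset)
qed

section \<open>Outer bounds and stopping cells\<close>

text \<open>
  An upper bound for the outer Lebesgue measure, meaningful also for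
  sets defined by existence of flags or of integer vectors.
\<close>

definition outer_le :: "(real ^ 'd::finite) set \<Rightarrow> ennreal \<Rightarrow> bool" where
  "outer_le E c \<longleftrightarrow> (\<exists>N\<in>sets lborel. E \<subseteq> N \<and> emeasure lborel N \<le> c)"

lemma outer_le_mono: "outer_le E c \<Longrightarrow> E' \<subseteq> E \<Longrightarrow> c \<le> c' \<Longrightarrow> outer_le E' c'"
  unfolding outer_le_def by (meson order_trans)

lemma outer_le_Un: "outer_le E c \<Longrightarrow> outer_le E' c' \<Longrightarrow> outer_le (E \<union> E') (c + c')"
  unfolding outer_le_def
  by (meson Un_mono add_mono emeasure_subadditive order_trans sets.Un)

text \<open>
  Bounds relative to the cells of a disjoint family add up to a bound relative to its union.  This
  is how an estimate on stopping cells becomes an estimate on the cell they came from.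
\<close>

lemma outer_le_UN_disjoint:
  assumes "countable \<Q>" "disjoint \<Q>" "\<Q> \<subseteq> sets lborel"
    and "\<And>Q. Q \<in> \<Q> \<Longrightarrow> outer_le (E \<inter> Q) (c * emeasure lborel Q)"
    and "E \<subseteq> \<Union>\<Q>"
  shows "outer_le E (c * emeasure lborel (\<Union>\<Q>))"
proof -
  obtain N where N: "\<And>Q. Q \<in> \<Q> \<Longrightarrow> N Q \<in> sets lborel" "\<And>Q. Q \<in> \<Q> \<Longrightarrow> E \<inter> Q \<subseteq> N Q"
      "\<And>Q. Q \<in> \<Q> \<Longrightarrow> emeasure lborel (N Q) \<le> c * emeasure lborel Q"
    using assms(4) unfolding outer_le_def by metis
  let ?N = "\<Union>Q\<in>\<Q>. N Q \<inter> Q"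
  have NQ: "N Q \<inter> Q \<in> sets lborel" if "Q \<in> \<Q>" for Q
    using N(1)[OF that] assms(3) that by (intro sets.Int) auto
  have "?N \<in> sets lborel"
  proof (rule sets.countable_UN'[OF assms(1)])
    show "(\<lambda>Q. N Q \<inter> Q) ` \<Q> \<subseteq> sets lborel"
      using NQ by blast
  qed
  moreover have "E \<subseteq> ?N"
  proof
    fix x assume "x \<in> E"
    then obtain Q where "Q \<in> \<Q>" "x \<in> Q" using assms(5) by auto
    then show "x \<in> ?N" using N(2)[of Q] \<open>x \<in> E\<close> by auto
  qed
  moreover have "emeasure lborel ?N \<le> c * emeasure lborel (\<Union>\<Q>)"
  proof -
    have dj: "disjoint_family_on (\<lambda>Q. Q) \<Q>" "disjoint_family_on (\<lambda>Q. N Q \<inter> Q) \<Q>"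
      using assms(2) by (auto simp: disjoint_family_on_def disjoint_def)
    have "emeasure lborel ?N = (\<integral>\<^sup>+Q. emeasure lborel (N Q \<inter> Q) \<partial>count_space \<Q>)"
      by (rule emeasure_UN_countable[OF _ assms(1) dj(2)]) (rule NQ)
    also have "\<dots> \<le> (\<integral>\<^sup>+Q. c * emeasure lborel Q \<partial>count_space \<Q>)"
    proof (rule nn_integral_mono)
      fix Q assume "Q \<in> space (count_space \<Q>)"
      then show "emeasure lborel (N Q \<inter> Q) \<le> c * emeasure lborel Q"
        using N(1,3)[of Q] emeasure_mono[of "N Q \<inter> Q" "N Q" lborel] by force
    qed
    also have "\<dots> = c * (\<integral>\<^sup>+Q. emeasure lborel Q \<partial>count_space \<Q>)"
      by (rule nn_integral_cmult) simp
    also have "(\<integral>\<^sup>+Q. emeasure lborel Q \<partial>count_space \<Q>) = emeasure lborel (\<Union>\<Q>)"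
      using emeasure_UN_countable[OF _ assms(1) dj(1), of lborel] assms(3) by (simp add: subset_iff)
    finally show ?thesis .
  qed
  ultimately show ?thesis
    unfolding outer_le_def by blast
qed

text \<open>
  Calderon-Zygmund selection: stop at the first cell around \<open>x\<close> that satisfies \<open>P\<close>.  Two
  stopping cells that meet are nested and hence equal by minimality of the level.  Minimality
  also yields the failure of \<open>P\<close> on the parent, which lies in the root because the root fails \<open>P\<close>.
\<close>

lemma stopping_cells:
  fixes x0 :: "real ^ 'd::finite"
  assumes "\<not> P (cell j0 x0)"
    and "E \<subseteq> cell j0 x0"
    and "\<And>x. x \<in> E \<Longrightarrow> \<exists>j\<ge>j0. P (cell j x)"
  obtains \<Q> where "countable \<Q>" "disjoint \<Q>" "\<Q> \<subseteq> sets lborel" "E \<subseteq> \<Union>\<Q>" "\<Union>\<Q> \<subseteq> cell j0 x0"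
    and "\<And>Q. Q \<in> \<Q> \<Longrightarrow> P Q"
    and "\<And>Q. Q \<in> \<Q> \<Longrightarrow> \<exists>j x. j0 \<le> j \<and> x \<in> cell j0 x0 \<and> Q = cell (Suc j) x \<and> \<not> P (cell j x)"
proof -
  define J where "J x = (LEAST j. j0 \<le> j \<and> P (cell j x))" for x
  have J: "j0 \<le> J x" "P (cell (J x) x)" if "x \<in> E" for x
    using LeastI_ex[OF assms(3)[OF that, unfolded Bex_def]] by (auto simp: J_def)
  have J_least: "\<not> P (cell j x)" if "j0 \<le> j" "j < J x" for j x
    using not_less_Least[OF that(2)[unfolded J_def]] that by auto
  have root: "cell j0 x = cell j0 x0" if "x \<in> E" for x
    using that assms(2) by (intro cell_eq) auto
  have J_gt: "j0 < J x" if "x \<in> E" for x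
    using J[OF that] root[OF that] assms(1) le_neq_implies_less by metis
  define \<Q> where "\<Q> = (\<lambda>x. cell (J x) x) ` E"
  show ?thesis
  proof
    show "countable \<Q>"
      by (rule countable_subset[OF _ countable_cells]) (auto simp: \<Q>_def)
    show "disjoint \<Q>"
    proof (clarsimp simp: \<Q>_def disjoint_def)
      fix x y assume xy: "x \<in> E" "y \<in> E" and ne: "cell (J x) x \<noteq> cell (J y) y"
      have "cell (J x) x = cell (J y) y" if z: "z \<in> cell (J x) x" "z \<in> cell (J y) y"
        and le: "J x \<le> J y" and xy: "x \<in> E" "y \<in> E" for x y z
      proof -
        have "cell (J x) y = cell (J x) x"
          using z cell_mono[OF le, of y] by (metis cell_eq subsetD)
        then have "\<not> J x < J y"
          using J_least[of "J x" y] J[OF xy(1)] by auto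
        then show ?thesis
          using \<open>cell (J x) y = cell (J x) x\<close> le by auto
      qed
      then show "cell (J x) x \<inter> cell (J y) y = {}"
        using xy ne nat_le_linear[of "J x" "J y"] by blast
    qed
    show "\<Q> \<subseteq> sets lborel" by (auto simp: \<Q>_def)
    show "E \<subseteq> \<Union>\<Q>" by (auto simp: \<Q>_def)
    show "\<Union>\<Q> \<subseteq> cell j0 x0"
      using J(1) cell_mono root by (fastforce simp: \<Q>_def)
    show "P Q" if "Q \<in> \<Q>" for Q
      using that J by (auto simp: \<Q>_def)
    show "\<exists>j x. j0 \<le> j \<and> x \<in> cell j0 x0 \<and> Q = cell (Suc j) x \<and> \<not> P (cell j x)" if "Q \<in> \<Q>" for Q
    proof -
      obtain x where x: "x \<in> E" "Q = cell (J x) x" using \<open>Q \<in> \<Q>\<close> by (auto simp: \<Q>_def)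
      have "j0 \<le> J x - 1" "J x = Suc (J x - 1)" "\<not> P (cell (J x - 1) x)"
        using J_gt[OF x(1)] J_least[of "J x - 1" x] by auto
      then show ?thesis
        using x assms(2) by (metis subsetD)
    qed
  qed
qed

section \<open>Good functions and quantitative nondivergence\<close>

text \<open>
  Read with \<open>y\<close> running over the cell, the condition says that the supremum of \<open>\<bar>F\<bar>\<close> on a
  child is at least \<open>\<kappa>\<close> times the supremum on its parent.
\<close>

definition doubling :: "nat \<Rightarrow> real ^ 'd::finite \<Rightarrow> real \<Rightarrow> (real ^ 'd \<Rightarrow> real) \<Rightarrow> bool" where
  "doubling j0 x0 \<kappa> F \<longleftrightarrow> (\<forall>j\<ge>j0. \<forall>x\<in>cell j0 x0. \<forall>y\<in>cell j x.
     \<exists>y'\<in>cell (Suc j) x. \<kappa> * \<bar>F y\<bar> \<le> \<bar>F y'\<bar>)"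

definition sublevel_small ::
  "nat \<Rightarrow> real ^ 'd::finite \<Rightarrow> real \<Rightarrow> ennreal \<Rightarrow> (real ^ 'd \<Rightarrow> real) \<Rightarrow> bool" where
  "sublevel_small j0 x0 \<delta> \<theta> F \<longleftrightarrow> (\<forall>j\<ge>j0. \<forall>x\<in>cell j0 x0. \<forall>y\<in>cell j x.
     outer_le {x' \<in> cell j x. \<bar>F x'\<bar> < \<delta> * \<bar>F y\<bar>} (\<theta> * emeasure lborel (cell j x)))"

text \<open>
  The proportion of the cell on which \<open>\<bar>F\<bar>\<close> is below \<open>\<epsilon>\<close> times its supremum is at most a
  power of \<open>\<epsilon>\<close>, sampled at \<open>\<epsilon> = \<mu>\<^sup>i\<close>: this is the notion of a \<open>(C, \<alpha>)\<close>-good function of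
  Kleinbock and Margulis with \<open>\<theta> = \<mu>\<^sup>\<alpha>\<close>.
\<close>

definition good ::
  "nat \<Rightarrow> real ^ 'd::finite \<Rightarrow> real \<Rightarrow> ennreal \<Rightarrow> (real ^ 'd \<Rightarrow> real) \<Rightarrow> bool" where
  "good j0 x0 \<mu> \<theta> F \<longleftrightarrow> (\<forall>i. sublevel_small j0 x0 (\<mu> ^ i) (\<theta> ^ i) F)"

lemma continuous_on_cell_less:
  assumes "continuous_on (cell j0 x0) F" "x \<in> cell j0 x0" "j0 \<le> j" "\<bar>F x\<bar> < (a :: real)"
  shows "\<exists>k\<ge>j. \<forall>y\<in>cell k x. \<bar>F y\<bar> < a"
proof -
  obtain d where d: "d > 0" "\<And>y. y \<in> cell j0 x0 \<Longrightarrow> dist y x < d \<Longrightarrow> dist (F y) (F x) < a - \<bar>F x\<bar>"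
    using assms(1,2,4) unfolding continuous_on_iff by (metis diff_gt_0_iff_gt)
  obtain k where k: "\<And>i. i \<ge> k \<Longrightarrow> cell i x \<subseteq> ball x d"
    using cell_in_ball[OF d(1)] by blast
  have "\<bar>F y\<bar> < a" if "y \<in> cell (max j k) x" for y
  proof -
    have "y \<in> cell j0 x"
      using that cell_mono[of j0 "max j k" x] assms(3) max.coboundedI1[of j0 j k] by blast
    then have "y \<in> cell j0 x0" using cell_eq[OF assms(2)] by simp
    moreover have "dist y x < d" using k[of "max j k"] that by (auto simp: dist_commute)
    ultimately have "dist (F y) (F x) < a - \<bar>F x\<bar>" using d(2) by blast
    then show ?thesis by (simp add: dist_real_def)
  qed
  then show ?thesis by (intro exI[of _ "max j k"]) auto
qed

lemma subcell: "x \<in> cell j0 x0 \<Longrightarrow> j0 \<le> j \<Longrightarrow> cell j x \<subseteq> cell j0 x0"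
  using cell_mono cell_eq by metis

text \<open>
  A single sublevel estimate improves itself.  On the maximal cells where \<open>\<bar>F\<bar> < \<delta> \<bar>F y\<bar>\<close>
  the supremum of \<open>\<bar>F\<bar>\<close> is at least \<open>\<kappa> \<delta> \<bar>F y\<bar>\<close>, since the parent is not such a cell; so
  the estimate for the exponent \<open>i\<close> applies inside these cells, and together they fill only the fraction
  \<open>\<theta>\<close> of the original one.
\<close>

lemma doubling_imp_good:
  fixes x0 :: "real ^ 'd::finite"
  assumes cont: "continuous_on (cell j0 x0) F"
    and dbl: "doubling j0 x0 \<kappa> F" and sub: "sublevel_small j0 x0 \<delta> \<theta> F"
    and \<kappa>: "0 < \<kappa>" "\<kappa> \<le> 1" and \<delta>: "0 < \<delta>" "\<delta> \<le> 1"
  shows "good j0 x0 (\<kappa> * \<delta>) \<theta> F"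
  unfolding good_def
proof
  fix i
  show "sublevel_small j0 x0 ((\<kappa> * \<delta>) ^ i) (\<theta> ^ i) F"
  proof (induction i)
    case 0
    show ?case
      unfolding sublevel_small_def outer_le_def by (auto intro!: bexI[of _ "cell _ _"])
  next
    case (Suc i)
    have "outer_le {x' \<in> cell j x. \<bar>F x'\<bar> < (\<kappa> * \<delta>) ^ Suc i * \<bar>F y\<bar>} (\<theta> ^ Suc i * emeasure lborel (cell j x))"
      if j: "j0 \<le> j" and x: "x \<in> cell j0 x0" and y: "y \<in> cell j x" for j x y
    proof -
      define E where "E = {x' \<in> cell j x. \<bar>F x'\<bar> < (\<kappa> * \<delta>) ^ Suc i * \<bar>F y\<bar>}"
      define P where "P Q \<longleftrightarrow> (\<forall>x'\<in>Q. \<bar>F x'\<bar> < \<delta> * \<bar>F y\<bar>)" for Q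
      have le: "(\<kappa> * \<delta>) ^ Suc i \<le> \<delta>"
      proof -
        have "(\<kappa> * \<delta>) ^ Suc i \<le> (\<kappa> * \<delta>) ^ 1"
          using \<kappa> \<delta> by (intro power_decreasing) (auto intro: mult_le_one)
        also have "\<dots> \<le> \<delta>" using \<kappa> \<delta> by (simp add: mult_left_le_one_le)
        finally show ?thesis .
      qed
      have nP: "\<not> P (cell j x)"
        using y \<delta> mult_left_le_one_le[of "\<bar>F y\<bar>" \<delta>] unfolding P_def by force
      have EP: "\<exists>k\<ge>j. P (cell k x')" if "x' \<in> E" for x'
      proof -
        have "x' \<in> cell j0 x0" "\<bar>F x'\<bar> < \<delta> * \<bar>F y\<bar>"
          using that subcell[OF x j] mult_right_mono[OF le, of "\<bar>F y\<bar>"] by (auto simp: E_def)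
        from continuous_on_cell_less[OF cont this(1) j this(2)] show ?thesis
          unfolding P_def by auto
      qed
      obtain \<Q> where \<Q>: "countable \<Q>" "disjoint \<Q>" "\<Q> \<subseteq> sets lborel" "E \<subseteq> \<Union>\<Q>" "\<Union>\<Q> \<subseteq> cell j x"
        and PQ: "\<And>Q. Q \<in> \<Q> \<Longrightarrow> P Q"
        and par: "\<And>Q. Q \<in> \<Q> \<Longrightarrow> \<exists>j' x'. j \<le> j' \<and> x' \<in> cell j x \<and> Q = cell (Suc j') x' \<and> \<not> P (cell j' x')"
        using stopping_cells[of P j x E, OF nP _ EP] unfolding E_def by blast
      have "outer_le (E \<inter> Q) (\<theta> ^ i * emeasure lborel Q)" if QQ: "Q \<in> \<Q>" for Q
      proof -
        obtain j' x' where j': "j \<le> j'" "x' \<in> cell j x" and Q: "Q = cell (Suc j') x'"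
          and "\<not> P (cell j' x')"
          using par[OF QQ] by blast
        then obtain y1 where y1: "y1 \<in> cell j' x'" "\<delta> * \<bar>F y\<bar> \<le> \<bar>F y1\<bar>"
          by (auto simp: P_def not_less)
        have x': "x' \<in> cell j0 x0" "j0 \<le> j'" using j' j subcell[OF x j] by auto
        then obtain y2 where y2: "y2 \<in> Q" "\<kappa> * \<bar>F y1\<bar> \<le> \<bar>F y2\<bar>"
          using dbl y1(1) unfolding doubling_def Q by blast
        have ge: "\<kappa> * \<delta> * \<bar>F y\<bar> \<le> \<bar>F y2\<bar>"
          using order_trans[OF mult_left_mono[OF y1(2), of \<kappa>] y2(2)] \<kappa> by (simp add: mult.assoc)
        have "outer_le {z \<in> Q. \<bar>F z\<bar> < (\<kappa> * \<delta>) ^ i * \<bar>F y2\<bar>} (\<theta> ^ i * emeasure lborel Q)"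
          using Suc.IH x' y2(1) unfolding sublevel_small_def Q by auto
        moreover have "E \<inter> Q \<subseteq> {z \<in> Q. \<bar>F z\<bar> < (\<kappa> * \<delta>) ^ i * \<bar>F y2\<bar>}"
          using mult_left_mono[OF ge, of "(\<kappa> * \<delta>) ^ i"] \<kappa> \<delta>
          by (auto simp: E_def power_Suc2 mult.assoc simp del: power_Suc intro: less_le_trans)
        ultimately show ?thesis by (rule outer_le_mono) simp
      qed
      from outer_le_UN_disjoint[OF \<Q>(1,2,3) this \<Q>(4)]
      have "outer_le E (\<theta> ^ i * emeasure lborel (\<Union>\<Q>))" .
      moreover have "emeasure lborel (\<Union>\<Q>) \<le> \<theta> * emeasure lborel (cell j x)"
      proof -
        obtain N where "N \<in> sets lborel" "{x' \<in> cell j x. \<bar>F x'\<bar> < \<delta> * \<bar>F y\<bar>} \<subseteq> N"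
            "emeasure lborel N \<le> \<theta> * emeasure lborel (cell j x)"
          using sub j x y unfolding sublevel_small_def outer_le_def by meson
        moreover have "\<Union>\<Q> \<subseteq> {x' \<in> cell j x. \<bar>F x'\<bar> < \<delta> * \<bar>F y\<bar>}"
          using PQ \<Q>(5) unfolding P_def by blast
        ultimately show ?thesis
          by (meson emeasure_mono order_trans)
      qed
      ultimately have "outer_le E (\<theta> ^ i * (\<theta> * emeasure lborel (cell j x)))"
        by (meson outer_le_mono mult_left_mono order_refl zero_le)
      then show ?thesis unfolding E_def by (simp add: ac_simps)
    qed
    then show ?case unfolding sublevel_small_def by blast
  qed
qed

text \<open>
  For covolumes this certifies that a lattice has no short vector.  The bounds \<open>a\<close> and \<open>r\<close> keep
  covolumes from being small in the flag \<open>W\<close> and next to it, and the bound 1 turns a lower bound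
  for the span of a member and one more vector into a lower bound for the length of that vector.
\<close>

definition marked :: "('s \<Rightarrow> 'x \<Rightarrow> real) \<Rightarrow> ('s \<Rightarrow> 's \<Rightarrow> bool) \<Rightarrow> 's set \<Rightarrow> real \<Rightarrow> real \<Rightarrow> 'x \<Rightarrow> bool" where
  "marked \<psi> cmp P a r y \<longleftrightarrow> (\<exists>W\<subseteq>P. (\<forall>s\<in>W. \<forall>t\<in>W. cmp s t) \<and>
     (\<forall>s\<in>W. a \<le> \<psi> s y \<and> \<psi> s y < 1) \<and>
     (\<forall>s\<in>P. s \<notin> W \<longrightarrow> (\<forall>w\<in>W. cmp s w) \<longrightarrow> r \<le> \<psi> s y))"

text \<open>
  Quantitative nondivergence for functions indexed by a poset.  The induction is on the number \<open>l\<close>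
  of ranks that occur in \<open>P\<close>.  Outside the stopping cells, where some \<open>\<psi> s\<close> stays below
  \<open>\<rho>\<close>, every value is at least \<open>\<rho>\<close> and the empty flag will do.  Inside a stopping cell for \<open>s\<close>
  all suprema are at least \<open>\<kappa> \<rho>\<close> by doubling.  The points where \<open>\<psi> s\<close> is below the threshold
  are discarded by goodness, and the induction hypothesis supplies a flag among the elements
  comparable with \<open>s\<close>, none of which has the rank of \<open>s\<close>; adding \<open>s\<close> to it
  gives the flag sought.
\<close>

theorem nondivergence:
  fixes \<psi> :: "'s \<Rightarrow> real ^ 'd::finite \<Rightarrow> real" and rk :: "'s \<Rightarrow> nat"
  assumes cont: "\<And>s. s \<in> S \<Longrightarrow> continuous_on (cell j0 x0) (\<psi> s)"
    and nonneg: "\<And>s x. s \<in> S \<Longrightarrow> 0 \<le> \<psi> s x"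
    and dbl: "\<And>s. s \<in> S \<Longrightarrow> doubling j0 x0 \<kappa> (\<psi> s)"
    and good: "\<And>s. s \<in> S \<Longrightarrow> good j0 x0 \<mu> \<theta> (\<psi> s)"
    and refl: "\<And>s. cmp s s" and sym: "\<And>s t. cmp s t \<Longrightarrow> cmp t s"
    and rk: "\<And>s t. s \<in> S \<Longrightarrow> t \<in> S \<Longrightarrow> cmp s t \<Longrightarrow> s \<noteq> t \<Longrightarrow> rk s \<noteq> rk t"
    and \<kappa>: "0 < \<kappa>" "\<kappa> \<le> 1" and \<mu>: "0 < \<mu>" and r0: "0 < r0"
    and "P \<subseteq> S" "finite (rk ` P)" "card (rk ` P) \<le> l" "r0 \<le> \<kappa> ^ l * \<rho>" "\<rho> \<le> 1"
    and "j0 \<le> j" "x \<in> cell j0 x0"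
    and "\<And>s. s \<in> P \<Longrightarrow> \<exists>y\<in>cell j x. \<rho> \<le> \<psi> s y"
  shows "outer_le {y \<in> cell j x. \<not> marked \<psi> cmp P (\<mu> ^ i * r0) r0 y}
           (of_nat l * \<theta> ^ i * emeasure lborel (cell j x))"
  using assms(12-)
proof (induction l arbitrary: P \<rho> j x)
  case 0
  then have "P = {}" by auto
  then have "{y \<in> cell j x. \<not> marked \<psi> cmp P (\<mu> ^ i * r0) r0 y} = {}"
    by (auto simp: marked_def)
  then show ?case by (auto simp: outer_le_def)
next
  case (Suc l)
  note PS = Suc.prems(1) and fin = Suc.prems(2) and crd = Suc.prems(3) and r0\<rho> = Suc.prems(4)
    and \<rho>1 = Suc.prems(5) and j = Suc.prems(6) and x = Suc.prems(7) and big = Suc.prems(8)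
  have \<rho>0: "0 < \<rho>"
    using less_le_trans[OF r0 r0\<rho>] \<kappa>(1) zero_less_power[OF \<kappa>(1), of "Suc l"]
    by (metis not_less_iff_gr_or_eq zero_less_mult_iff)
  have r0_le: "r0 \<le> \<rho>"
    using order_trans[OF r0\<rho> mult_left_le_one_le] \<kappa> \<rho>0 power_le_one[of \<kappa> "Suc l"]
    by (simp del: power_Suc)
  define E where "E = {y \<in> cell j x. \<not> marked \<psi> cmp P (\<mu> ^ i * r0) r0 y}"
  define Pr where "Pr Q \<longleftrightarrow> (\<exists>s\<in>P. \<forall>y\<in>Q. \<psi> s y < \<rho>)" for Q
  have nPr: "\<not> Pr (cell j x)"
    using big unfolding Pr_def by (meson not_less)
  have EP: "\<exists>k\<ge>j. Pr (cell k y)" if "y \<in> E" for y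
  proof -
    have "\<exists>s\<in>P. \<psi> s y < \<rho>"
    proof (rule ccontr)
      assume "\<not> ?thesis"
      then have "marked \<psi> cmp P (\<mu> ^ i * r0) r0 y"
        using r0_le unfolding marked_def by (intro exI[of _ "{}"]) force
      then show False using that by (simp add: E_def)
    qed
    then obtain s where s: "s \<in> P" "\<psi> s y < \<rho>" by blast
    have "y \<in> cell j0 x0" using that subcell[OF x j] by (auto simp: E_def)
    from continuous_on_cell_less[OF cont this j, of s \<rho>] s PS nonneg[of s]
    show ?thesis unfolding Pr_def by fastforce
  qed
  obtain \<Q> where \<Q>: "countable \<Q>" "disjoint \<Q>" "\<Q> \<subseteq> sets lborel" "E \<subseteq> \<Union>\<Q>" "\<Union>\<Q> \<subseteq> cell j x"
    and PQ: "\<And>Q. Q \<in> \<Q> \<Longrightarrow> Pr Q"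
    and par: "\<And>Q. Q \<in> \<Q> \<Longrightarrow> \<exists>j' x'. j \<le> j' \<and> x' \<in> cell j x \<and> Q = cell (Suc j') x' \<and> \<not> Pr (cell j' x')"
    using stopping_cells[of Pr j x E, OF nPr _ EP] unfolding E_def by blast
  have "outer_le (E \<inter> Q) (of_nat (Suc l) * \<theta> ^ i * emeasure lborel Q)" if QQ: "Q \<in> \<Q>" for Q
  proof -
    obtain j' x' where j': "j \<le> j'" "x' \<in> cell j x" and Q: "Q = cell (Suc j') x'"
      and nP: "\<not> Pr (cell j' x')"
      using par[OF QQ] by blast
    have x': "x' \<in> cell j0 x0" "j0 \<le> j'" using j' j subcell[OF x j] by auto
    have big': "\<exists>y\<in>Q. \<kappa> * \<rho> \<le> \<psi> s y" if sP: "s \<in> P" for s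
    proof -
      obtain y where y: "y \<in> cell j' x'" "\<rho> \<le> \<psi> s y"
        using nP sP by (auto simp: Pr_def not_less)
      have s: "s \<in> S" using sP PS by auto
      obtain y' where "y' \<in> Q" "\<kappa> * \<bar>\<psi> s y\<bar> \<le> \<bar>\<psi> s y'\<bar>"
        using dbl[OF s] x' y(1) unfolding doubling_def Q by blast
      moreover have "\<kappa> * \<rho> \<le> \<kappa> * \<psi> s y" using y(2) \<kappa> by simp
      ultimately show ?thesis using nonneg[OF s] by (intro bexI[of _ y']) auto
    qed
    obtain s where s: "s \<in> P" "\<And>y. y \<in> Q \<Longrightarrow> \<psi> s y < \<rho>"
      using PQ[OF QQ] by (auto simp: Pr_def)
    have sS: "s \<in> S" using s PS by auto
    define P' where "P' = {t \<in> P. cmp t s \<and> t \<noteq> s}"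
    have sub: "rk ` P' \<subseteq> rk ` P" "P' \<subseteq> P" by (auto simp: P'_def)
    have "rk s \<notin> rk ` P'"
    proof
      assume "rk s \<in> rk ` P'"
      then obtain t where "t \<in> P" "cmp t s" "t \<noteq> s" "rk s = rk t" by (auto simp: P'_def)
      then show False using rk[of t s] sS PS by auto
    qed
    moreover have "rk s \<in> rk ` P" using s by auto
    ultimately have pss: "rk ` P' \<subset> rk ` P" using sub by blast
    then have "card (rk ` P') \<le> l"
      using psubset_card_mono[OF fin pss] crd by linarith
    moreover have "finite (rk ` P')" using finite_subset[OF sub(1) fin] .
    moreover have "r0 \<le> \<kappa> ^ l * (\<kappa> * \<rho>)" using r0\<rho> by (simp add: ac_simps)
    moreover have "\<kappa> * \<rho> \<le> 1" using \<rho>1 \<rho>0 \<kappa> by (simp add: mult_le_one)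
    ultimately have "outer_le {y \<in> Q. \<not> marked \<psi> cmp P' (\<mu> ^ i * r0) r0 y}
        (of_nat l * \<theta> ^ i * emeasure lborel Q)"
      unfolding Q using Suc.IH[OF order_trans[OF sub(2) PS], of "\<kappa> * \<rho>" "Suc j'" x']
        big' sub(2) x' unfolding Q by (meson le_SucI subsetD)
    moreover have "outer_le {y \<in> Q. \<psi> s y < \<mu> ^ i * r0} (\<theta> ^ i * emeasure lborel Q)"
    proof -
      obtain y where y: "y \<in> Q" "\<kappa> * \<rho> \<le> \<psi> s y" using big'[OF s(1)] by blast
      have "r0 \<le> \<kappa> * \<rho>"
      proof -
        have "\<kappa> ^ Suc l * \<rho> \<le> \<kappa> ^ 1 * \<rho>"
          using \<kappa> \<rho>0 by (intro mult_right_mono power_decreasing) auto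
        then show ?thesis using r0\<rho> by simp
      qed
      then have "\<mu> ^ i * r0 \<le> \<mu> ^ i * \<psi> s y"
        using y(2) \<mu> by (intro mult_left_mono) auto
      then have "{y \<in> Q. \<psi> s y < \<mu> ^ i * r0} \<subseteq> {z \<in> Q. \<bar>\<psi> s z\<bar> < \<mu> ^ i * \<bar>\<psi> s y\<bar>}"
        using nonneg[OF sS] by auto
      moreover have "outer_le {z \<in> Q. \<bar>\<psi> s z\<bar> < \<mu> ^ i * \<bar>\<psi> s y\<bar>} (\<theta> ^ i * emeasure lborel Q)"
        using good[OF sS] x' y(1) unfolding good_def sublevel_small_def Q by auto
      ultimately show ?thesis using outer_le_mono by blast
    qed
    ultimately have "outer_le ({y \<in> Q. \<not> marked \<psi> cmp P' (\<mu> ^ i * r0) r0 y} \<union> {y \<in> Q. \<psi> s y < \<mu> ^ i * r0})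
        (of_nat l * \<theta> ^ i * emeasure lborel Q + \<theta> ^ i * emeasure lborel Q)"
      by (rule outer_le_Un)
    moreover have "E \<inter> Q \<subseteq> {y \<in> Q. \<not> marked \<psi> cmp P' (\<mu> ^ i * r0) r0 y} \<union> {y \<in> Q. \<psi> s y < \<mu> ^ i * r0}"
    proof clarsimp
      fix y assume y: "y \<in> E" "y \<in> Q" "\<not> \<psi> s y < \<mu> ^ i * r0" "marked \<psi> cmp P' (\<mu> ^ i * r0) r0 y"
      then obtain W where W: "W \<subseteq> P'" "\<forall>s\<in>W. \<forall>t\<in>W. cmp s t"
          "\<forall>s\<in>W. \<mu> ^ i * r0 \<le> \<psi> s y \<and> \<psi> s y < 1"
          "\<forall>s\<in>P'. s \<notin> W \<longrightarrow> (\<forall>w\<in>W. cmp s w) \<longrightarrow> r0 \<le> \<psi> s y"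
        unfolding marked_def by auto
      have "marked \<psi> cmp P (\<mu> ^ i * r0) r0 y"
        unfolding marked_def
      proof (intro exI[of _ "insert s W"] conjI)
        show "insert s W \<subseteq> P" using W(1) s(1) sub by auto
        show "\<forall>t\<in>insert s W. \<forall>u\<in>insert s W. cmp t u"
          using W(1,2) refl sym by (auto simp: P'_def subset_iff)
        show "\<forall>t\<in>insert s W. \<mu> ^ i * r0 \<le> \<psi> t y \<and> \<psi> t y < 1"
          using W(3) y(2,3) s(2) \<rho>1 by fastforce
        show "\<forall>t\<in>P. t \<notin> insert s W \<longrightarrow> (\<forall>w\<in>insert s W. cmp t w) \<longrightarrow> r0 \<le> \<psi> t y"
          using W(4) by (auto simp: P'_def)
      qed
      then show False using y(1) by (simp add: E_def)
    qed
    ultimately have "outer_le (E \<inter> Q) (of_nat l * \<theta> ^ i * emeasure lborel Q + \<theta> ^ i * emeasure lborel Q)"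
      by (rule outer_le_mono) simp
    then show ?thesis by (simp add: algebra_simps)
  qed
  from outer_le_UN_disjoint[OF \<Q>(1,2,3) this \<Q>(4)]
  have "outer_le E (of_nat (Suc l) * \<theta> ^ i * emeasure lborel (\<Union>\<Q>))" .
  moreover have "emeasure lborel (\<Union>\<Q>) \<le> emeasure lborel (cell j x)"
    using \<Q>(5) by (rule emeasure_mono) simp
  ultimately show ?case
    unfolding E_def[symmetric] by (meson outer_le_mono mult_left_mono order_refl zero_le)
qed

section \<open>Iterated differences of functions of class \<open>C\<^sup>k\<close>\<close>

definition diff1 :: "'a::real_vector \<Rightarrow> ('a \<Rightarrow> 'b::real_normed_vector) \<Rightarrow> 'a \<Rightarrow> 'b" where
  "diff1 v g x = g (x + v) - g x"

abbreviation iter_diff :: "'a::real_vector list \<Rightarrow> ('a \<Rightarrow> 'b::real_normed_vector) \<Rightarrow> 'a \<Rightarrow> 'b" where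
  "iter_diff vs \<equiv> foldr diff1 vs"

text \<open>
  The points at which \<open>iter_diff vs g x\<close> evaluates \<open>g\<close>.
\<close>

fun partial_sums :: "'a::real_vector list \<Rightarrow> 'a \<Rightarrow> 'a set" where
  "partial_sums [] x = {x}"
| "partial_sums (v # vs) x = partial_sums vs (x + v) \<union> partial_sums vs x"

lemma iter_diff_Cons: "iter_diff (v # vs) g x = iter_diff vs g (x + v) - iter_diff vs g x"
  by (simp add: diff1_def)

lemma iter_diff_snoc: "iter_diff (vs @ [v]) g x = iter_diff vs g (x + v) - iter_diff vs g x"
proof (induction vs arbitrary: x)
  case (Cons u vs)
  then show ?case
    by (simp only: append_Cons iter_diff_Cons) (simp add: algebra_simps)
qed (simp add: diff1_def)

lemma iter_diff_sum_scaleR: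
  "iter_diff vs (\<lambda>z. \<Sum>i\<in>I. c i *\<^sub>R g i z) x = (\<Sum>i\<in>I. c i *\<^sub>R iter_diff vs (g i) x)"
  by (induction vs arbitrary: x) (simp, simp only: iter_diff_Cons sum_subtractf scaleR_diff_right)

text \<open>
  One difference removes the constant, so from then on \<open>c\<^sub>0 + c \<bullet> g\<close> behaves like
  \<open>c \<bullet> g\<close>.  The calculus can therefore be done once for the vector valued map.
\<close>

lemma iter_diff_affine:
  fixes g :: "'a::real_vector \<Rightarrow> 'b::real_inner"
  shows "vs \<noteq> [] \<Longrightarrow> iter_diff vs (\<lambda>x. c0 + c \<bullet> g x) x = c \<bullet> iter_diff vs g x"
proof (induction vs arbitrary: x)
  case (Cons v vs)
  then show ?case
    by (cases "vs = []") (simp add: diff1_def inner_diff_right, simp only: iter_diff_Cons inner_diff_right not_False_eq_True)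
qed simp

lemma iter_diff_has_vector_derivative:
  assumes "\<And>z. z \<in> partial_sums vs x \<Longrightarrow> ((\<lambda>t. g (z + t *\<^sub>R u)) has_vector_derivative g' z) (at 0)"
  shows "((\<lambda>t. iter_diff vs g (x + t *\<^sub>R u)) has_vector_derivative iter_diff vs g' x) (at 0)"
  using assms
proof (induction vs arbitrary: x)
  case (Cons v vs)
  have "((\<lambda>t. iter_diff vs g (x + v + t *\<^sub>R u) - iter_diff vs g (x + t *\<^sub>R u)) has_vector_derivative
      iter_diff vs g' (x + v) - iter_diff vs g' x) (at 0)"
    by (intro has_vector_derivative_diff Cons.IH Cons.prems) auto
  then show ?case
    unfolding iter_diff_Cons by (simp only: add_ac)
qed simp

lemma has_vector_derivative_shift:
  fixes G :: "'a::real_vector \<Rightarrow> 'b::real_normed_vector"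
  assumes "((\<lambda>s. G (x + t *\<^sub>R u + s *\<^sub>R u)) has_vector_derivative D) (at 0)"
  shows "((\<lambda>s. G (x + s *\<^sub>R u)) has_vector_derivative D) (at t)"
proof -
  have "((\<lambda>s. s - t) has_vector_derivative 1) (at t)"
    by (auto intro!: derivative_eq_intros)
  from vector_diff_chain_at[OF this, of "\<lambda>s. G (x + t *\<^sub>R u + s *\<^sub>R u)" D] assms
  show ?thesis by (simp add: o_def algebra_simps)
qed

lemma mvt_linearization:
  fixes g :: "real \<Rightarrow> 'b::real_normed_vector"
  assumes "\<And>t. t \<in> closed_segment 0 a \<Longrightarrow> (g has_vector_derivative g' t) (at t)"
    and "\<And>t. t \<in> closed_segment 0 a \<Longrightarrow> norm (g' t - c) \<le> B"
  shows "norm (g a - g 0 - a *\<^sub>R c) \<le> \<bar>a\<bar> * B"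
proof -
  define h where "h s = g s - s *\<^sub>R c" for s
  have "norm (h a - h 0) \<le> B * norm (a - 0)"
  proof (rule differentiable_bound[of "closed_segment 0 a" h "\<lambda>t s. s *\<^sub>R (g' t - c)"])
    fix t assume t: "t \<in> closed_segment 0 a"
    have "(h has_vector_derivative g' t - c) (at t)"
      unfolding h_def using assms(1)[OF t] by (auto intro!: derivative_eq_intros)
    then show "(h has_derivative (\<lambda>s. s *\<^sub>R (g' t - c))) (at t within closed_segment 0 a)"
      unfolding has_vector_derivative_def by (rule has_derivative_at_withinI)
    show "onorm (\<lambda>s. s *\<^sub>R (g' t - c)) \<le> B"
      using assms(2)[OF t] by (intro onorm_le) (simp add: mult.commute[of B] mult_left_mono)
  qed auto
  moreover have "h a - h 0 = g a - g 0 - a *\<^sub>R c" by (simp add: h_def)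
  ultimately show ?thesis by (simp add: mult.commute)
qed

lemma Ck_on_continuous: "Ck_on k U f \<Longrightarrow> continuous_on U f"
  by (cases k) auto

lemma Ck_on_foldr_partial_deriv:
  "Ck_on (length w + k) U f \<Longrightarrow> Ck_on k U (foldr partial_deriv w f)"
  by (induction w arbitrary: f rule: rev_induct) auto

lemma Ck_on_partial:
  assumes "Ck_on (Suc k) U f" "x \<in> U"
  shows "((\<lambda>t. f (x + t *\<^sub>R axis i 1)) has_vector_derivative partial_deriv i f x) (at 0)"
  using assms by (simp add: partial_deriv_def vector_derivative_works[symmetric])

text \<open>
  Continuous partial derivatives give total differentiability: pass from \<open>x\<close> to \<open>y\<close> changing one
  coordinate after the other and apply the mean value estimate to each change.
\<close>

lemma Ck_on_has_derivative:
  fixes f :: "real ^ 'd::finite \<Rightarrow> 'b::real_normed_vector"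
  assumes C: "Ck_on (Suc k) U f" and "open U" and x: "x \<in> U"
  shows "(f has_derivative (\<lambda>v. \<Sum>i\<in>UNIV. v $ i *\<^sub>R partial_deriv i f x)) (at x)"
  unfolding has_derivative_at_alt
proof (intro conjI allI impI)
  show "bounded_linear (\<lambda>v. \<Sum>i\<in>UNIV. v $ i *\<^sub>R partial_deriv i f x)"
    by (intro bounded_linear_sum bounded_linear_scaleR_const bounded_linear_vec_nth)
  fix e :: real assume e: "e > 0"
  define e' where "e' = e / real CARD('d)"
  have e': "e' > 0" using e by (simp add: e'_def)
  have "\<forall>i. \<exists>d>0. \<forall>z. dist z x < d \<longrightarrow> z \<in> U \<and> dist (partial_deriv i f z) (partial_deriv i f x) < e'"
  proof
    fix i
    have "continuous_on U (partial_deriv i f)"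
      using C by (auto intro: Ck_on_continuous)
    then obtain d1 where d1: "d1 > 0" "\<And>z. z \<in> U \<Longrightarrow> dist z x < d1 \<Longrightarrow> dist (partial_deriv i f z) (partial_deriv i f x) < e'"
      using x e' unfolding continuous_on_iff by meson
    obtain d2 where d2: "d2 > 0" "ball x d2 \<subseteq> U"
      using \<open>open U\<close> x open_contains_ball by blast
    show "\<exists>d>0. \<forall>z. dist z x < d \<longrightarrow> z \<in> U \<and> dist (partial_deriv i f z) (partial_deriv i f x) < e'"
      using d1 d2 by (intro exI[of _ "min d1 d2"]) (auto simp: subset_iff dist_commute)
  qed
  then obtain d where d: "\<And>i. d i > 0"
      "\<And>i z. dist z x < d i \<Longrightarrow> z \<in> U \<and> dist (partial_deriv i f z) (partial_deriv i f x) < e'"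
    by metis
  define d0 where "d0 = Min (range d)"
  have d0: "d0 > 0" "\<And>i. d0 \<le> d i" using d(1) by (auto simp: d0_def)
  have "norm (f y - f x - (\<Sum>i\<in>UNIV. (y - x) $ i *\<^sub>R partial_deriv i f x)) \<le> e * norm (y - x)"
    if y: "norm (y - x) < d0" for y
  proof -
    define v where "v = y - x"
    define s where "s S = (\<Sum>i\<in>S. v $ i *\<^sub>R axis i (1::real))" for S
    have s_nth: "s S $ i = (if i \<in> S then v $ i else 0)" if "finite S" for S i
    proof -
      have "s S $ i = (\<Sum>j\<in>S. if i = j then v $ j else 0)"
        unfolding s_def sum_component by (rule sum.cong) (auto simp: axis_def)
      then show ?thesis using that by simp
    qed
    have "norm (f (x + s S) - f x - (\<Sum>i\<in>S. v $ i *\<^sub>R partial_deriv i f x)) \<le> (\<Sum>i\<in>S. \<bar>v $ i\<bar> * e')" for S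
      using finite[of S]
    proof (induction S rule: finite_induct)
      case empty
      show ?case by (simp add: s_def)
    next
      case (insert i S)
      have pt: "dist (x + s S + t *\<^sub>R axis i 1) x < d0" if t: "t \<in> closed_segment 0 (v $ i)" for t
      proof -
        have "\<bar>t\<bar> \<le> \<bar>v $ i\<bar>" using t by (auto simp: closed_segment_eq_real_ivl split: if_splits)
        then have "norm (s S + t *\<^sub>R axis i 1) \<le> norm v"
          using insert.hyps by (intro norm_le_componentwise_cart) (auto simp: s_nth axis_def)
        then show ?thesis using y by (simp add: dist_norm v_def add.assoc)
      qed
      have "norm (f (x + s S + v $ i *\<^sub>R axis i 1) - f (x + s S + 0 *\<^sub>R axis i 1) - v $ i *\<^sub>R partial_deriv i f x)
          \<le> \<bar>v $ i\<bar> * e'"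
      proof (rule mvt_linearization[where g' = "\<lambda>t. partial_deriv i f (x + s S + t *\<^sub>R axis i 1)"])
        fix t assume t: "t \<in> closed_segment 0 (v $ i)"
        have "dist (x + s S + t *\<^sub>R axis i 1) x < d i"
          using pt[OF t] d0(2)[of i] by linarith
        from d(2)[OF this]
        have *: "x + s S + t *\<^sub>R axis i 1 \<in> U"
            "dist (partial_deriv i f (x + s S + t *\<^sub>R axis i 1)) (partial_deriv i f x) < e'"
          by auto
        show "((\<lambda>t. f (x + s S + t *\<^sub>R axis i 1)) has_vector_derivative
            partial_deriv i f (x + s S + t *\<^sub>R axis i 1)) (at t)"
          by (rule has_vector_derivative_shift, rule Ck_on_partial[OF C *(1)])
        show "norm (partial_deriv i f (x + s S + t *\<^sub>R axis i 1) - partial_deriv i f x) \<le> e'"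
          using *(2) by (simp add: dist_norm)
      qed
      moreover have "x + s S + v $ i *\<^sub>R axis i 1 = x + s (insert i S)"
        using insert.hyps by (simp add: s_def)
      ultimately have "norm (f (x + s (insert i S)) - f (x + s S) - v $ i *\<^sub>R partial_deriv i f x) \<le> \<bar>v $ i\<bar> * e'"
        by simp
      from norm_triangle_mono[OF this insert.IH]
      show ?case using insert.hyps by (simp add: algebra_simps)
    qed
    from this[of UNIV] have "norm (f (x + s UNIV) - f x - (\<Sum>i\<in>UNIV. v $ i *\<^sub>R partial_deriv i f x)) \<le> (\<Sum>i\<in>UNIV. \<bar>v $ i\<bar> * e')" .
    also have "\<dots> \<le> (\<Sum>i\<in>(UNIV :: 'd set). norm v * e')"
      using e' by (intro sum_mono mult_right_mono component_le_norm_cart) auto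
    also have "\<dots> = e * norm v"
      by (simp add: e'_def)
    also have "x + s UNIV = y"
      by (simp add: vec_eq_iff s_nth v_def)
    finally show ?thesis by (simp only: v_def)
  qed
  then show "\<exists>d>0. \<forall>y. norm (y - x) < d \<longrightarrow>
      norm (f y - f x - (\<Sum>i\<in>UNIV. (y - x) $ i *\<^sub>R partial_deriv i f x)) \<le> e * norm (y - x)"
    using d0 by blast
qed

lemma Ck_on_directional:
  fixes f :: "real ^ 'd::finite \<Rightarrow> 'b::real_normed_vector"
  assumes "Ck_on (Suc k) U f" and "open U" and "x \<in> U"
  shows "((\<lambda>t. f (x + t *\<^sub>R v)) has_vector_derivative (\<Sum>i\<in>UNIV. v $ i *\<^sub>R partial_deriv i f x)) (at 0)"
proof -
  have 1: "((\<lambda>t. x + t *\<^sub>R v) has_vector_derivative v) (at 0)"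
    by (auto intro!: derivative_eq_intros)
  have 2: "(f has_derivative (\<lambda>v. \<Sum>i\<in>UNIV. v $ i *\<^sub>R partial_deriv i f x)) (at (x + 0 *\<^sub>R v))"
    using Ck_on_has_derivative[OF assms] by simp
  show ?thesis
    using diff_chain_at[OF 1[unfolded has_vector_derivative_def] 2]
    by (simp add: has_vector_derivative_def o_def scaleR_sum_right)
qed

lemma partial_sums_replicate: "partial_sums (replicate k v) x \<subseteq> {x + real j *\<^sub>R v | j. j \<le> k}"
proof (induction k arbitrary: x)
  case (Suc k)
  have "partial_sums (replicate k v) (x + v) \<subseteq> {x + real j *\<^sub>R v | j. j \<le> Suc k}"
  proof
    fix z assume "z \<in> partial_sums (replicate k v) (x + v)"
    then obtain j where "j \<le> k" "z = x + v + real j *\<^sub>R v" using Suc by blast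
    then have "z = x + real (Suc j) *\<^sub>R v" "Suc j \<le> Suc k" by (auto simp: algebra_simps)
    then show "z \<in> {x + real j *\<^sub>R v | j. j \<le> Suc k}" by blast
  qed
  moreover have "partial_sums (replicate k v) x \<subseteq> {x + real j *\<^sub>R v | j. j \<le> Suc k}"
    using Suc[of x] by (force simp: le_Suc_eq)
  ultimately show ?case by simp
qed (auto intro: exI[of _ 0])

lemma convex_line:
  assumes "convex Q" "x \<in> Q" "x + a *\<^sub>R v \<in> Q" "0 \<le> t" "t \<le> (a :: real)"
  shows "x + t *\<^sub>R v \<in> Q"
proof (cases "a = 0")
  case False
  then have "x + t *\<^sub>R v = (1 - t / a) *\<^sub>R x + (t / a) *\<^sub>R (x + a *\<^sub>R v)"
    by (simp add: algebra_simps)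
  then show ?thesis
    using assms False by (auto intro!: convexD simp: divide_simps)
qed (use assms in auto)

text \<open>
  If the derivatives of order \<open>k\<close> were constant, \<open>f\<close> would be a polynomial of degree \<open>k\<close> and its
  differences of order \<open>k + 1\<close> would vanish.  In general these are bounded by the oscillation
  \<open>\<eta>\<close> of the derivatives.  The induction estimates one difference by
  the derivative along \<open>v\<close>, a combination of partial derivatives to which the bound for
  \<open>k - 1\<close> applies.
\<close>

lemma norm_iter_diff_le_oscillation:
  fixes f :: "real ^ 'd::finite \<Rightarrow> 'b::real_normed_vector"
  assumes "Ck_on k U f" "open U" "Q \<subseteq> U" "convex Q"
    and "\<And>w y z. length w = k \<Longrightarrow> y \<in> Q \<Longrightarrow> z \<in> Q \<Longrightarrow>
          norm (foldr partial_deriv w f y - foldr partial_deriv w f z) \<le> \<eta>"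
    and "x \<in> Q" "x + real (Suc k) *\<^sub>R v \<in> Q"
  shows "norm (iter_diff (replicate (Suc k) v) f x) \<le> (\<Sum>i\<in>UNIV. \<bar>v $ i\<bar>) ^ k * \<eta>"
  using assms
proof (induction k arbitrary: f x)
  case 0
  have "norm (f (x + v) - f x) \<le> \<eta>"
    using 0(5)[of "[]" "x + v" x] 0(6,7) by simp
  then show ?case by (simp add: diff1_def)
next
  case (Suc k)
  define D where "D z = (\<Sum>i\<in>UNIV. v $ i *\<^sub>R partial_deriv i f z)" for z
  have "norm (iter_diff (replicate (Suc k) v) f (x + 1 *\<^sub>R v) - iter_diff (replicate (Suc k) v) f (x + 0 *\<^sub>R v) - 1 *\<^sub>R 0)
      \<le> \<bar>1\<bar> * ((\<Sum>i\<in>UNIV. \<bar>v $ i\<bar>) ^ Suc k * \<eta>)"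
  proof (rule mvt_linearization[where g' = "\<lambda>t. iter_diff (replicate (Suc k) v) D (x + t *\<^sub>R v)"])
    fix t :: real assume "t \<in> closed_segment 0 1"
    then have t: "0 \<le> t" "t \<le> 1" by (auto simp: closed_segment_eq_real_ivl)
    have pt: "x + t *\<^sub>R v + s *\<^sub>R v \<in> Q" if "0 \<le> s" "s \<le> real (Suc k)" for s
      using convex_line[OF Suc.prems(4,6,7), of "t + s"] t that by (simp add: algebra_simps)
    show "((\<lambda>t. iter_diff (replicate (Suc k) v) f (x + t *\<^sub>R v)) has_vector_derivative
        iter_diff (replicate (Suc k) v) D (x + t *\<^sub>R v)) (at t)"
    proof (rule has_vector_derivative_shift, rule iter_diff_has_vector_derivative)
      fix z assume "z \<in> partial_sums (replicate (Suc k) v) (x + t *\<^sub>R v)"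
      then obtain j where "j \<le> Suc k" "z = x + t *\<^sub>R v + real j *\<^sub>R v"
        using partial_sums_replicate by blast
      then have "z \<in> U" using pt[of "real j"] Suc.prems(3) by auto
      then show "((\<lambda>t. f (z + t *\<^sub>R v)) has_vector_derivative D z) (at 0)"
        unfolding D_def by (rule Ck_on_directional[OF Suc.prems(1,2)])
    qed
    have IH: "norm (iter_diff (replicate (Suc k) v) (partial_deriv i f) (x + t *\<^sub>R v)) \<le> (\<Sum>i\<in>UNIV. \<bar>v $ i\<bar>) ^ k * \<eta>" for i
    proof (rule Suc.IH)
      show "norm (foldr partial_deriv w (partial_deriv i f) y - foldr partial_deriv w (partial_deriv i f) z) \<le> \<eta>"
        if "length w = k" "y \<in> Q" "z \<in> Q" for w y z
        using Suc.prems(5)[of "w @ [i]" y z] that by simp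
    qed (use Suc.prems pt[of 0] pt[of "real (Suc k)"] in auto)
    have "norm (iter_diff (replicate (Suc k) v) D (x + t *\<^sub>R v))
        = norm (\<Sum>i\<in>UNIV. v $ i *\<^sub>R iter_diff (replicate (Suc k) v) (partial_deriv i f) (x + t *\<^sub>R v))"
      unfolding D_def iter_diff_sum_scaleR ..
    also have "\<dots> \<le> (\<Sum>i\<in>UNIV. \<bar>v $ i\<bar> * ((\<Sum>i\<in>UNIV. \<bar>v $ i\<bar>) ^ k * \<eta>))"
      by (rule sum_norm_le) (use IH in \<open>simp add: mult_left_mono\<close>)
    finally show "norm (iter_diff (replicate (Suc k) v) D (x + t *\<^sub>R v) - 0) \<le> (\<Sum>i\<in>UNIV. \<bar>v $ i\<bar>) ^ Suc k * \<eta>"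
      by (simp add: sum_distrib_right mult.assoc)
  qed
  moreover have "replicate (Suc (Suc k)) v = v # replicate (Suc k) v" by simp
  ultimately show ?case by (simp only: iter_diff_Cons) simp
qed

lemma partial_sums_axes:
  assumes "0 \<le> h" "z \<in> partial_sums (map (\<lambda>i. h *\<^sub>R axis i 1) w) x"
  shows "x $ i \<le> z $ i \<and> z $ i \<le> x $ i + real (length w) * h"
  using assms(2)
proof (induction w arbitrary: x)
  case (Cons a w)
  then consider "z \<in> partial_sums (map (\<lambda>i. h *\<^sub>R axis i 1) w) (x + h *\<^sub>R axis a 1)"
    | "z \<in> partial_sums (map (\<lambda>i. h *\<^sub>R axis i 1) w) x" by auto
  then show ?case
  proof cases
    case 1
    have "0 \<le> h * axis a 1 $ i" "h * axis a 1 $ i \<le> h" using \<open>0 \<le> h\<close> by (auto simp: axis_def)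
    then show ?thesis using Cons.IH[OF 1] by (simp add: algebra_simps)
  next
    case 2
    from Cons.IH[OF this] show ?thesis using \<open>0 \<le> h\<close> by (simp add: algebra_simps)
  qed
qed simp

text \<open>
  A mixed difference with step \<open>h\<close> approximates \<open>h\<^sup>l\<close> times the iterated partial derivative for
  the same word of directions.  The induction splits off the innermost derivative,
  which leaves a word of the same shape for the partial derivative of \<open>f\<close>.
\<close>

lemma iter_diff_axes_approx:
  fixes f :: "real ^ 'd::finite \<Rightarrow> 'b::real_normed_vector"
  assumes "Ck_on (length w) U f" "Q \<subseteq> U" "0 \<le> h"
    and "\<And>z. z \<in> Q \<Longrightarrow> norm (foldr partial_deriv w f z - a) \<le> \<eta>"
    and "\<And>z. (\<And>i. x $ i \<le> z $ i \<and> z $ i \<le> x $ i + real (length w) * h) \<Longrightarrow> z \<in> Q"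
  shows "norm (iter_diff (map (\<lambda>i. h *\<^sub>R axis i 1) w) f x - h ^ length w *\<^sub>R a) \<le> h ^ length w * \<eta>"
  using assms
proof (induction w arbitrary: f x rule: rev_induct)
  case Nil
  then show ?case by simp
next
  case (snoc i w)
  let ?D = "iter_diff (map (\<lambda>i. h *\<^sub>R axis i 1) w)"
  have "norm (?D f (x + h *\<^sub>R axis i 1) - ?D f (x + 0 *\<^sub>R axis i 1) - h *\<^sub>R (h ^ length w *\<^sub>R a))
      \<le> \<bar>h\<bar> * (h ^ length w * \<eta>)"
  proof (rule mvt_linearization[where g' = "\<lambda>t. ?D (partial_deriv i f) (x + t *\<^sub>R axis i 1)"])
    fix t assume "t \<in> closed_segment 0 h"
    then have t: "0 \<le> t" "t \<le> h" using \<open>0 \<le> h\<close> by (auto simp: closed_segment_eq_real_ivl)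
    have inQ: "z \<in> Q" if z: "\<And>l. (x + t *\<^sub>R axis i 1) $ l \<le> z $ l \<and>
        z $ l \<le> (x + t *\<^sub>R axis i 1) $ l + real (length w) * h" for z
    proof (rule snoc.prems(5))
      fix l
      have "0 \<le> t * axis i 1 $ l" "t * axis i 1 $ l \<le> h" using t by (auto simp: axis_def)
      then show "x $ l \<le> z $ l \<and> z $ l \<le> x $ l + real (length (w @ [i])) * h"
        using z[of l] by (simp add: algebra_simps)
    qed
    show "((\<lambda>t. ?D f (x + t *\<^sub>R axis i 1)) has_vector_derivative ?D (partial_deriv i f) (x + t *\<^sub>R axis i 1)) (at t)"
    proof (rule has_vector_derivative_shift, rule iter_diff_has_vector_derivative)
      fix z assume "z \<in> partial_sums (map (\<lambda>i. h *\<^sub>R axis i 1) w) (x + t *\<^sub>R axis i 1)"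
      then have "z \<in> Q" by (intro inQ partial_sums_axes[OF \<open>0 \<le> h\<close>])
      then show "((\<lambda>t. f (z + t *\<^sub>R axis i 1)) has_vector_derivative partial_deriv i f z) (at 0)"
        using snoc.prems(1,2) by (intro Ck_on_partial[of "length w" U]) auto
    qed
    show "norm (?D (partial_deriv i f) (x + t *\<^sub>R axis i 1) - h ^ length w *\<^sub>R a) \<le> h ^ length w * \<eta>"
      using snoc.prems(1-4) inQ by (intro snoc.IH) auto
  qed
  then show ?case
    using \<open>0 \<le> h\<close> by (simp add: iter_diff_snoc mult.assoc del: foldr_append)
qed

section \<open>Functions that are almost polynomial on every cell\<close>

lemma replicate_iter_diff_Suc:
  "iter_diff (replicate (Suc k) v) g x = iter_diff (replicate k v) g (x + v) - iter_diff (replicate k v) g x"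
  unfolding replicate_Suc by (rule iter_diff_Cons)

lemma norm_iter_diff_replicate_le:
  assumes "\<And>j. j \<le> k \<Longrightarrow> norm (g (x + real j *\<^sub>R v)) \<le> M"
  shows "norm (iter_diff (replicate k v) g x) \<le> 2 ^ k * M"
  using assms
proof (induction k arbitrary: x)
  case 0
  then show ?case using 0[of 0] by simp
next
  case (Suc k)
  have "norm (iter_diff (replicate k v) g (x + v)) \<le> 2 ^ k * M"
    using Suc.prems[of "Suc _"] by (intro Suc.IH) (simp add: algebra_simps)
  moreover have "norm (iter_diff (replicate k v) g x) \<le> 2 ^ k * M"
    by (intro Suc.IH Suc.prems) simp
  ultimately show ?case
    unfolding replicate_iter_diff_Suc
    using norm_triangle_ineq4[of "iter_diff (replicate k v) g (x + v)" "iter_diff (replicate k v) g x"] by simp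
qed

text \<open>
  Extrapolation: a vanishing difference of order \<open>k\<close> expresses the value at the last
  point of a progression of \<open>k + 1\<close> points by the preceding ones, with coefficients of total size
  less than \<open>2\<^sup>k\<close>.
\<close>

lemma norm_last_le_iter_diff:
  assumes "\<And>j. j < k \<Longrightarrow> norm (g (x + real j *\<^sub>R v)) \<le> M" "0 \<le> M"
  shows "norm (g (x + real k *\<^sub>R v)) \<le> norm (iter_diff (replicate k v) g x) + 2 ^ k * M"
  using assms(1)
proof (induction k arbitrary: x)
  case 0
  then show ?case using \<open>0 \<le> M\<close> by simp
next
  case (Suc k)
  have "norm (g (x + v + real k *\<^sub>R v)) \<le> norm (iter_diff (replicate k v) g (x + v)) + 2 ^ k * M"
    using Suc.prems[of "Suc _"] by (intro Suc.IH) (simp add: algebra_simps)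
  moreover have "norm (iter_diff (replicate k v) g x) \<le> 2 ^ k * M"
    by (intro norm_iter_diff_replicate_le Suc.prems) simp
  moreover have "norm (iter_diff (replicate k v) g (x + v)) \<le>
      norm (iter_diff (replicate (Suc k) v) g x) + norm (iter_diff (replicate k v) g x)"
    unfolding replicate_iter_diff_Suc add.commute[of "norm (_ - _)"] by (rule norm_triangle_sub)
  ultimately show ?case by (simp add: algebra_simps del: replicate_Suc)
qed

lemma norm_first_le_iter_diff:
  assumes "\<And>j. 1 \<le> j \<Longrightarrow> j \<le> k \<Longrightarrow> norm (g (x + real j *\<^sub>R v)) \<le> M" "0 \<le> M"
  shows "norm (g x) \<le> norm (iter_diff (replicate k v) g x) + 2 ^ k * M"
  using assms(1)
proof (induction k)
  case 0
  then show ?case using \<open>0 \<le> M\<close> by simp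
next
  case (Suc k)
  have "norm (g x) \<le> norm (iter_diff (replicate k v) g x) + 2 ^ k * M"
    by (intro Suc.IH Suc.prems) auto
  moreover have "norm (iter_diff (replicate k v) g (x + v)) \<le> 2 ^ k * M"
    using Suc.prems[of "Suc _"] by (intro norm_iter_diff_replicate_le) (simp add: algebra_simps)
  moreover have "norm (iter_diff (replicate k v) g x) \<le>
      norm (iter_diff (replicate (Suc k) v) g x) + norm (iter_diff (replicate k v) g (x + v))"
    unfolding replicate_iter_diff_Suc add.commute[of "norm (_ - _)"]
    by (subst norm_minus_commute) (rule norm_triangle_sub)
  ultimately show ?case by (simp add: algebra_simps del: replicate_Suc)
qed

text \<open>
  Iterated extrapolation along a progression.  The bound \<open>M\<close> for the differences is absorbed by
  doubling the growth factor \<open>2\<^bsup>m+1\<^esup>\<close> of a single step.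
\<close>

lemma norm_progression_le:
  assumes diff: "\<And>i. i + Suc m \<le> N \<Longrightarrow> norm (iter_diff (replicate (Suc m) v) g (z + real i *\<^sub>R v)) \<le> M"
    and start: "\<And>i. i \<le> m \<Longrightarrow> norm (g (z + real i *\<^sub>R v)) \<le> M"
    and "i \<le> N"
  shows "norm (g (z + real i *\<^sub>R v)) \<le> (2 ^ (m + 2)) ^ i * M"
  using \<open>i \<le> N\<close>
proof (induction i rule: less_induct)
  case (less i)
  have M0: "0 \<le> M" using start[of 0] norm_ge_zero order_trans by blast
  show ?case
  proof (cases "i \<le> m")
    case True
    have "1 * M \<le> (2 ^ (m + 2)) ^ i * M"
      using M0 by (intro mult_right_mono one_le_power) auto
    then show ?thesis using start[OF True] by simp
  next
    case False
    then obtain i' where i: "i = i' + Suc m" by (metis add.commute add_Suc_right less_imp_Suc_add not_le)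
    let ?K = "(2 ^ (m + 2)) ^ (i' + m) * M"
    have K: "M \<le> ?K"
      using mult_right_mono[OF one_le_power[OF one_le_power] M0, of 2 "m + 2" "i' + m"] by simp
    have "norm (g (z + real i' *\<^sub>R v + real j *\<^sub>R v)) \<le> ?K" if "j < Suc m" for j
    proof -
      have "norm (g (z + real (i' + j) *\<^sub>R v)) \<le> (2 ^ (m + 2)) ^ (i' + j) * M"
        using less.IH[of "i' + j"] that i less.prems by auto
      also have "\<dots> \<le> ?K"
        using that M0 by (intro mult_right_mono power_increasing one_le_power) auto
      finally show ?thesis by (simp add: algebra_simps)
    qed
    from norm_last_le_iter_diff[of "Suc m" g "z + real i' *\<^sub>R v" v, OF this]
    have "norm (g (z + real i' *\<^sub>R v + real (Suc m) *\<^sub>R v)) \<le> M + 2 ^ Suc m * ?K"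
      using diff[of i'] i less.prems M0 K by (force simp del: replicate_Suc power_Suc of_nat_Suc)
    also have "z + real i' *\<^sub>R v + real (Suc m) *\<^sub>R v = z + real i *\<^sub>R v"
      by (simp add: i algebra_simps)
    also have "M + 2 ^ Suc m * ?K \<le> 2 ^ (m + 2) * ?K"
    proof -
      have "1 * ?K \<le> 2 ^ Suc m * ?K"
        using K M0 by (intro mult_right_mono one_le_power) auto
      then have "M \<le> 2 ^ Suc m * ?K" using K by linarith
      then show ?thesis by (simp add: algebra_simps)
    qed
    also have "\<dots> = (2 ^ (m + 2)) ^ i * M" by (simp add: i power_add)
    finally show ?thesis .
  qed
qed

text \<open>
  The value at a point \<open>y\<close> of a cell is extrapolated from the values near the centre of the child.  The
  lower bound \<open>L\<close> on the child guarantees that the differences of order \<open>m + 1\<close>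
  are not larger than a value of \<open>\<bar>F\<bar>\<close> attained there.
\<close>

lemma almost_polynomial_doubling:
  fixes x0 :: "real ^ 'd::finite"
  assumes diff: "\<And>j y x v. j0 \<le> j \<Longrightarrow> y \<in> cell j0 x0 \<Longrightarrow> x \<in> cell j y \<Longrightarrow>
      x + real (Suc m) *\<^sub>R v \<in> cell j y \<Longrightarrow>
      \<bar>iter_diff (replicate (Suc m) v) F x\<bar> \<le> E * (1 / 2 ^ j) ^ m"
    and lower: "\<And>j y. j0 \<le> j \<Longrightarrow> y \<in> cell j0 x0 \<Longrightarrow> \<exists>x\<in>cell j y. L * (1 / 2 ^ j) ^ m \<le> \<bar>F x\<bar>"
    and EL: "2 ^ m * E \<le> L"
  shows "doubling j0 x0 (1 / (2 ^ (m + 2)) ^ (4 * Suc m)) F"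
  unfolding doubling_def
proof (intro allI impI ballI)
  fix j x y assume j: "j0 \<le> j" and x: "x \<in> cell j0 x0" and y: "y \<in> cell j x"
  let ?N = "4 * Suc m"
  obtain p where p: "cell (Suc j) x = {y. \<forall>i. p $ i \<le> y $ i \<and> y $ i < p $ i + 1 / 2 ^ Suc j}"
    by (rule cell_corner)
  define z where "z = p + (\<chi> i. 1 / 2 ^ (j + 2))"
  have zQ: "z \<in> cell (Suc j) x" by (auto simp: p z_def divide_strict_left_mono)
  then have zj: "z \<in> cell j x" using cell_Suc_subset by blast
  \<comment> \<open>A progression from the centre of the child to \<open>y\<close>; its first \<open>m + 1\<close> points move by less than a quarter of the side of the parent and so stay in the child.\<close>
  define u where "u = (1 / real ?N) *\<^sub>R (y - z)"
  have zNu: "z + real ?N *\<^sub>R u = y" by (simp add: u_def del: of_nat_mult)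
  have start: "z + real i *\<^sub>R u \<in> cell (Suc j) x" if "i \<le> m" for i
  proof -
    have "\<bar>(real i *\<^sub>R u) $ l\<bar> < 1 / 2 ^ (j + 2)" for l
    proof -
      have "\<bar>(real i *\<^sub>R u) $ l\<bar> = real i / real ?N * \<bar>y $ l - z $ l\<bar>"
        by (simp add: u_def abs_mult)
      also have "\<dots> \<le> real i / real ?N * (1 / 2 ^ j)"
        using cell_dist_less[OF y zj, of l] by (intro mult_left_mono) auto
      also have "\<dots> < 1 / 4 * (1 / 2 ^ j)"
        using that by (intro mult_strict_right_mono) (auto simp: field_simps)
      finally show ?thesis by (simp add: field_simps)
    qed
    then have "- (1 / 2 ^ (j + 2)) < (real i *\<^sub>R u) $ l \<and> (real i *\<^sub>R u) $ l < 1 / 2 ^ (j + 2)" for l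
      by (simp only: abs_less_iff) (metis minus_less_iff)
    moreover have "(1 :: real) / 2 ^ Suc j = 1 / 2 ^ (j + 2) + 1 / 2 ^ (j + 2)" by (simp add: field_simps)
    ultimately have "p $ l \<le> p $ l + 1 / 2 ^ (j + 2) + (real i *\<^sub>R u) $ l \<and>
        p $ l + 1 / 2 ^ (j + 2) + (real i *\<^sub>R u) $ l < p $ l + 1 / 2 ^ Suc j" for l
      by (smt (verit))
    then show ?thesis
      unfolding p z_def by simp
  qed
  have inQ: "z + real i *\<^sub>R u \<in> cell j x" if "i \<le> ?N" for i
    using convex_line[OF convex_cell zj, of "real ?N" u "real i"] zNu y that by (simp del: of_nat_mult)
  obtain x' where x': "x' \<in> cell (Suc j) x" "L * (1 / 2 ^ Suc j) ^ m \<le> \<bar>F x'\<bar>"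
    using lower[of "Suc j" x] j x by auto
  define S where "S = insert x' ((\<lambda>i. z + real i *\<^sub>R u) ` {..m})"
  have "finite ((\<lambda>x. \<bar>F x\<bar>) ` S)" "(\<lambda>x. \<bar>F x\<bar>) ` S \<noteq> {}" by (auto simp: S_def)
  from Max_in[OF this] obtain y' where y': "y' \<in> S" "Max ((\<lambda>x. \<bar>F x\<bar>) ` S) = \<bar>F y'\<bar>" by auto
  have y'_max: "\<bar>F x\<bar> \<le> \<bar>F y'\<bar>" if "x \<in> S" for x
    using Max_ge[OF \<open>finite ((\<lambda>x. \<bar>F x\<bar>) ` S)\<close>, of "\<bar>F x\<bar>"] that y'(2) by auto
  have err: "E * (1 / 2 ^ j) ^ m \<le> \<bar>F y'\<bar>"
  proof -
    have "E * (1 / 2 ^ j) ^ m = 2 ^ m * E * (1 / 2 ^ Suc j) ^ m"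
      by (simp add: power_divide power_mult_distrib)
    also have "\<dots> \<le> L * (1 / 2 ^ Suc j) ^ m"
      using EL by (intro mult_right_mono) auto
    also have "\<dots> \<le> \<bar>F y'\<bar>"
      using x'(2) y'_max[of x'] by (simp add: S_def)
    finally show ?thesis .
  qed
  have "norm (F (z + real ?N *\<^sub>R u)) \<le> (2 ^ (m + 2)) ^ ?N * \<bar>F y'\<bar>"
  proof (rule norm_progression_le[where N = ?N and M = "\<bar>F y'\<bar>"])
    fix i assume i: "i + Suc m \<le> ?N"
    have "z + real i *\<^sub>R u + real (Suc m) *\<^sub>R u \<in> cell j x"
      using inQ[OF i] by (simp add: algebra_simps)
    from diff[OF j x inQ this] i err
    show "norm (iter_diff (replicate (Suc m) u) F (z + real i *\<^sub>R u)) \<le> \<bar>F y'\<bar>"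
      by (auto simp del: replicate_Suc)
  next
    fix i assume "i \<le> m"
    then show "norm (F (z + real i *\<^sub>R u)) \<le> \<bar>F y'\<bar>"
      using y'_max[of "z + real i *\<^sub>R u"] by (auto simp: S_def)
  qed simp
  then have "1 / (2 ^ (m + 2)) ^ ?N * \<bar>F y\<bar> \<le> \<bar>F y'\<bar>"
    unfolding zNu by (simp add: field_simps)
  moreover have "y' \<in> cell (Suc j) x"
    using y'(1) x'(1) start by (auto simp: S_def)
  ultimately show "\<exists>y'\<in>cell (Suc j) x. 1 / (2 ^ (m + 2)) ^ ?N * \<bar>F y\<bar> \<le> \<bar>F y'\<bar>" by blast
qed

lemma emeasure_homothety_vimage:
  fixes G :: "(real ^ 'd::finite) set"
  assumes "G \<in> sets borel" "t > 0"
  shows "ennreal t ^ CARD('d) * emeasure lborel ((\<lambda>x. a + t *\<^sub>R x) -` G) = emeasure lborel G"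
proof -
  have [measurable]: "(\<lambda>x. a + t *\<^sub>R x) \<in> borel \<rightarrow>\<^sub>M borel" by simp
  have "emeasure lborel G = emeasure (density (distr lborel borel (\<lambda>x. a + t *\<^sub>R x)) (\<lambda>_. \<bar>t\<bar> ^ DIM(real ^ 'd))) G"
    using lborel_affine[of t a] assms(2) by simp
  also have "\<dots> = ennreal t ^ CARD('d) * emeasure (distr lborel borel (\<lambda>x. a + t *\<^sub>R x)) G"
    using assms by (subst emeasure_density) (auto simp: nn_integral_cmult_indicator ennreal_power)
  also have "emeasure (distr lborel borel (\<lambda>x. a + t *\<^sub>R x)) G = emeasure lborel ((\<lambda>x. a + t *\<^sub>R x) -` G)"
    using assms by (subst emeasure_distr) auto
  finally show ?thesis by simp
qed

text \<open>
  Let \<open>\<bar>F y1\<bar>\<close> be large.  On every progression of \<open>m + 2\<close> points from \<open>y1\<close> to a point of the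
  cell some later value of \<open>\<bar>F\<bar>\<close> is comparable with \<open>\<bar>F y1\<bar>\<close>.  So the cell is
  covered by the preimages of the set \<open>G\<close> of such points under \<open>m + 1\<close> contractions \<open>T i\<close>
  towards \<open>y1\<close>, and the change of volume under these gives a lower bound for the measure of \<open>G\<close>.
\<close>

lemma almost_polynomial_sublevel_small:
  fixes x0 :: "real ^ 'd::finite"
  assumes diff: "\<And>j y x v. j0 \<le> j \<Longrightarrow> y \<in> cell j0 x0 \<Longrightarrow> x \<in> cell j y \<Longrightarrow>
      x + real (Suc m) *\<^sub>R v \<in> cell j y \<Longrightarrow>
      \<bar>iter_diff (replicate (Suc m) v) F x\<bar> \<le> E * (1 / 2 ^ j) ^ m"
    and lower: "\<And>j y. j0 \<le> j \<Longrightarrow> y \<in> cell j0 x0 \<Longrightarrow> \<exists>x\<in>cell j y. L * (1 / 2 ^ j) ^ m \<le> \<bar>F x\<bar>"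
    and EL: "2 * E \<le> L" and L: "0 < L"
    and cont: "continuous_on (cell j0 x0) F"
  shows "sublevel_small j0 x0 (1 / 2 ^ (m + 3)) (ennreal (1 - (1 / real (Suc m)) ^ Suc CARD('d))) F"
  unfolding sublevel_small_def
proof (intro allI impI ballI)
  fix j x y assume j: "j0 \<le> j" and x: "x \<in> cell j0 x0" and y: "y \<in> cell j x"
  let ?Q = "cell j x" and ?\<delta> = "1 / 2 ^ (m + 3) :: real" and ?d = "CARD('d)"
  obtain x' where x': "x' \<in> ?Q" "L * (1 / 2 ^ j) ^ m \<le> \<bar>F x'\<bar>"
    using lower[OF j x] by auto
  obtain y1 where y1: "y1 \<in> ?Q" "L * (1 / 2 ^ j) ^ m \<le> \<bar>F y1\<bar>" "\<bar>F y\<bar> \<le> \<bar>F y1\<bar>"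
    using x' y by (cases "\<bar>F y\<bar> \<le> \<bar>F x'\<bar>") force+
  have Fy1: "0 < \<bar>F y1\<bar>" using y1(2) L by (smt (verit) divide_pos_pos mult_pos_pos zero_less_power)
  have err: "E * (1 / 2 ^ j) ^ m \<le> \<bar>F y1\<bar> / 2"
    using order_trans[OF mult_right_mono[OF EL, of "(1 / 2 ^ j) ^ m"] y1(2)] by simp
  define G where "G = {z \<in> ?Q. ?\<delta> * \<bar>F y1\<bar> \<le> \<bar>F z\<bar>}"
  have G: "G \<in> sets borel"
  proof -
    have "continuous_on ?Q F" using cont subcell[OF x j] continuous_on_subset by blast
    then have [measurable]: "F \<in> borel_measurable (restrict_space borel ?Q)"
      by (rule borel_measurable_continuous_on_restrict)
    have "{z \<in> space (restrict_space borel ?Q). ?\<delta> * \<bar>F y1\<bar> \<le> \<bar>F z\<bar>} \<in> sets (restrict_space borel ?Q)"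
      by measurable
    then show ?thesis
      by (subst (asm) sets_restrict_space_iff) (auto simp: G_def space_restrict_space)
  qed
  define T where "T i z = (1 - real i / real (Suc m)) *\<^sub>R y1 + (real i / real (Suc m)) *\<^sub>R z" for i and z :: "real ^ 'd"
  have T_eq: "T i z = y1 + real i *\<^sub>R ((1 / real (Suc m)) *\<^sub>R (z - y1))" for i z
    by (simp add: T_def algebra_simps)
  have cover: "?Q \<subseteq> (\<Union>i\<in>{1..Suc m}. T i -` G)"
  proof (rule ccontr)
    assume "\<not> ?thesis"
    then obtain z where z: "z \<in> ?Q" "z \<notin> (\<Union>i\<in>{1..Suc m}. T i -` G)" by blast
    have T_in: "T i z \<in> ?Q" if "i \<le> Suc m" for i
      unfolding T_def using convexD[OF convex_cell y1(1) z(1), of "1 - real i / real (Suc m)" "real i / real (Suc m)"] that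
      by (auto simp: divide_simps)
    let ?v = "(1 / real (Suc m)) *\<^sub>R (z - y1)"
    have "norm (F y1) \<le> norm (iter_diff (replicate (Suc m) ?v) F y1) + 2 ^ Suc m * (?\<delta> * \<bar>F y1\<bar>)"
    proof (rule norm_first_le_iter_diff)
      fix i assume "1 \<le> i" "i \<le> Suc m"
      with z(2) T_in[of i] show "norm (F (y1 + real i *\<^sub>R ?v)) \<le> ?\<delta> * \<bar>F y1\<bar>"
        unfolding T_eq by (force simp: G_def not_le)
    qed simp
    also have "norm (iter_diff (replicate (Suc m) ?v) F y1) \<le> \<bar>F y1\<bar> / 2"
    proof -
      have "y1 + real (Suc m) *\<^sub>R ?v \<in> cell j x" using T_in[of "Suc m"] unfolding T_eq by simp
      from diff[OF j x y1(1) this] err show ?thesis by (simp del: replicate_Suc)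
    qed
    also have "2 ^ Suc m * (?\<delta> * \<bar>F y1\<bar>) = \<bar>F y1\<bar> / 4"
      by (simp add: power_add)
    finally show False using Fy1 by simp
  qed
  have finQ: "emeasure lborel ?Q \<noteq> \<infinity>" by (simp add: emeasure_cell)
  have GQ: "G \<subseteq> ?Q" by (auto simp: G_def)
  have T_meas [measurable]: "T i -` G \<in> sets borel" for i
    using measurable_sets_borel[of "T i" borel G] G by (simp add: T_def[abs_def])
  let ?r = "ennreal (1 / real (Suc m)) ^ ?d"
  have "?r * emeasure lborel ?Q \<le> ?r * (\<Sum>i\<in>{1..Suc m}. emeasure lborel (T i -` G))"
  proof (rule mult_left_mono)
    have "emeasure lborel ?Q \<le> emeasure lborel (\<Union>i\<in>{1..Suc m}. T i -` G)"
      by (rule emeasure_mono[OF cover]) simp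
    also have "\<dots> \<le> (\<Sum>i\<in>{1..Suc m}. emeasure lborel (T i -` G))"
      by (rule emeasure_subadditive_finite) (simp_all add: image_subset_iff)
    finally show "emeasure lborel ?Q \<le> (\<Sum>i\<in>{1..Suc m}. emeasure lborel (T i -` G))" .
  qed simp
  also have "\<dots> = (\<Sum>i\<in>{1..Suc m}. ?r * emeasure lborel (T i -` G))"
    by (rule sum_distrib_left)
  also have "\<dots> \<le> (\<Sum>i\<in>{1..Suc m}. emeasure lborel G)"
  proof (rule sum_mono)
    fix i assume i: "i \<in> {1..Suc m}"
    have "?r * emeasure lborel (T i -` G) \<le> ennreal (real i / real (Suc m)) ^ ?d * emeasure lborel (T i -` G)"
      using i by (intro mult_right_mono power_mono ennreal_leI divide_right_mono) auto
    also have "\<dots> = emeasure lborel G"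
      unfolding T_def using i by (intro emeasure_homothety_vimage G) auto
    finally show "?r * emeasure lborel (T i -` G) \<le> emeasure lborel G" .
  qed
  also have "\<dots> = of_nat (Suc m) * emeasure lborel G" by simp
  finally have *: "?r * emeasure lborel ?Q \<le> of_nat (Suc m) * emeasure lborel G" .
  have finG: "emeasure lborel G \<noteq> \<infinity>"
    using emeasure_mono[OF GQ, of lborel] finQ by (auto simp: top_unique)
  have eQ: "emeasure lborel ?Q = ennreal (measure lborel ?Q)" and eG: "emeasure lborel G = ennreal (measure lborel G)"
    using finQ finG by (simp_all add: emeasure_eq_ennreal_measure)
  have "(1 / real (Suc m)) ^ ?d * measure lborel ?Q \<le> real (Suc m) * measure lborel G"
    using * unfolding eQ eG ennreal_of_nat_eq_real_of_nat
    by (simp add: ennreal_power flip: ennreal_mult del: of_nat_Suc)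
  then have **: "(1 / real (Suc m)) ^ Suc ?d * measure lborel ?Q \<le> measure lborel G"
    using mult_left_mono[of _ _ "1 / real (Suc m)"] by (fastforce simp: mult.assoc simp del: of_nat_Suc)
  have "emeasure lborel (?Q - G) = ennreal (measure lborel ?Q - measure lborel G)"
    using G GQ finG by (subst emeasure_Diff) (auto simp: eQ eG ennreal_minus)
  also have "\<dots> \<le> ennreal ((1 - (1 / real (Suc m)) ^ Suc ?d) * measure lborel ?Q)"
    using ** by (intro ennreal_leI) (simp add: algebra_simps)
  also have "\<dots> = ennreal (1 - (1 / real (Suc m)) ^ Suc ?d) * emeasure lborel ?Q"
    unfolding eQ by (rule ennreal_mult) (simp_all add: power_le_one del: power_Suc of_nat_Suc)
  finally have "emeasure lborel (?Q - G) \<le> ennreal (1 - (1 / real (Suc m)) ^ Suc ?d) * emeasure lborel ?Q" .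
  moreover have "{z \<in> ?Q. \<bar>F z\<bar> < ?\<delta> * \<bar>F y\<bar>} \<subseteq> ?Q - G"
    using mult_left_mono[OF y1(3), of ?\<delta>] by (auto simp: G_def)
  ultimately show "outer_le {z \<in> ?Q. \<bar>F z\<bar> < ?\<delta> * \<bar>F y\<bar>}
      (ennreal (1 - (1 / real (Suc m)) ^ Suc ?d) * emeasure lborel ?Q)"
    unfolding outer_le_def using G by (intro bexI[of _ "?Q - G"]) auto
qed

section \<open>Nondegenerate points\<close>

text \<open>
  What the dynamical argument uses about \<open>f\<close> on a cell: all functions \<open>c\<^sub>0 + c \<bullet> f\<close> are doubling and
  good with common constants, and those with a coefficient of size at least 1 are somewhere of size at
  least \<open>\<rho>\<close>.
\<close>

definition tame ::
  "(real ^ 'd::finite \<Rightarrow> real ^ 'n::finite) \<Rightarrow> nat \<Rightarrow> real ^ 'd \<Rightarrow> real \<Rightarrow> real \<Rightarrow> ennreal \<Rightarrow> real \<Rightarrow> bool" where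
  "tame f j0 x0 \<kappa> \<mu> \<theta> \<rho> \<longleftrightarrow> continuous_on (cell j0 x0) f \<and>
     (\<forall>c0 c. doubling j0 x0 \<kappa> (\<lambda>x. c0 + c \<bullet> f x) \<and> good j0 x0 \<mu> \<theta> (\<lambda>x. c0 + c \<bullet> f x)) \<and>
     (\<forall>c0 c. 1 \<le> \<bar>c0\<bar> \<or> 1 \<le> norm c \<longrightarrow> (\<exists>x\<in>cell j0 x0. \<rho> \<le> \<bar>c0 + c \<bullet> f x\<bar>))"

lemma Ck_on_mono: "Ck_on m U f \<Longrightarrow> l \<le> m \<Longrightarrow> Ck_on l U f"
proof (induction m arbitrary: l f)
  case (Suc m)
  then show ?case by (cases l) auto
qed simp

lemma ex_list_with_counts:
  fixes \<beta> :: "'d::finite \<Rightarrow> nat"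
  shows "\<exists>xs. \<forall>i. count_list xs i = \<beta> i"
proof -
  obtain xs where "mset xs = Abs_multiset \<beta>" using ex_mset by blast
  then have "count_list xs i = \<beta> i" for i
    by (metis count_mset count_Abs_multiset finite)
  then show ?thesis by blast
qed

text \<open>
  Whatever order of differentiation is chosen, the derivative belongs to some word of the right length.
\<close>

lemma multi_deriv_eq_foldr:
  fixes \<beta> :: "'d::finite \<Rightarrow> nat"
  obtains w where "length w = (\<Sum>i\<in>UNIV. \<beta> i)" "multi_deriv \<beta> f = foldr partial_deriv w f"
proof
  let ?w = "SOME xs. \<forall>i. count_list xs i = \<beta> i"
  have "\<forall>i. count_list ?w i = \<beta> i"
    using someI_ex[OF ex_list_with_counts] .
  then show "length ?w = (\<Sum>i\<in>UNIV. \<beta> i)"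
    using sum_count_set[of ?w UNIV] by simp
qed (rule multi_deriv_def)

text \<open>
  Compactness of the unit sphere: a vector orthogonal to a spanning set vanishes.
\<close>

lemma spanning_lower_bound:
  fixes v :: "'w \<Rightarrow> 'a::euclidean_space"
  assumes "finite W" "span (v ` W) = UNIV"
  obtains A where "A > 0" "\<And>c. \<exists>w\<in>W. A * norm c \<le> \<bar>c \<bullet> v w\<bar>"
proof -
  have "W \<noteq> {}"
  proof
    assume "W = {}"
    then have "(UNIV :: 'a set) = {0}" using assms(2) by simp
    moreover obtain b :: 'a where "b \<in> Basis" using nonempty_Basis by blast
    ultimately show False using nonzero_Basis by blast
  qed
  define \<phi> where "\<phi> c = (\<Sum>w\<in>W. \<bar>c \<bullet> v w\<bar>)" for c
  have "continuous_on (sphere 0 1) \<phi>" unfolding \<phi>_def by (intro continuous_intros)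
  moreover have "sphere (0 :: 'a) 1 \<noteq> {}" by simp
  ultimately obtain c1 where c1: "c1 \<in> sphere 0 1" "\<And>c. c \<in> sphere 0 1 \<Longrightarrow> \<phi> c1 \<le> \<phi> c"
    using continuous_attains_inf[of "sphere (0 :: 'a) 1" \<phi>] by auto
  have pos: "\<phi> c1 > 0"
  proof (rule ccontr)
    assume "\<not> ?thesis"
    moreover have "\<phi> c1 \<ge> 0" unfolding \<phi>_def by (intro sum_nonneg) auto
    ultimately have "\<phi> c1 = 0" by simp
    then have "\<forall>w\<in>W. \<bar>c1 \<bullet> v w\<bar> = 0"
      unfolding \<phi>_def using assms(1) by (subst (asm) sum_nonneg_eq_0_iff) auto
    then have "orthogonal c1 y" if "y \<in> v ` W" for y using that by (auto simp: orthogonal_def)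
    then have "orthogonal c1 c1"
      using orthogonal_to_span[of c1 "v ` W" c1] assms(2) by auto
    then show False using c1(1) by (simp add: orthogonal_def)
  qed
  define A where "A = \<phi> c1 / real (card W)"
  have cW: "card W > 0" using assms(1) \<open>W \<noteq> {}\<close> by (simp add: card_gt_0_iff)
  show ?thesis
  proof
    show "A > 0" using pos cW by (simp add: A_def)
    fix c :: 'a
    show "\<exists>w\<in>W. A * norm c \<le> \<bar>c \<bullet> v w\<bar>"
    proof (cases "c = 0")
      case True
      then show ?thesis using \<open>W \<noteq> {}\<close> by auto
    next
      case False
      show ?thesis
      proof (rule ccontr)
        assume "\<not> ?thesis"
        then have less: "\<bar>c \<bullet> v w\<bar> < A * norm c" if "w \<in> W" for w using that by (auto simp: not_le)
        have "\<phi> c = norm c * \<phi> ((1 / norm c) *\<^sub>R c)"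
          using False by (simp add: \<phi>_def sum_distrib_left abs_mult)
        moreover have "\<phi> c1 \<le> \<phi> ((1 / norm c) *\<^sub>R c)"
          using False by (intro c1(2)) simp
        ultimately have "norm c * \<phi> c1 \<le> \<phi> c" by (simp add: mult_left_mono)
        moreover have "\<phi> c < (\<Sum>w\<in>W. A * norm c)"
          unfolding \<phi>_def using less assms(1) \<open>W \<noteq> {}\<close> by (intro sum_strict_mono) auto
        ultimately show False using cW by (simp add: A_def mult.commute)
      qed
    qed
  qed
qed

lemma norm_iter_diff_le_sample:
  "\<exists>z\<in>partial_sums vs x. norm (iter_diff vs g x) \<le> 2 ^ length vs * norm (g z)"
proof (induction vs arbitrary: x)
  case (Cons v vs)
  obtain z1 where z1: "z1 \<in> partial_sums vs (x + v)" "norm (iter_diff vs g (x + v)) \<le> 2 ^ length vs * norm (g z1)"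
    using Cons by blast
  obtain z2 where z2: "z2 \<in> partial_sums vs x" "norm (iter_diff vs g x) \<le> 2 ^ length vs * norm (g z2)"
    using Cons by blast
  have "norm (iter_diff (v # vs) g x) \<le> 2 ^ length vs * norm (g z1) + 2 ^ length vs * norm (g z2)"
    unfolding iter_diff_Cons using z1(2) z2(2) norm_triangle_ineq4 by (meson add_mono order_trans)
  moreover have "\<exists>z\<in>{z1, z2}. norm (g z1) + norm (g z2) \<le> 2 * norm (g z)"
    by auto
  then obtain z where z: "z \<in> {z1, z2}" "norm (g z1) + norm (g z2) \<le> 2 * norm (g z)" by blast
  moreover have "2 ^ length vs * norm (g z1) + 2 ^ length vs * norm (g z2) \<le> 2 ^ length vs * (2 * norm (g z))"
    unfolding distrib_left[symmetric] using z(2) by (intro mult_left_mono) auto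
  ultimately show ?case using z1(1) z2(1) by (intro bexI[of _ z]) auto
qed simp

lemma constant_sublevel_small: "\<delta> \<le> 1 \<Longrightarrow> sublevel_small j0 x0 \<delta> \<theta> (\<lambda>x. c)"
proof -
  assume "\<delta> \<le> 1"
  then have "\<not> \<bar>c\<bar> < \<delta> * \<bar>c\<bar>" using mult_right_mono[of \<delta> 1 "\<bar>c\<bar>"] by simp
  then show ?thesis unfolding sublevel_small_def outer_le_def
    by (auto intro!: bexI[of _ "{}"])
qed

text \<open>
  \<open>A'\<close> is a lower bound, for unit \<open>c\<close>, of the largest derivative of \<open>c \<bullet> f\<close> at \<open>x0\<close>.  On a cell so small that all derivatives
  up to order \<open>m\<close> vary by at most \<open>\<eta>\<close>, mixed differences give the lower bound \<open>\<bar>c\<bar> A1 s\<^sup>m\<close> for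
  \<open>\<bar>c\<^sub>0 + c \<bullet> f\<bar>\<close> on every subcell of side \<open>s\<close>, and the oscillation bounds the differences of order
  \<open>m + 1\<close>.  The choice of \<open>\<eta>\<close> makes the second negligible against the first.
\<close>

theorem nondegenerate_imp_tame:
  fixes f :: "real ^ 'd::finite \<Rightarrow> real ^ 'n::finite"
  assumes C: "Ck_on m U f" and "open U" and x0: "x0 \<in> U" and m: "1 \<le> m"
    and sp: "span {multi_deriv \<beta> f x0 | \<beta>. 1 \<le> (\<Sum>i\<in>UNIV. \<beta> i) \<and> (\<Sum>i\<in>UNIV. \<beta> i) \<le> m} = UNIV"
  shows "\<exists>j0 \<kappa> \<mu> \<theta> \<rho>. 0 < \<kappa> \<and> \<kappa> \<le> 1 \<and> 0 < \<mu> \<and> \<mu> < 1 \<and> 0 < \<theta> \<and> \<theta> < 1 \<and> 0 < \<rho> \<and> \<rho> \<le> 1 \<and>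
    cell j0 x0 \<subseteq> U \<and> tame f j0 x0 \<kappa> \<mu> (ennreal \<theta>) \<rho>"
proof -
  define W where "W = {w :: 'd list. 1 \<le> length w \<and> length w \<le> m}"
  have finW': "finite {w :: 'd list. length w \<le> m}"
    using finite_lists_length_le[of "UNIV :: 'd set" m] by simp
  then have finW: "finite W" by (rule rev_finite_subset) (auto simp: W_def)
  have "{multi_deriv \<beta> f x0 | \<beta>. 1 \<le> (\<Sum>i\<in>UNIV. \<beta> i) \<and> (\<Sum>i\<in>UNIV. \<beta> i) \<le> m}
      \<subseteq> (\<lambda>w. foldr partial_deriv w f x0) ` W"
  proof clarify
    fix \<beta> :: "'d \<Rightarrow> nat" assume "1 \<le> (\<Sum>i\<in>UNIV. \<beta> i)" "(\<Sum>i\<in>UNIV. \<beta> i) \<le> m"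
    then show "multi_deriv \<beta> f x0 \<in> (\<lambda>w. foldr partial_deriv w f x0) ` W"
      using multi_deriv_eq_foldr[of \<beta> f] by (metis (mono_tags, lifting) W_def image_eqI mem_Collect_eq)
  qed
  from span_mono[OF this] have "span ((\<lambda>w. foldr partial_deriv w f x0) ` W) = UNIV" using sp by auto
  from spanning_lower_bound[OF finW this] obtain A' where A': "A' > 0"
    "\<And>c. \<exists>w\<in>W. A' * norm c \<le> \<bar>c \<bullet> foldr partial_deriv w f x0\<bar>" by blast
  define A where "A = A' / 2"
  have A: "A > 0" using A' by (simp add: A_def)
  \<comment> \<open>A difference with step \<open>h = s / (2 m)\<close> stays in a cell of side \<open>s\<close>; it is a sum of at most \<open>2\<^sup>m\<close> values, so some value is at least \<open>A (h / 2)\<^sup>m\<close> times the norm of \<open>c\<close>.\<close>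
  define A1 where "A1 = A / (4 * real m) ^ m"
  have A1: "A1 > 0" using A m by (simp add: A1_def)
  define \<eta> where "\<eta> = min A (A1 / (2 ^ Suc m * real CARD('d) ^ m))"
  have \<eta>: "0 < \<eta>" "\<eta> \<le> A" "\<eta> \<le> A1 / (2 ^ Suc m * real CARD('d) ^ m)"
    using A A1 by (auto simp: \<eta>_def)
  have "\<forall>\<^sub>F z in nhds x0. z \<in> U \<and> norm (foldr partial_deriv w f z - foldr partial_deriv w f x0) \<le> \<eta>"
    if "length w \<le> m" for w
  proof -
    have "Ck_on (m - length w) U (foldr partial_deriv w f)"
      using C that by (intro Ck_on_foldr_partial_deriv) simp
    then have "continuous_on U (foldr partial_deriv w f)" by (rule Ck_on_continuous)
    then have "(foldr partial_deriv w f \<longlongrightarrow> foldr partial_deriv w f x0) (nhds x0)"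
      using x0 \<open>open U\<close> by (metis continuous_on_eq_continuous_at continuous_within tendsto_at_iff_tendsto_nhds)
    then have "\<forall>\<^sub>F z in nhds x0. dist (foldr partial_deriv w f z) (foldr partial_deriv w f x0) < \<eta>"
      using \<eta>(1) by (rule tendstoD)
    moreover have "\<forall>\<^sub>F z in nhds x0. z \<in> U" using x0 \<open>open U\<close> by (simp add: eventually_nhds_in_open)
    ultimately show ?thesis by eventually_elim (simp add: dist_norm)
  qed
  then have "\<forall>\<^sub>F z in nhds x0. \<forall>w\<in>{w. length w \<le> m}. z \<in> U \<and> norm (foldr partial_deriv w f z - foldr partial_deriv w f x0) \<le> \<eta>"
    using finW' by (subst eventually_ball_finite_distrib) auto
  then obtain \<delta> where \<delta>0: "\<delta> > 0" and "\<forall>z. dist z x0 < \<delta> \<longrightarrow> (\<forall>w\<in>{w. length w \<le> m}. z \<in> U \<and>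
      norm (foldr partial_deriv w f z - foldr partial_deriv w f x0) \<le> \<eta>)"
    unfolding eventually_nhds_metric by blast
  then have \<delta>: "z \<in> U \<and> norm (foldr partial_deriv w f z - foldr partial_deriv w f x0) \<le> \<eta>"
    if "dist z x0 < \<delta>" "length w \<le> m" for z w
    using that by blast
  obtain j0 where "\<And>j. j0 \<le> j \<Longrightarrow> cell j x0 \<subseteq> ball x0 \<delta>"
    using cell_in_ball[OF \<delta>0] by blast
  from this[OF order_refl] have "cell j0 x0 \<subseteq> ball x0 \<delta>" .
  then have cell_\<delta>: "dist z x0 < \<delta>" if "z \<in> cell j0 x0" for z using that by (auto simp: dist_commute)
  have cell_U: "cell j0 x0 \<subseteq> U" using \<delta>[of _ "[]"] cell_\<delta> by auto
  have near: "norm (foldr partial_deriv w f z - foldr partial_deriv w f x0) \<le> \<eta>"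
    if "z \<in> cell j0 x0" "length w \<le> m" for z w
    using \<delta> cell_\<delta> that by blast
  have diff: "\<bar>iter_diff (replicate (Suc m) v) (\<lambda>x. c0 + c \<bullet> f x) x\<bar> \<le> norm c * (real CARD('d) ^ m * (2 * \<eta>)) * (1 / 2 ^ j) ^ m"
    if j: "j0 \<le> j" and y: "y \<in> cell j0 x0" and x: "x \<in> cell j y" and xv: "x + real (Suc m) *\<^sub>R v \<in> cell j y"
    for j x y v c0 c
  proof -
    have sub: "cell j y \<subseteq> cell j0 x0" by (rule subcell[OF y j])
    have "norm (iter_diff (replicate (Suc m) v) f x) \<le> (\<Sum>i\<in>UNIV. \<bar>v $ i\<bar>) ^ m * (2 * \<eta>)"
    proof (rule norm_iter_diff_le_oscillation[OF C \<open>open U\<close> _ convex_cell _ x xv])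
      show "cell j y \<subseteq> U" using sub cell_U by blast
      fix w :: "'d list" and z z' assume "length w = m" "z \<in> cell j y" "z' \<in> cell j y"
      then have "norm (foldr partial_deriv w f z - foldr partial_deriv w f x0) \<le> \<eta>"
          "norm (foldr partial_deriv w f z' - foldr partial_deriv w f x0) \<le> \<eta>"
        using near sub by auto
      then show "norm (foldr partial_deriv w f z - foldr partial_deriv w f z') \<le> 2 * \<eta>"
        by norm
    qed
    also have "\<dots> \<le> (real CARD('d) * (1 / 2 ^ j)) ^ m * (2 * \<eta>)"
    proof (intro mult_right_mono power_mono)
      have "\<bar>v $ i\<bar> \<le> 1 / 2 ^ j" for i
      proof -
        have "1 * \<bar>v $ i\<bar> \<le> real (Suc m) * \<bar>v $ i\<bar>" by (intro mult_right_mono) auto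
        also have "\<dots> = \<bar>(x + real (Suc m) *\<^sub>R v) $ i - x $ i\<bar>" by (simp add: abs_mult)
        also have "\<dots> < 1 / 2 ^ j" by (rule cell_dist_less[OF xv x])
        finally show ?thesis by simp
      qed
      then show "(\<Sum>i\<in>UNIV. \<bar>v $ i\<bar>) \<le> real CARD('d) * (1 / 2 ^ j)"
        using sum_bounded_above[of UNIV "\<lambda>i. \<bar>v $ i\<bar>" "1 / 2 ^ j"] by simp
    qed (use \<eta> in \<open>auto intro: sum_nonneg\<close>)
    finally have "norm (iter_diff (replicate (Suc m) v) f x) \<le> (real CARD('d) * (1 / 2 ^ j)) ^ m * (2 * \<eta>)" .
    from mult_left_mono[OF this norm_ge_zero[of c]] Cauchy_Schwarz_ineq2[of c "iter_diff (replicate (Suc m) v) f x"]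
    have "\<bar>c \<bullet> iter_diff (replicate (Suc m) v) f x\<bar> \<le> norm c * ((real CARD('d) * (1 / 2 ^ j)) ^ m * (2 * \<eta>))"
      by (rule order_trans[rotated])
    then show ?thesis
      unfolding power_mult_distrib by (subst iter_diff_affine) (simp_all only: mult_ac, simp)
  qed
  have lower: "\<exists>x\<in>cell j y. norm c * A1 * (1 / 2 ^ j) ^ m \<le> \<bar>c0 + c \<bullet> f x\<bar>"
    if j: "j0 \<le> j" and y: "y \<in> cell j0 x0" for j y c0 c
  proof -
    obtain p where p: "cell j y = {y. \<forall>i. p $ i \<le> y $ i \<and> y $ i < p $ i + 1 / 2 ^ j}"
      by (rule cell_corner)
    obtain w where w: "1 \<le> length w" "length w \<le> m" "A' * norm c \<le> \<bar>c \<bullet> foldr partial_deriv w f x0\<bar>"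
      using A'(2)[of c] by (auto simp: W_def)
    define h where "h = 1 / (2 * real m) * (1 / 2 ^ j)"
    have h: "0 < h" "h \<le> 1"
    proof -
      show "0 < h" using m by (simp add: h_def)
      have "1 / (2 * real m) \<le> 1" "1 / 2 ^ j \<le> (1 :: real)" using m by auto
      then show "h \<le> 1" unfolding h_def by (intro mult_le_one) auto
    qed
    have box: "z \<in> cell j y" if z: "\<And>i. p $ i \<le> z $ i \<and> z $ i \<le> p $ i + real (length w) * h" for z
    proof -
      have "real (length w) * h \<le> real m * h" using w(2) h by (intro mult_right_mono) auto
      also have "\<dots> = (1 / 2 ^ j) / 2" using m by (simp add: h_def)
      also have "\<dots> < 1 / 2 ^ j"
      proof -
        have half: "a / 2 < a" if "0 < a" for a :: real using that by simp
        show ?thesis by (rule half) simp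
      qed
      finally have "real (length w) * h < 1 / 2 ^ j" .
      then have "p $ i \<le> z $ i \<and> z $ i < p $ i + 1 / 2 ^ j" for i
        using z[of i] by linarith
      then show ?thesis unfolding p by blast
    qed
    let ?vs = "map (\<lambda>i. h *\<^sub>R axis i (1 :: real)) w"
    let ?a = "foldr partial_deriv w f x0"
    have sub: "cell j y \<subseteq> cell j0 x0" by (rule subcell[OF y j])
    have "norm (iter_diff ?vs f p - h ^ length w *\<^sub>R ?a) \<le> h ^ length w * \<eta>"
    proof (rule iter_diff_axes_approx[where Q = "cell j y" and U = U])
      show "Ck_on (length w) U f" using Ck_on_mono[OF C w(2)] .
      show "cell j y \<subseteq> U" using sub cell_U by blast
      show "norm (foldr partial_deriv w f z - ?a) \<le> \<eta>" if "z \<in> cell j y" for z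
        using near sub that w(2) by blast
    qed (use h box in auto)
    from mult_left_mono[OF this norm_ge_zero[of c]] Cauchy_Schwarz_ineq2[of c "iter_diff ?vs f p - h ^ length w *\<^sub>R ?a"]
    have 1: "\<bar>c \<bullet> iter_diff ?vs f p - h ^ length w * (c \<bullet> ?a)\<bar> \<le> norm c * (h ^ length w * \<eta>)"
      by (simp add: inner_diff_right)
    have "norm c * (h ^ length w * \<eta>) \<le> norm c * (h ^ length w * A)"
      using \<eta> h by (intro mult_left_mono) auto
    moreover have "h ^ length w * (A' * norm c) \<le> \<bar>h ^ length w * (c \<bullet> ?a)\<bar>"
      using w(3) h by (simp add: abs_mult)
    moreover have "h ^ length w * (A' * norm c) = 2 * (norm c * (h ^ length w * A))"
      by (simp add: A_def)
    ultimately have 2: "norm c * (h ^ length w * A) \<le> \<bar>c \<bullet> iter_diff ?vs f p\<bar>"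
      using 1 by linarith
    have "?vs \<noteq> []" using w(1) by auto
    from iter_diff_affine[OF this, of c0 c f p]
    have 3: "norm c * (h ^ length w * A) \<le> norm (iter_diff ?vs (\<lambda>x. c0 + c \<bullet> f x) p)" using 2 by simp
    obtain z where z: "z \<in> partial_sums ?vs p"
      "norm (iter_diff ?vs (\<lambda>x. c0 + c \<bullet> f x) p) \<le> 2 ^ length w * \<bar>c0 + c \<bullet> f z\<bar>"
      using norm_iter_diff_le_sample[of ?vs p "\<lambda>x. c0 + c \<bullet> f x"] by auto
    have zin: "z \<in> cell j y"
      using partial_sums_axes[OF less_imp_le[OF h(1)] z(1)] by (intro box) auto
    have "norm c * A1 * (1 / 2 ^ j) ^ m = norm c * A * (h / 2) ^ m"
    proof -
      have "h / 2 = 1 / (4 * real m) * (1 / 2 ^ j)" by (simp add: h_def)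
      then have "(h / 2) ^ m = 1 / (4 * real m) ^ m * (1 / 2 ^ j) ^ m"
        by (simp only: power_mult_distrib) (simp add: power_divide)
      then show ?thesis by (simp add: A1_def)
    qed
    also have "\<dots> \<le> norm c * A * (h / 2) ^ length w"
      using h w(2) A by (intro mult_left_mono power_decreasing) auto
    also have "\<dots> \<le> \<bar>c0 + c \<bullet> f z\<bar>"
      using order_trans[OF 3 z(2)] by (simp add: field_simps power_divide)
    finally show ?thesis using zin by blast
  qed
  define \<kappa> :: real where "\<kappa> = 1 / (2 ^ (m + 2)) ^ (4 * Suc m)"
  define \<delta>' :: real where "\<delta>' = 1 / 2 ^ (m + 3)"
  define \<theta> where "\<theta> = 1 - (1 / real (Suc m)) ^ Suc CARD('d)"
  have "1 \<le> ((2 :: real) ^ (m + 2)) ^ (4 * Suc m)" by (intro one_le_power) simp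
  then have \<kappa>: "0 < \<kappa>" "\<kappa> \<le> 1" unfolding \<kappa>_def by (simp_all only: divide_le_eq_1) auto
  have \<delta>': "0 < \<delta>'" "\<delta>' < 1" by (auto simp: \<delta>'_def)
  have \<theta>: "0 < \<theta>" "\<theta> < 1"
  proof -
    have "(1 / real (Suc m)) ^ Suc CARD('d) \<le> (1 / real (Suc m)) ^ 1"
      by (intro power_decreasing) auto
    also have "\<dots> < 1" using m by simp
    finally show "0 < \<theta>" by (simp add: \<theta>_def)
    show "\<theta> < 1" by (simp add: \<theta>_def)
  qed
  have contf: "continuous_on (cell j0 x0) f"
    using Ck_on_continuous[OF C] cell_U continuous_on_subset by blast
  have EL: "2 ^ m * (norm c * (real CARD('d) ^ m * (2 * \<eta>))) \<le> norm c * A1" for c :: "real ^ 'n"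
  proof -
    have "2 ^ m * (real CARD('d) ^ m * (2 * \<eta>)) \<le> A1"
      using \<eta>(3) by (simp add: field_simps)
    from mult_left_mono[OF this, of "norm c"] show ?thesis by (simp add: mult_ac)
  qed
  have dg: "doubling j0 x0 \<kappa> (\<lambda>x. c0 + c \<bullet> f x)" "good j0 x0 (\<kappa> * \<delta>') (ennreal \<theta>) (\<lambda>x. c0 + c \<bullet> f x)" for c0 c
  proof -
    show d: "doubling j0 x0 \<kappa> (\<lambda>x. c0 + c \<bullet> f x)"
      unfolding \<kappa>_def by (rule almost_polynomial_doubling[OF diff lower EL])
    have cont: "continuous_on (cell j0 x0) (\<lambda>x. c0 + c \<bullet> f x)"
      using contf by (intro continuous_intros)
    have s: "sublevel_small j0 x0 \<delta>' (ennreal \<theta>) (\<lambda>x. c0 + c \<bullet> f x)"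
    proof (cases "c = 0")
      case True
      then show ?thesis using constant_sublevel_small[of \<delta>' j0 x0 "ennreal \<theta>" c0] \<delta>' by simp
    next
      case False
      have "2 * (norm c * (real CARD('d) ^ m * (2 * \<eta>))) \<le> 2 ^ m * (norm c * (real CARD('d) ^ m * (2 * \<eta>)))"
        using m \<eta> power_increasing[OF m, of "2 :: real"] by (intro mult_right_mono) auto
      then have "2 * (norm c * (real CARD('d) ^ m * (2 * \<eta>))) \<le> norm c * A1"
        using EL[of c] by linarith
      then show ?thesis
        unfolding \<delta>'_def \<theta>_def using False A1 cont
        by (intro almost_polynomial_sublevel_small[OF diff lower]) auto
    qed
    show "good j0 x0 (\<kappa> * \<delta>') (ennreal \<theta>) (\<lambda>x. c0 + c \<bullet> f x)"
      using \<kappa> \<delta>' by (intro doubling_imp_good[OF cont d s]) auto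
  qed
  define L0 where "L0 = A1 * (1 / 2 ^ j0) ^ m"
  define K where "K = norm (f x0) + 1"
  have L0: "L0 > 0" using A1 by (simp add: L0_def)
  have K: "K \<ge> 1" by (simp add: K_def)
  \<comment> \<open>Either \<open>c\<close> is so small that \<open>c\<^sub>0\<close> dominates at \<open>x0\<close>, or its norm is at least \<open>1 / (2 K)\<close> and the lower bound on the cell applies.\<close>
  define \<rho> where "\<rho> = min (1 / 2) (L0 / (2 * K))"
  have \<rho>: "0 < \<rho>" "\<rho> \<le> 1" using L0 K by (auto simp: \<rho>_def)
  have low: "\<exists>x\<in>cell j0 x0. \<rho> \<le> \<bar>c0 + c \<bullet> f x\<bar>" if "1 \<le> \<bar>c0\<bar> \<or> 1 \<le> norm c" for c0 c
  proof (cases "norm c * K \<le> 1 / 2")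
    case True
    have "norm c * 1 \<le> norm c * K" using K by (intro mult_left_mono) auto
    then have "1 \<le> \<bar>c0\<bar>" using that True by auto
    moreover have "\<bar>c \<bullet> f x0\<bar> \<le> norm c * K"
      using Cauchy_Schwarz_ineq2[of c "f x0"] by (simp add: K_def distrib_left add_increasing2)
    ultimately have "1 / 2 \<le> \<bar>c0 + c \<bullet> f x0\<bar>" using True by linarith
    then show ?thesis by (intro bexI[of _ x0]) (auto simp: \<rho>_def min_le_iff_disj)
  next
    case False
    obtain x where x: "x \<in> cell j0 x0" "norm c * A1 * (1 / 2 ^ j0) ^ m \<le> \<bar>c0 + c \<bullet> f x\<bar>"
      using lower[of j0 x0 c c0] by auto
    have "1 / (2 * K) \<le> norm c" using False K by (simp add: field_simps)
    from mult_right_mono[OF this, of L0] L0 have "L0 / (2 * K) \<le> norm c * L0" by simp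
    also have "\<dots> \<le> \<bar>c0 + c \<bullet> f x\<bar>" using x(2) by (simp add: L0_def mult_ac)
    finally show ?thesis using x(1) by (intro bexI[of _ x]) (auto simp: \<rho>_def min_le_iff_disj)
  qed
  have "tame f j0 x0 \<kappa> (\<kappa> * \<delta>') (ennreal \<theta>) \<rho>"
    unfolding tame_def using contf dg low by blast
  moreover have "0 < \<kappa> * \<delta>'" "\<kappa> * \<delta>' < 1"
    using \<kappa> \<delta>' le_less_trans[OF mult_right_mono[of \<kappa> 1 \<delta>']] by auto
  ultimately show ?thesis using \<kappa> \<theta> \<rho> cell_U by blast
qed

section \<open>Covolumes of rational subspaces\<close>

text \<open>
  A coordinate of the exterior product of the vectors \<open>h (v s)\<close>, \<open>s \<in> J\<close>.  Completing the family
  by standard basis vectors in the remaining slots turns minors of every order into determinants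
  of one fixed size, so that the usual row operations apply.
\<close>

definition minor :: "(real ^ 'k::finite \<Rightarrow> real ^ 'k) \<Rightarrow> 'k set \<Rightarrow> ('k \<Rightarrow> real ^ 'k) \<Rightarrow> ('k \<Rightarrow> 'k) \<Rightarrow> real" where
  "minor h J v c = det (\<chi> s. if s \<in> J then h (v s) else axis (c s) 1)"

definition wedge_norm :: "(real ^ 'k::finite \<Rightarrow> real ^ 'k) \<Rightarrow> 'k set \<Rightarrow> ('k \<Rightarrow> real ^ 'k) \<Rightarrow> real" where
  "wedge_norm h J v = Max (range (\<lambda>c. \<bar>minor h J v c\<bar>))"

lemma minor_le_wedge_norm: "\<bar>minor h J v c\<bar> \<le> wedge_norm h J v"
  unfolding wedge_norm_def by (intro Max_ge) auto

lemma wedge_norm_attained: obtains c where "wedge_norm h J v = \<bar>minor h J v c\<bar>"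
proof -
  have "wedge_norm h J v \<in> range (\<lambda>c. \<bar>minor h J v c\<bar>)"
    unfolding wedge_norm_def by (intro Max_in) auto
  then show ?thesis using that by blast
qed

lemma wedge_norm_nonneg: "0 \<le> wedge_norm h J v"
  using minor_le_wedge_norm[of h J v] abs_ge_zero order_trans by blast

text \<open>
  Changing the basis of a subspace multiplies all minors by one determinant, which does not
  depend on the linear map \<open>h\<close>.
\<close>

lemma minor_change_basis:
  fixes v v' :: "'k::finite \<Rightarrow> real ^ 'k"
  assumes "\<And>s. s \<in> J \<Longrightarrow> v' s \<in> span (v ` J)"
  obtains a where "\<And>h c. linear h \<Longrightarrow> minor h J v' c = a * minor h J v c"
proof -
  have "\<exists>A. v' s = (\<Sum>t\<in>J. A t *\<^sub>R v t)" if s: "s \<in> J" for s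
  proof -
    have "v' s \<in> span (v ` J)" using assms[OF s] .
    then show ?thesis
    proof (induction rule: span_induct_alt)
      case base
      show ?case by (intro exI[of _ "\<lambda>_. 0"]) simp
    next
      case (step c x y)
      then obtain A t where A: "y = (\<Sum>t\<in>J. A t *\<^sub>R v t)" and t: "t \<in> J" "x = v t" by blast
      have "(\<Sum>u\<in>J. (A u + (if u = t then c else 0)) *\<^sub>R v u) = (\<Sum>u\<in>J. A u *\<^sub>R v u) + (\<Sum>u\<in>J. if u = t then c *\<^sub>R v u else 0)"
        unfolding sum.distrib[symmetric] by (rule sum.cong) (auto simp: scaleR_add_left)
      also have "\<dots> = c *\<^sub>R x + y" using t A by (simp add: add.commute)
      finally show ?case by metis
    qed
  qed
  then obtain A where A: "\<And>s. s \<in> J \<Longrightarrow> v' s = (\<Sum>t\<in>J. A s t *\<^sub>R v t)" by metis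
  define M :: "real ^ 'k ^ 'k" where
    "M = (\<chi> s t. if s \<in> J then (if t \<in> J then A s t else 0) else (if s = t then 1 else 0))"
  show ?thesis
  proof
    fix h :: "real ^ 'k \<Rightarrow> real ^ 'k" and c
    assume h: "linear h"
    have "(\<chi> s. if s \<in> J then h (v' s) else axis (c s) 1) = M ** (\<chi> s. if s \<in> J then h (v s) else axis (c s) 1)"
    proof (subst vec_eq_iff, subst vec_eq_iff, intro allI)
      fix s r
      show "(\<chi> s. if s \<in> J then h (v' s) else axis (c s) 1) $ s $ r =
          (M ** (\<chi> s. if s \<in> J then h (v s) else axis (c s) 1)) $ s $ r"
      proof (cases "s \<in> J")
        case True
        have "h (v' s) $ r = (\<Sum>t\<in>J. A s t * h (v t) $ r)"
          unfolding A[OF True] by (simp add: linear_sum[OF h] linear_scale[OF h])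
        also have "\<dots> = (\<Sum>t\<in>UNIV. if t \<in> J then A s t * h (v t) $ r else 0)"
          by (simp add: sum.If_cases)
        also have "\<dots> = (M ** (\<chi> s. if s \<in> J then h (v s) else axis (c s) 1)) $ s $ r"
          using True by (auto simp: matrix_matrix_mult_def M_def intro!: sum.cong)
        finally show ?thesis using True by simp
      next
        case False
        then have "(M ** (\<chi> s. if s \<in> J then h (v s) else axis (c s) 1)) $ s $ r =
            (\<Sum>t\<in>UNIV. if s = t then axis (c s) 1 $ r else 0)"
          unfolding matrix_matrix_mult_def M_def vec_lambda_beta by (intro sum.cong) auto
        then show ?thesis using False by simp
      qed
    qed
    then show "minor h J v' c = det M * minor h J v c"
      unfolding minor_def by (simp add: det_mul)
  qed
qed

lemma wedge_norm_scale:
  assumes "\<And>c. minor h J v' c = a * minor h J v c"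
  shows "wedge_norm h J v' = \<bar>a\<bar> * wedge_norm h J v"
proof (rule antisym)
  obtain c where c: "wedge_norm h J v' = \<bar>minor h J v' c\<bar>" by (rule wedge_norm_attained)
  show "wedge_norm h J v' \<le> \<bar>a\<bar> * wedge_norm h J v"
    unfolding c assms abs_mult by (intro mult_left_mono minor_le_wedge_norm) simp
  obtain c where c: "wedge_norm h J v = \<bar>minor h J v c\<bar>" by (rule wedge_norm_attained)
  show "\<bar>a\<bar> * wedge_norm h J v \<le> wedge_norm h J v'"
    unfolding c abs_mult[symmetric] assms[symmetric] by (rule minor_le_wedge_norm)
qed

text \<open>
  Submultiplicativity: expand the minor linearly in the new row \<open>h w\<close>; each term is a minor
  of the old family in which the slot \<open>s\<close> is filled by a standard basis vector.
\<close>

lemma wedge_norm_insert: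
  fixes v :: "'k::finite \<Rightarrow> real ^ 'k"
  assumes "s \<notin> J"
  shows "wedge_norm h (insert s J) (v(s := w)) \<le> (\<Sum>r\<in>UNIV. \<bar>h w $ r\<bar>) * wedge_norm h J v"
proof -
  obtain c where c: "wedge_norm h (insert s J) (v(s := w)) = \<bar>minor h (insert s J) (v(s := w)) c\<bar>"
    by (rule wedge_norm_attained)
  let ?g = "\<lambda>t. if t \<in> J then h (v t) else axis (c t) 1"
  have "minor h (insert s J) (v(s := w)) c = det (\<chi> t. if t = s then (\<Sum>r\<in>UNIV. h w $ r *s axis r 1) else ?g t)"
    unfolding minor_def
    by (rule arg_cong[where f = det]) (use assms in \<open>auto simp: vec_eq_iff basis_expansion\<close>)
  also have "\<dots> = (\<Sum>r\<in>UNIV. h w $ r * det (\<chi> t. if t = s then axis r 1 else ?g t))"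
    by (simp only: det_linear_row_sum[OF finite] det_row_mul)
  also have "\<dots> = (\<Sum>r\<in>UNIV. h w $ r * minor h J v (c(s := r)))"
    unfolding minor_def
    by (intro sum.cong refl arg_cong2[where f = times] arg_cong[where f = det])
       (use assms in \<open>auto simp: vec_eq_iff\<close>)
  also have "\<bar>\<dots>\<bar> \<le> (\<Sum>r\<in>UNIV. \<bar>h w $ r\<bar> * wedge_norm h J v)"
    by (rule order_trans[OF sum_abs]) (auto simp: abs_mult intro!: sum_mono mult_left_mono minor_le_wedge_norm)
  finally show ?thesis unfolding c by (simp add: sum_distrib_right)
qed

lemma det_eq_0_if_rows_eq:
  fixes X :: "'k::finite \<Rightarrow> real ^ 'k"
  shows "s \<noteq> t \<Longrightarrow> X s = X t \<Longrightarrow> det (\<chi> s. X s) = 0"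
  by (rule det_identical_rows[of s t]) (simp_all add: row_def)

lemma wedge_norm_empty: "wedge_norm h {} v \<le> 1"
proof -
  obtain c where c: "wedge_norm h {} v = \<bar>minor h {} v c\<bar>" by (rule wedge_norm_attained)
  have "\<bar>minor h {} v c\<bar> \<le> 1"
  proof (cases "inj c")
    case True
    then have "c permutes UNIV"
      by (intro bij_imp_permutes) (simp_all add: bij_betw_def finite_UNIV_inj_surj)
    from det_permute_rows[OF this, of "mat 1 :: real ^ 'a ^ 'a"]
    have "det (\<chi> s. (mat 1 :: real ^ 'a ^ 'a) $ c s) = of_int (sign c)" by simp
    moreover have "(\<chi> s. (mat 1 :: real ^ 'a ^ 'a) $ c s) = (\<chi> s. axis (c s) 1)"
      by (auto simp: vec_eq_iff mat_def axis_def)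
    ultimately show ?thesis unfolding minor_def by (simp add: sign_def)
  next
    case False
    then obtain s t where "s \<noteq> t" "c s = c t" by (auto simp: inj_def)
    then show ?thesis unfolding minor_def using det_eq_0_if_rows_eq[of s t "\<lambda>s. axis (c s) 1"] by simp
  qed
  then show ?thesis using c by simp
qed

text \<open>
  An independent family can be completed to a basis by standard basis vectors (Steinitz).
\<close>

lemma independent_minor_nonzero:
  fixes v :: "'k::finite \<Rightarrow> real ^ 'k"
  assumes "independent (v ` J)" "inj_on v J"
  obtains c where "minor (\<lambda>x. x) J v c \<noteq> 0"
proof -
  obtain B where B: "v ` J \<subseteq> B" "B \<subseteq> v ` J \<union> Basis" "independent B" "v ` J \<union> Basis \<subseteq> span B"
    using maximal_independent_subset_extend[of "v ` J" "v ` J \<union> Basis"] assms(1) by auto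
  have spB: "span B = UNIV"
    using span_mono[of Basis "span B"] B(4) by (auto simp: span_span)
  have finB: "finite B" using B(3) independent_imp_finite by blast
  have "card B = CARD('k)"
    using dim_span_eq_card_independent[OF B(3)] spB by (simp add: dim_UNIV)
  then have "card (B - v ` J) = card (- J)"
    using B(1) finB assms(2)
    by (subst card_Diff_subset) (auto simp: card_image Compl_eq_Diff_UNIV card_Diff_subset intro: finite_subset)
  then obtain g where g: "bij_betw g (- J) (B - v ` J)"
    using finite_same_card_bij[of "- J" "B - v ` J"] finB by auto
  have "\<exists>r. g s = axis r 1" if "s \<notin> J" for s
  proof -
    have "g s \<in> B - v ` J" using g that by (auto simp: bij_betw_def)
    then have "g s \<in> Basis" using B(2) by auto
    then show ?thesis by (auto simp: Basis_vec_def)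
  qed
  then obtain c where c: "\<And>s. s \<notin> J \<Longrightarrow> g s = axis (c s) 1" by metis
  let ?A = "(\<chi> s. if s \<in> J then v s else axis (c s) 1) :: real ^ 'k ^ 'k"
  have "rows ?A = B"
  proof -
    have "rows ?A = (\<lambda>s. if s \<in> J then v s else axis (c s) 1) ` UNIV"
      by (auto simp: rows_def row_def image_def)
    also have "\<dots> = v ` J \<union> g ` (- J)" using c by auto
    also have "\<dots> = B" using g B(1) by (auto simp: bij_betw_def)
    finally show ?thesis .
  qed
  then have "\<exists>B. B ** ?A = mat 1" using matrix_left_invertible_span_rows spB by blast
  then have "invertible ?A" by (simp add: invertible_left_inverse)
  then have "det ?A \<noteq> 0" by (simp add: invertible_det_nz)
  then show ?thesis using that unfolding minor_def by blast
qed

definition int_vec :: "real ^ 'k::finite \<Rightarrow> bool" where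
  "int_vec v \<longleftrightarrow> (\<forall>i. v $ i \<in> \<int>)"

lemma minor_Ints:
  assumes "\<And>s. s \<in> J \<Longrightarrow> int_vec (v s)"
  shows "minor (\<lambda>x. x) J v c \<in> \<int>"
  unfolding minor_def det_def
  using assms by (intro Ints_sum Ints_mult Ints_prod) (auto simp: int_vec_def axis_def)

text \<open>
  A fixed enumeration of the slots.  Frames of subspaces of dimension \<open>j\<close> always occupy the
  first \<open>j\<close> slots, which makes all frames of the same subspace directly comparable.
\<close>

definition slot_index :: "'k::finite \<Rightarrow> nat" where
  "slot_index = (SOME f. bij_betw f UNIV {0..<CARD('k)})"

definition slots :: "nat \<Rightarrow> 'k::finite set" where
  "slots j = {s. slot_index s < j}"

lemma bij_slot_index: "bij_betw (slot_index :: 'k::finite \<Rightarrow> nat) UNIV {0..<CARD('k)}"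
  unfolding slot_index_def by (rule someI_ex[OF ex_bij_betw_finite_nat]) simp

lemma slots_Suc:
  assumes "j < CARD('k::finite)"
  obtains s :: "'k::finite" where "s \<notin> slots j" "slots (Suc j) = insert s (slots j)"
proof -
  have "j \<in> (slot_index :: 'k \<Rightarrow> nat) ` UNIV"
    using bij_slot_index[where 'k = 'k] assms unfolding bij_betw_def by auto
  then obtain s :: 'k where s: "slot_index s = j" by auto
  have "slot_index t = j \<longleftrightarrow> t = s" for t
    using bij_slot_index[where 'k = 'k] s unfolding bij_betw_def inj_def by auto
  then have 1: "slots (Suc j) = insert s (slots j)"
    by (auto simp: slots_def less_Suc_eq)
  have 2: "s \<notin> slots j" using s by (simp add: slots_def)
  show ?thesis by (rule that[OF 2 1])
qed

lemma slots_0 [simp]: "slots 0 = {}"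
  by (simp add: slots_def)

lemma card_slots: "j \<le> CARD('k) \<Longrightarrow> card (slots j :: 'k::finite set) = j"
proof (induction j)
  case (Suc j)
  then obtain s :: 'k where "s \<notin> slots j" "slots (Suc j) = insert s (slots j)"
    using slots_Suc[of j, where 'k = 'k] by auto
  then show ?case using Suc by simp
qed simp

definition rational_subspaces :: "(real ^ 'k::finite) set set" where
  "rational_subspaces = {W. \<exists>B\<subseteq>Collect int_vec. W = span B}"

text \<open>
  An integral basis of the real space \<open>W\<close>: independence is forced by the number of slots.
\<close>

definition frame :: "(real ^ 'k::finite) set \<Rightarrow> ('k \<Rightarrow> real ^ 'k) \<Rightarrow> bool" where
  "frame W v \<longleftrightarrow> (\<forall>s\<in>slots (dim W). int_vec (v s)) \<and> span (v ` slots (dim W)) = W"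

lemma dim_le_CARD: "dim (W :: (real ^ 'k::finite) set) \<le> CARD('k)"
  using dim_subset_UNIV[of W] by simp

lemma frame_independent:
  assumes "frame W (v :: 'k::finite \<Rightarrow> real ^ 'k)"
  shows "independent (v ` slots (dim W))" "inj_on v (slots (dim W))"
proof -
  let ?S = "slots (dim W) :: 'k set"
  have cS: "card ?S = dim W" using card_slots dim_le_CARD by blast
  have sp: "span (v ` ?S) = W" using assms by (simp add: frame_def)
  have "dim W \<le> card (v ` ?S)"
    using sp by (metis dim_le_card' dim_span finite finite_imageI)
  moreover have "card (v ` ?S) \<le> card ?S" by (rule card_image_le) simp
  ultimately have c: "card (v ` ?S) = card ?S" using cS by simp
  then show "inj_on v ?S" by (simp add: eq_card_imp_inj_on)
  show "independent (v ` ?S)"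
  proof (rule card_le_dim_spanning)
    show "v ` ?S \<subseteq> W" using span_superset[of "v ` ?S"] sp by simp
  qed (use sp c cS in auto)
qed

lemma frame_exists:
  assumes "W \<in> rational_subspaces"
  shows "\<exists>v. frame W (v :: 'k::finite \<Rightarrow> real ^ 'k)"
proof -
  obtain B where B: "B \<subseteq> Collect int_vec" "W = span B" using assms by (auto simp: rational_subspaces_def)
  obtain B' where B': "B' \<subseteq> B" "independent B'" "B \<subseteq> span B'" by (rule maximal_independent_subset)
  have sp: "span B' = W"
    using span_mono[OF B'(1)] span_minimal[OF B'(3) subspace_span] unfolding B(2) by (rule subset_antisym)
  have fin: "finite B'" using B'(2) independent_imp_finite by blast
  have "card B' = dim W" using dim_span_eq_card_independent[OF B'(2)] sp by simp
  then have "card (slots (dim W) :: 'k set) = card B'" using card_slots[OF dim_le_CARD[of W]] by simp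
  from finite_same_card_bij[OF finite fin this]
  obtain v where v: "bij_betw v (slots (dim W) :: 'k set) B'" by (elim exE)
  have "v ` slots (dim W) = B'" using v by (rule bij_betw_imp_surj_on)
  then have "frame W v" using sp B' B(1) by (auto simp: frame_def)
  then show ?thesis by blast
qed

lemma frame_wedge_norm_pos:
  assumes "frame W v"
  shows "1 \<le> wedge_norm (\<lambda>x. x) (slots (dim W)) v"
proof -
  obtain c where c: "minor (\<lambda>x. x) (slots (dim W)) v c \<noteq> 0"
    using independent_minor_nonzero frame_independent[OF assms] by blast
  have "minor (\<lambda>x. x) (slots (dim W)) v c \<in> \<int>"
    using assms by (intro minor_Ints) (simp add: frame_def)
  from Ints_nonzero_abs_ge1[OF this c] show ?thesis using minor_le_wedge_norm order_trans by blast
qed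

text \<open>
  A frame with least wedge norm plays the role of a basis of the lattice of integer points of \<open>W\<close>.
\<close>

definition minimal_frame :: "(real ^ 'k::finite) set \<Rightarrow> 'k \<Rightarrow> real ^ 'k" where
  "minimal_frame W = (SOME v. frame W v \<and> (\<forall>v'. frame W v' \<longrightarrow>
     wedge_norm (\<lambda>x. x) (slots (dim W)) v \<le> wedge_norm (\<lambda>x. x) (slots (dim W)) v'))"

text \<open>
  The minimum exists because wedge norms of frames are natural numbers.
\<close>

lemma minimal_frame:
  assumes "W \<in> rational_subspaces"
  shows "frame W (minimal_frame W)"
    and "frame W v' \<Longrightarrow> wedge_norm (\<lambda>x. x) (slots (dim W)) (minimal_frame W) \<le> wedge_norm (\<lambda>x. x) (slots (dim W)) v'"
proof -
  let ?N = "wedge_norm (\<lambda>x. x) (slots (dim W))"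
  have int: "real (nat \<lfloor>?N v\<rfloor>) = ?N v" if v: "frame W v" for v
  proof -
    obtain c where "?N v = \<bar>minor (\<lambda>x. x) (slots (dim W)) v c\<bar>" by (rule wedge_norm_attained)
    moreover have "minor (\<lambda>x. x) (slots (dim W)) v c \<in> \<int>"
      using v by (intro minor_Ints) (simp add: frame_def)
    ultimately have "?N v \<in> \<int>" by simp
    then show ?thesis using wedge_norm_nonneg[of "\<lambda>x. x" "slots (dim W)" v] by (elim Ints_cases) auto
  qed
  obtain v0 where "frame W v0" using frame_exists[OF assms] by blast
  from ex_has_least_nat[of "frame W", OF this, of "\<lambda>v. nat \<lfloor>?N v\<rfloor>"]
  obtain v where v: "frame W v" "\<And>v'. frame W v' \<Longrightarrow> nat \<lfloor>?N v\<rfloor> \<le> nat \<lfloor>?N v'\<rfloor>" by blast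
  have "frame W v \<and> (\<forall>v'. frame W v' \<longrightarrow> ?N v \<le> ?N v')"
    using v int by (metis of_nat_le_iff)
  then have "frame W (minimal_frame W) \<and> (\<forall>v'. frame W v' \<longrightarrow> ?N (minimal_frame W) \<le> ?N v')"
    unfolding minimal_frame_def by (rule someI[where x = v])
  then show "frame W (minimal_frame W)" "frame W v' \<Longrightarrow> ?N (minimal_frame W) \<le> ?N v'" by auto
qed

definition covol :: "(real ^ 'k::finite \<Rightarrow> real ^ 'k) \<Rightarrow> (real ^ 'k) set \<Rightarrow> real" where
  "covol h W = wedge_norm h (slots (dim W)) (minimal_frame W)"

text \<open>
  Two frames of \<open>W\<close> have proportional minors.  The factor has modulus at least 1 when the
  reference is minimal for the identity, and the same factor governs every other linear map.
\<close>

lemma covol_le_frame: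
  assumes W: "W \<in> rational_subspaces" and v: "frame W v" and h: "linear h"
  shows "covol h W \<le> wedge_norm h (slots (dim W)) v"
proof -
  let ?S = "slots (dim W)"
  have "v s \<in> span (minimal_frame W ` ?S)" if "s \<in> ?S" for s
  proof -
    have "v s \<in> span (v ` ?S)" using that by (intro span_base) auto
    then show ?thesis using v minimal_frame(1)[OF W] by (simp add: frame_def)
  qed
  then obtain a where a: "\<And>h c. linear h \<Longrightarrow> minor h ?S v c = a * minor h ?S (minimal_frame W) c"
    using minor_change_basis[of ?S v "minimal_frame W"] by blast
  have sc: "wedge_norm h ?S v = \<bar>a\<bar> * wedge_norm h ?S (minimal_frame W)" if "linear h" for h
    using a[OF that] by (rule wedge_norm_scale)
  have "1 * wedge_norm (\<lambda>x. x) ?S (minimal_frame W) \<le> \<bar>a\<bar> * wedge_norm (\<lambda>x. x) ?S (minimal_frame W)"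
    using minimal_frame(2)[OF W v] sc[OF linear_ident] by simp
  then have "1 \<le> \<bar>a\<bar>"
    using frame_wedge_norm_pos[OF minimal_frame(1)[OF W]] by (simp add: mult_le_cancel_right)
  from mult_right_mono[OF this wedge_norm_nonneg[of h ?S "minimal_frame W"]]
  show ?thesis unfolding covol_def sc[OF h] by simp
qed

lemma covol_span_insert:
  assumes W: "W \<in> rational_subspaces" and w: "int_vec w" "w \<notin> W" and h: "linear h"
  shows "span (insert w W) \<in> rational_subspaces"
    and "covol h (span (insert w W)) \<le> (\<Sum>r\<in>UNIV. \<bar>h w $ r\<bar>) * covol h W"
proof -
  let ?W' = "span (insert w W)" and ?v = "minimal_frame W"
  have spW: "span W = W" using W by (auto simp: rational_subspaces_def span_span)
  have fr: "frame W ?v" by (rule minimal_frame(1)[OF W])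
  have dim': "dim ?W' = Suc (dim W)" using w(2) by (simp add: dim_insert spW del: span_eq_iff)
  then have "dim W < CARD('a)" using dim_le_CARD[of ?W'] by simp
  then obtain s :: 'a where s: "s \<notin> slots (dim W)" "slots (Suc (dim W)) = insert s (slots (dim W))"
    by (rule slots_Suc)
  have im: "?v(s := w) ` slots (dim ?W') = insert w (?v ` slots (dim W))"
    unfolding dim' s(2) using s(1) by auto
  have sp': "span (insert w (?v ` slots (dim W))) = ?W'"
  proof -
    have spv: "span (?v ` slots (dim W)) = W" using fr by (simp add: frame_def)
    show ?thesis unfolding span_insert[of w] spv spW ..
  qed
  have fr': "frame ?W' (?v(s := w))"
    unfolding frame_def
  proof (intro conjI ballI)
    fix t :: 'a assume "t \<in> slots (dim ?W')"
    then have "t = s \<or> t \<in> slots (dim W)" unfolding dim' s(2) by simp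
    then show "int_vec ((?v(s := w)) t)" using fr w(1) by (auto simp: frame_def)
  qed (simp only: im sp')
  then show W': "?W' \<in> rational_subspaces"
    unfolding rational_subspaces_def frame_def by (intro CollectI exI[of _ "?v(s := w) ` slots (dim ?W')"]) auto
  have "covol h ?W' \<le> wedge_norm h (slots (dim ?W')) (?v(s := w))"
    by (rule covol_le_frame[OF W' fr' h])
  also have "\<dots> \<le> (\<Sum>r\<in>UNIV. \<bar>h w $ r\<bar>) * wedge_norm h (slots (dim W)) ?v"
    unfolding dim' s(2) by (rule wedge_norm_insert[OF s(1)])
  finally show "covol h ?W' \<le> (\<Sum>r\<in>UNIV. \<bar>h w $ r\<bar>) * covol h W" by (simp add: covol_def)
qed

text \<open>
  Let \<open>W1\<close> be the largest member of the flag, or zero, that does not contain \<open>u\<close>.  The space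
  spanned by \<open>W1\<close> and \<open>u\<close> lies in every larger member, so it is compatible with the flag and
  has covolume at least \<open>a\<close>; but its covolume is at most that of \<open>W1\<close>, which is at most 1,
  times the length of \<open>h u\<close>.
\<close>

lemma marked_imp_no_short_vector:
  fixes h :: "real ^ 'k::finite \<Rightarrow> real ^ 'k"
  assumes h: "linear h"
    and marked: "marked (\<lambda>W y. covol h W) (\<lambda>W W'. W \<subseteq> W' \<or> W' \<subseteq> W) (rational_subspaces - {{0}}) a r y"
    and "a \<le> r" and u: "int_vec u" "u \<noteq> 0"
  shows "a \<le> (\<Sum>i\<in>UNIV. \<bar>h u $ i\<bar>)"
proof -
  obtain F where F: "F \<subseteq> rational_subspaces - {{0}}"
    and chain: "\<forall>W\<in>F. \<forall>W'\<in>F. W \<subseteq> W' \<or> W' \<subseteq> W"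
    and bounds: "\<forall>W\<in>F. a \<le> covol h W \<and> covol h W < 1"
    and others: "\<forall>W\<in>rational_subspaces - {{0}}. W \<notin> F \<longrightarrow> (\<forall>W'\<in>F. W \<subseteq> W' \<or> W' \<subseteq> W) \<longrightarrow> r \<le> covol h W"
    using marked unfolding marked_def by metis
  have zero: "{0} \<in> (rational_subspaces :: (real ^ 'k) set set)"
    unfolding rational_subspaces_def by (intro CollectI exI[of _ "{}"]) auto
  let ?G = "{W \<in> insert {0} F. u \<notin> W}"
  have "{0} \<in> ?G" using u(2) by simp
  moreover have "\<forall>W. W \<in> ?G \<longrightarrow> dim W < Suc CARD('k)" using dim_le_CARD le_imp_less_Suc by blast
  ultimately have "\<exists>W1. W1 \<in> ?G \<and> (\<forall>W. W \<in> ?G \<longrightarrow> dim W \<le> dim W1)"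
    by (rule ex_has_greatest_nat)
  then obtain W1 where W1: "W1 \<in> ?G" and W1_max: "\<And>W. W \<in> ?G \<Longrightarrow> dim W \<le> dim W1"
    by (elim exE conjE) blast
  have rat: "W \<in> rational_subspaces" if "W \<in> insert {0} F" for W using that F zero by auto
  have W1r: "W1 \<in> rational_subspaces" using W1 rat by blast
  have subsp: "subspace W" if "W \<in> rational_subspaces" for W :: "(real ^ 'k) set"
    using that by (auto simp: rational_subspaces_def)
  let ?W' = "span (insert u W1)"
  have uW1: "u \<notin> W1" using W1 by simp
  note W' = covol_span_insert[OF W1r u(1) uW1 h]
  have "\<forall>W\<in>F. ?W' \<subseteq> W \<or> W \<subseteq> ?W'"
  proof
    fix W assume W: "W \<in> F"
    have comp: "W \<subseteq> W1 \<or> W1 \<subseteq> W"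
    proof (cases "W1 = {0}")
      case True
      then show ?thesis using subspace_0[OF subsp[OF rat[of W]]] W by auto
    next
      case False
      then show ?thesis using chain W W1 by auto
    qed
    show "?W' \<subseteq> W \<or> W \<subseteq> ?W'"
    proof (cases "u \<in> W")
      case True
      then have "W1 \<subseteq> W" using comp uW1 by auto
      then have "?W' \<subseteq> W" using True subsp[OF rat[of W]] W by (intro span_minimal) auto
      then show ?thesis by blast
    next
      case False
      then have "dim W \<le> dim W1" using W1_max[of W] W by simp
      then have "W \<subseteq> W1"
        using comp subspace_dim_equal[OF subsp[OF W1r] subsp[OF rat[of W]]] W by auto
      then show ?thesis using span_superset[of "insert u W1"] by auto
    qed
  qed
  moreover have "?W' \<noteq> {0}" using span_base[of u "insert u W1"] u(2) by auto
  ultimately have "a \<le> covol h ?W'"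
    using bounds others[rule_format, of ?W'] W'(1) \<open>a \<le> r\<close> by (cases "?W' \<in> F") auto
  also have "\<dots> \<le> (\<Sum>i\<in>UNIV. \<bar>h u $ i\<bar>) * covol h W1" by (rule W'(2))
  also have "\<dots> \<le> (\<Sum>i\<in>UNIV. \<bar>h u $ i\<bar>) * 1"
  proof (rule mult_left_mono)
    show "covol h W1 \<le> 1"
      using W1 bounds wedge_norm_empty[of h] by (auto simp: covol_def)
  qed (simp add: sum_nonneg)
  finally show ?thesis by simp
qed

section \<open>The flow and its minors\<close>

text \<open>
  The diagonal flow with exponents \<open>(T, -t\<^sub>1, \<dots>, -t\<^sub>n)\<close>, \<open>T = \<Sum>t\<^sub>i\<close>, composed with the unipotent map
  \<open>(p, q) \<mapsto> (p + q \<bullet> y, q)\<close>; the index \<open>None\<close> is that of the coordinate \<open>p\<close>.  Integer exponents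
  suffice, since rounding costs bounded factors only.
\<close>

definition flow :: "('n::finite \<Rightarrow> nat) \<Rightarrow> real ^ 'n \<Rightarrow> real ^ ('n option) \<Rightarrow> real ^ ('n option)" where
  "flow t y v = (\<chi> r. case r of
     None \<Rightarrow> 2 ^ (\<Sum>i\<in>UNIV. t i) * (v $ None + (\<Sum>i\<in>UNIV. y $ i * v $ Some i))
   | Some i \<Rightarrow> v $ Some i / 2 ^ t i)"

lemma flow_None: "flow t y v $ None = 2 ^ (\<Sum>i\<in>UNIV. t i) * (v $ None + (\<Sum>i\<in>UNIV. y $ i * v $ Some i))"
  and flow_Some: "flow t y v $ Some i = v $ Some i / 2 ^ t i"
  by (simp_all add: flow_def)

lemma linear_flow: "linear (flow t y)"
proof (rule linearI)
  show "flow t y (v + w) = flow t y v + flow t y w" for v w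
    unfolding vec_eq_iff
  proof
    fix r show "flow t y (v + w) $ r = (flow t y v + flow t y w) $ r"
      by (cases r) (simp_all add: flow_None flow_Some sum.distrib algebra_simps add_divide_distrib)
  qed
  show "flow t y (a *\<^sub>R v) = a *\<^sub>R flow t y v" for a v
    unfolding vec_eq_iff
  proof
    fix r show "flow t y (a *\<^sub>R v) $ r = (a *\<^sub>R flow t y v) $ r"
      by (cases r) (simp_all add: flow_None flow_Some sum_distrib_left algebra_simps)
  qed
qed

lemma sum_UNIV_option: "(\<Sum>r\<in>UNIV. g r) = g None + (\<Sum>i\<in>UNIV. g (Some i))" for g :: "'n::finite option \<Rightarrow> 'a::comm_monoid_add"
  by (simp add: UNIV_option_conv sum.reindex)

lemma prod_UNIV_option: "(\<Prod>r\<in>UNIV. g r) = g None * (\<Prod>i\<in>UNIV. g (Some i))" for g :: "'n::finite option \<Rightarrow> 'a::comm_monoid_mult"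
  by (simp add: UNIV_option_conv prod.reindex)

text \<open>
  Only the column of the index \<open>None\<close> depends on \<open>y\<close>, and it does so affinely.
\<close>

lemma minor_flow_affine:
  fixes v :: "'n::finite option \<Rightarrow> real ^ ('n option)"
  shows "\<exists>c0 a. \<forall>y. minor (flow t y) J v c = c0 + a \<bullet> y"
proof -
  let ?T = "\<Sum>i\<in>UNIV. t i"
  define B :: "'n option \<Rightarrow> real ^ ('n option)" where
    "B q = (\<chi> s. if s \<in> J then 2 ^ ?T * v s $ q else if q = None then axis (c s) 1 $ None else 0)" for q
  define C :: "'n option \<Rightarrow> real ^ ('n option)" where
    "C r = (\<chi> s. if s \<in> J then v s $ r / 2 ^ t (the r) else axis (c s) 1 $ r)" for r
  define E where "E q = det (\<chi> r. if r = None then B q else C r)" for q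
  have "minor (flow t y) J v c = E None + (\<chi> i. E (Some i)) \<bullet> y" for y
  proof -
    define w where "w q = (case q of None \<Rightarrow> 1 | Some i \<Rightarrow> y $ i)" for q
    have tr: "transpose (\<chi> s. if s \<in> J then flow t y (v s) else axis (c s) 1) =
        (\<chi> r. if r = None then (\<Sum>q\<in>UNIV. w q *s B q) else C r)"
      unfolding vec_eq_iff
    proof (intro allI)
      fix r s
      show "transpose (\<chi> s. if s \<in> J then flow t y (v s) else axis (c s) 1) $ r $ s =
          (\<chi> r. if r = None then (\<Sum>q\<in>UNIV. w q *s B q) else C r) $ r $ s"
      proof (cases r)
        case None
        have "(\<Sum>q\<in>UNIV. w q *s B q) $ s = B None $ s + (\<Sum>i\<in>UNIV. y $ i * B (Some i) $ s)"
          by (simp add: sum_UNIV_option w_def)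
        also have "\<dots> = (if s \<in> J then flow t y (v s) $ None else axis (c s) 1 $ None)"
          by (simp add: B_def flow_None distrib_left sum_distrib_left mult.left_commute)
        finally show ?thesis using None by (simp add: transpose_def)
      next
        case (Some i)
        then show ?thesis by (simp add: transpose_def flow_Some C_def)
      qed
    qed
    have "minor (flow t y) J v c = det (\<chi> r. if r = None then (\<Sum>q\<in>UNIV. w q *s B q) else C r)"
      unfolding minor_def by (subst det_transpose[symmetric]) (simp only: tr)
    also have "\<dots> = (\<Sum>q\<in>UNIV. w q * E q)"
      unfolding E_def by (simp only: det_linear_row_sum[OF finite] det_row_mul)
    also have "\<dots> = E None + (\<chi> i. E (Some i)) \<bullet> y"
      by (simp add: sum_UNIV_option w_def inner_vec_def mult.commute)
    finally show ?thesis .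
  qed
  then show ?thesis by blast
qed

text \<open>
  A unipotent row operation does not change the determinant of the diagonal matrix, whose entries have
  product \<open>2\<^sup>T / 2\<^sup>T\<close>.
\<close>

lemma det_matrix_flow: "det (matrix (flow t y)) = 1"
proof -
  let ?T = "\<Sum>i\<in>UNIV. t i"
  define d :: "'a option \<Rightarrow> real" where "d r = (case r of None \<Rightarrow> 2 ^ ?T | Some i \<Rightarrow> 1 / 2 ^ t i)" for r
  define A :: "real ^ ('a option) ^ ('a option)" where "A = (\<chi> r. d r *s axis r 1)"
  define x :: "real ^ ('a option)" where "x = (\<Sum>i\<in>UNIV. (2 ^ ?T * y $ i) *s axis (Some i) 1)"
  have rowA: "row r A = d r *s axis r 1" for r by (simp add: row_def A_def vec_eq_iff)
  have "matrix (flow t y) = (\<chi> k. if k = None then row None A + x else row k A)"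
    unfolding vec_eq_iff
  proof (intro allI)
    fix r s
    show "matrix (flow t y) $ r $ s = (\<chi> k. if k = None then row None A + x else row k A) $ r $ s"
    proof (cases r; cases s)
      fix l assume rs: "r = None" "s = Some l"
      have "(\<Sum>i\<in>UNIV. y $ i * axis (Some l) 1 $ Some i) = (\<Sum>i\<in>UNIV. if l = i then y $ i else 0)"
        by (rule sum.cong) (auto simp: axis_def)
      moreover have "(\<Sum>i\<in>UNIV. 2 ^ ?T * y $ i * axis (Some i) 1 $ Some l) = (\<Sum>i\<in>UNIV. if l = i then 2 ^ ?T * y $ i else 0)"
        by (rule sum.cong) (auto simp: axis_def)
      ultimately show ?thesis
        using rs by (simp add: matrix_def flow_None rowA d_def x_def axis_def)
    qed (auto simp: matrix_def flow_None flow_Some rowA d_def x_def axis_def)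
  qed
  moreover have "x \<in> vec.span {row j A |j. j \<noteq> None}"
    unfolding x_def
  proof (intro vec.span_sum vec.span_scale)
    fix i :: 'a
    have "row (Some i) A \<in> vec.span {row j A |j. j \<noteq> None}" by (rule vec.span_base) auto
    from vec.span_scale[OF this, of "2 ^ t i"]
    show "axis (Some i) 1 \<in> vec.span {row j A |j. j \<noteq> None}" by (simp add: rowA d_def)
  qed
  ultimately have "det (matrix (flow t y)) = det A" by (simp add: det_row_span)
  also have "det A = (\<Prod>r\<in>UNIV. A $ r $ r)" by (rule det_diagonal) (auto simp: A_def axis_def)
  also have "\<dots> = 2 ^ ?T * (\<Prod>i\<in>UNIV. 1 / 2 ^ t i)" by (simp add: A_def prod_UNIV_option d_def axis_def)
  also have "\<dots> = 1" by (simp add: power_sum prod_dividef)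
  finally show ?thesis .
qed

lemma det_rows_linear:
  fixes X :: "'k::finite \<Rightarrow> real ^ 'k"
  assumes "linear h"
  shows "det (\<chi> s. h (X s)) = det (matrix h) * det (\<chi> s. X s)"
proof -
  have "(\<chi> s. h (X s)) = (\<chi> s. X s) ** transpose (matrix h)"
    unfolding vec_eq_iff
  proof (intro allI)
    fix s r
    have "h (X s) $ r = (matrix h *v X s) $ r" by (simp only: matrix_vector_mul(2)[OF assms, THEN fun_cong])
    then show "(\<chi> s. h (X s)) $ s $ r = ((\<chi> s. X s) ** transpose (matrix h)) $ s $ r"
      by (simp add: matrix_vector_mult_def matrix_matrix_mult_def transpose_def mult.commute)
  qed
  then show ?thesis by (simp add: det_mul mult.commute)
qed

text \<open>
  The standard basis vector of \<open>Some i\<close> is \<open>2\<^bsup>t i\<^esup>\<close> times the image under the flow of that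
  vector minus \<open>y\<^sub>i\<close> times the one of \<open>None\<close>.  Hence the whole matrix is an image under the flow, which has
  determinant 1.  The factor that comes out is at least 1.
\<close>

lemma minor_flow_eq:
  fixes v :: "'n::finite option \<Rightarrow> real ^ ('n option)"
  assumes c: "\<And>s. s \<notin> J \<Longrightarrow> c s \<noteq> None"
  shows "minor (flow t y) J v c = (\<Prod>s\<in>UNIV. if s \<in> J then 1 else 2 ^ t (the (c s))) *
    det (\<chi> s. if s \<in> J then v s else axis (c s) 1 - y $ the (c s) *s axis None 1)"
proof -
  define k :: "'n option \<Rightarrow> real" where "k s = (if s \<in> J then 1 else 2 ^ t (the (c s)))" for s
  define Z where "Z s = (if s \<in> J then v s else axis (c s) 1 - y $ the (c s) *s axis None 1)" for s
  have "(if s \<in> J then flow t y (v s) else axis (c s) 1) = flow t y (k s *s Z s)" for s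
  proof (cases "s \<in> J")
    case False
    obtain i where i: "c s = Some i" using c[OF False] by auto
    have "flow t y (k s *s Z s) $ r = axis (c s) 1 $ r" for r
    proof (cases r)
      case None
      have "(\<Sum>l\<in>UNIV. y $ l * (k s *s Z s) $ Some l) = (\<Sum>l\<in>UNIV. if i = l then y $ l * k s else 0)"
        using False i by (intro sum.cong) (auto simp: Z_def axis_def)
      then show ?thesis using None False i by (simp add: flow_None Z_def axis_def)
    next
      case (Some l)
      then show ?thesis using False i by (simp add: flow_Some Z_def k_def axis_def)
    qed
    then show ?thesis using False by (simp add: vec_eq_iff)
  qed (simp add: k_def Z_def)
  then have "minor (flow t y) J v c = det (\<chi> s. flow t y (k s *s Z s))" unfolding minor_def by presburger
  also have "\<dots> = det (\<chi> s. k s *s Z s)"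
    by (simp only: det_rows_linear[OF linear_flow] det_matrix_flow mult_1)
  also have "\<dots> = (\<Prod>s\<in>UNIV. k s) * det (\<chi> s. Z s)" by (rule det_rows_mul)
  finally show ?thesis unfolding k_def Z_def .
qed

text \<open>
  Some minor of the integral frame itself is a nonzero integer.  If it can be chosen without the index
  \<open>None\<close> in the completion, it survives in the constant term.  Otherwise \<open>None\<close> is
  exchanged for an index \<open>i\<close> missing from the completion; the constant term then vanishes and
  the integer minor reappears in the coefficient of \<open>y\<^sub>i\<close>.
\<close>

lemma frame_has_large_minor:
  fixes v :: "'n::finite option \<Rightarrow> real ^ ('n option)"
  assumes fr: "frame W v" and W: "W \<noteq> {0}"
  shows "\<exists>c c0 a. (\<forall>y. minor (flow t y) (slots (dim W)) v c = c0 + a \<bullet> y) \<and> (1 \<le> \<bar>c0\<bar> \<or> 1 \<le> norm a)"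
proof -
  let ?J = "slots (dim W) :: 'n option set"
  let ?m = "minor (\<lambda>x. x) ?J v"
  have int: "?m c \<in> \<int>" for c using fr by (intro minor_Ints) (simp add: frame_def)
  have prod_ge: "1 \<le> (\<Prod>s\<in>(UNIV :: 'n option set). if s \<in> ?J then 1 else (2 :: real) ^ t (the (c s)))" for c
    by (intro prod_ge_1) auto
  obtain c where c: "?m c \<noteq> 0"
    using independent_minor_nonzero frame_independent[OF fr] by blast
  have at0: "\<bar>?m c\<bar> \<le> \<bar>minor (flow t 0) ?J v c\<bar>" if "\<And>s. s \<notin> ?J \<Longrightarrow> c s \<noteq> None" for c
  proof -
    have "minor (flow t 0) ?J v c = (\<Prod>s\<in>UNIV. if s \<in> ?J then 1 else 2 ^ t (the (c s))) * ?m c"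
      by (subst minor_flow_eq[OF that]) (simp_all add: minor_def cong: if_cong)
    then show ?thesis
      using mult_right_mono[OF prod_ge[of c], of "\<bar>?m c\<bar>"] by (simp add: abs_mult abs_prod if_distrib cong: if_cong)
  qed
  show ?thesis
  proof (cases "\<exists>c. (\<forall>s. s \<notin> ?J \<longrightarrow> c s \<noteq> None) \<and> ?m c \<noteq> 0")
    case True
    then obtain c where c: "\<And>s. s \<notin> ?J \<Longrightarrow> c s \<noteq> None" "?m c \<noteq> 0" by blast
    obtain c0 a where ca: "\<And>y. minor (flow t y) ?J v c = c0 + a \<bullet> y" using minor_flow_affine by metis
    have "1 \<le> \<bar>?m c\<bar>" by (rule Ints_nonzero_abs_ge1[OF int c(2)])
    also have "\<dots> \<le> \<bar>minor (flow t 0) ?J v c\<bar>" by (rule at0) (rule c(1))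
    finally have "1 \<le> \<bar>c0\<bar>" using ca[of 0] by simp
    then show ?thesis using ca by blast
  next
    case False
    then obtain s0 where s0: "s0 \<notin> ?J" "c s0 = None" using c by blast
    have inj: "inj_on c (- ?J)"
    proof (rule inj_onI, rule ccontr)
      fix s s' assume "s \<in> - ?J" "s' \<in> - ?J" "c s = c s'" "s \<noteq> s'"
      then have "?m c = 0"
        unfolding minor_def
        by (intro det_eq_0_if_rows_eq[of s s' "\<lambda>s. if s \<in> ?J then v s else axis (c s) 1"]) auto
      then show False using c by simp
    qed
    have "?J \<noteq> {}"
    proof
      assume "?J = {}"
      then have "span {} = W" using fr unfolding frame_def by simp
      then show False using W by simp
    qed
    then have "- ?J \<noteq> UNIV" by blast
    then have "card (- ?J) < CARD('n option)" by (metis finite psubset_card_mono top.not_eq_extremum)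
    then have "card (c ` (- ?J)) < CARD('n option)" using card_image[OF inj] by simp
    then have "c ` (- ?J) \<noteq> UNIV" by force
    then obtain r where r: "r \<notin> c ` (- ?J)" by blast
    with s0 obtain i where i: "r = Some i" by (cases r) force+
    define c' where "c' = c(s0 := Some i)"
    have c'_Some: "c' s \<noteq> None" if "s \<notin> ?J" for s
      using inj_onD[OF inj, of s s0] s0 that by (auto simp: c'_def)
    have c'_i: "the (c' s) \<noteq> i" if "s \<notin> ?J" "s \<noteq> s0" for s
    proof
      assume "the (c' s) = i"
      then have "c s = r" using c'_Some[OF that(1)] that(2) i by (auto simp: c'_def)
      then show False using r that(1) by blast
    qed
    obtain c0 a where ca: "\<And>y. minor (flow t y) ?J v c' = c0 + a \<bullet> y" using minor_flow_affine by metis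
    have m0: "?m c' = 0" using False c'_Some by blast
    have "c0 = 0"
    proof -
      have "minor (flow t 0) ?J v c' = (\<Prod>s\<in>UNIV. if s \<in> ?J then 1 else 2 ^ t (the (c' s))) * ?m c'"
        by (subst minor_flow_eq[OF c'_Some]) (simp_all add: minor_def cong: if_cong)
      then show ?thesis using ca[of 0] m0 by simp
    qed
    let ?g = "\<lambda>s. if s \<in> ?J then v s else axis (c s) 1"
    have "det (\<chi> s. if s \<in> ?J then v s else axis (c' s) 1 - axis i 1 $ the (c' s) *s axis None 1)
        = det (\<chi> s. if s = s0 then axis (Some i) 1 + (- 1) *s axis None 1 else ?g s)"
      using s0 c'_i by (intro arg_cong[where f = det]) (auto simp: vec_eq_iff c'_def axis_def)
    also have "\<dots> = det (\<chi> s. if s = s0 then axis (Some i) 1 else ?g s) - det (\<chi> s. if s = s0 then axis None 1 else ?g s)"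
      by (simp only: det_row_add det_row_mul)
    also have "det (\<chi> s. if s = s0 then axis (Some i) 1 else ?g s) = ?m c'"
      unfolding minor_def using s0 by (intro arg_cong[where f = det]) (auto simp: vec_eq_iff c'_def)
    also have "det (\<chi> s. if s = s0 then axis None 1 else ?g s) = ?m c"
      unfolding minor_def using s0 by (intro arg_cong[where f = det]) (auto simp: vec_eq_iff)
    finally have D: "det (\<chi> s. if s \<in> ?J then v s else axis (c' s) 1 - axis i 1 $ the (c' s) *s axis None 1) = - ?m c"
      using m0 by simp
    have "a \<bullet> axis i 1 = (\<Prod>s\<in>UNIV. if s \<in> ?J then 1 else 2 ^ t (the (c' s))) * (- ?m c)"
      using ca[of "axis i 1"] \<open>c0 = 0\<close> minor_flow_eq[OF c'_Some, where y = "axis i 1" and t = t and v = v] D by simp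
    moreover have "1 \<le> \<bar>?m c\<bar>" by (rule Ints_nonzero_abs_ge1[OF int c])
    ultimately have "1 \<le> \<bar>a \<bullet> axis i 1\<bar>"
      using mult_mono[OF prod_ge[of c'] \<open>1 \<le> \<bar>?m c\<bar>\<close> order_trans[OF zero_le_one prod_ge[of c']] zero_le_one]
      by (simp add: abs_mult abs_prod if_distrib cong: if_cong)
    also have "\<dots> \<le> norm a" using component_le_norm_cart[of a i] by (simp add: inner_axis)
    finally show ?thesis using ca by blast
  qed
qed

section \<open>Short vectors are rare\<close>

lemma continuous_on_Max_finite:
  fixes G :: "'c \<Rightarrow> 'a::topological_space \<Rightarrow> real"
  assumes "finite A" "A \<noteq> {}" "\<And>c. c \<in> A \<Longrightarrow> continuous_on S (G c)"
  shows "continuous_on S (\<lambda>x. Max ((\<lambda>c. G c x) ` A))"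
  using assms
proof (induction rule: finite_ne_induct)
  case (insert a A)
  then have "continuous_on S (\<lambda>x. max (G a x) (Max ((\<lambda>c. G c x) ` A)))"
    by (intro continuous_on_max) auto
  then show ?case using insert.hyps by simp
qed simp

lemma covol_flow_conv:
  fixes W :: "(real ^ ('n::finite option)) set"
  assumes "W \<in> rational_subspaces"
  obtains c0 :: "('n option \<Rightarrow> 'n option) \<Rightarrow> real" and a :: "('n option \<Rightarrow> 'n option) \<Rightarrow> real ^ 'n" where "\<And>y. covol (flow t y) W = Max (range (\<lambda>c. \<bar>c0 c + a c \<bullet> y\<bar>))"
    and "W \<noteq> {0} \<Longrightarrow> \<exists>c. 1 \<le> \<bar>c0 c\<bar> \<or> 1 \<le> norm (a c)"
proof -
  let ?m = "\<lambda>y. minor (flow t y) (slots (dim W)) (minimal_frame W)"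
  have "\<forall>c. \<exists>c0 a. \<forall>y. ?m y c = c0 + a \<bullet> y"
    using minor_flow_affine by blast
  then obtain c0 a where ca: "\<And>c y. ?m y c = c0 c + a c \<bullet> y" by metis
  show ?thesis
  proof
    show "covol (flow t y) W = Max (range (\<lambda>c. \<bar>c0 c + a c \<bullet> y\<bar>))" for y
      unfolding covol_def wedge_norm_def ca ..
    assume "W \<noteq> {0}"
    from frame_has_large_minor[OF minimal_frame(1)[OF assms] this, of t]
    obtain c c0' a' where c: "\<And>y. ?m y c = c0' + a' \<bullet> y" "1 \<le> \<bar>c0'\<bar> \<or> 1 \<le> norm a'" by blast
    have "c0 c = c0'" using ca[of 0 c] c(1)[of 0] by simp
    moreover have "a c = a'"
    proof (rule vector_eq_ldot[THEN iffD1], intro allI)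
      fix y show "y \<bullet> a c = y \<bullet> a'"
        using ca[of y c] c(1)[of y] \<open>c0 c = c0'\<close> by (simp add: inner_commute)
    qed
    ultimately show "\<exists>c. 1 \<le> \<bar>c0 c\<bar> \<or> 1 \<le> norm (a c)" using c(2) by blast
  qed
qed

text \<open>
  For both properties only the function that attains the maximum at the reference point matters.
\<close>

lemma Max_doubling:
  fixes G :: "'c::finite \<Rightarrow> real ^ 'd::finite \<Rightarrow> real"
  assumes "\<And>c. doubling j0 x0 \<kappa> (G c)"
  shows "doubling j0 x0 \<kappa> (\<lambda>x. Max (range (\<lambda>c. \<bar>G c x\<bar>)))"
  unfolding doubling_def
proof (intro allI impI ballI)
  fix j x y assume *: "j0 \<le> j" "x \<in> cell j0 x0" "y \<in> cell j x"
  have "Max (range (\<lambda>c. \<bar>G c y\<bar>)) \<in> range (\<lambda>c. \<bar>G c y\<bar>)" by (intro Max_in) auto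
  then obtain c where c: "Max (range (\<lambda>c. \<bar>G c y\<bar>)) = \<bar>G c y\<bar>" by (elim imageE) blast
  obtain y' where y': "y' \<in> cell (Suc j) x" "\<kappa> * \<bar>G c y\<bar> \<le> \<bar>G c y'\<bar>"
    using assms[of c] * unfolding doubling_def by blast
  have "\<bar>G c y'\<bar> \<le> Max (range (\<lambda>c. \<bar>G c y'\<bar>))" by (intro Max_ge) auto
  from order_trans[OF y'(2) order_trans[OF this abs_ge_self]] y'(1)
  show "\<exists>y'\<in>cell (Suc j) x. \<kappa> * \<bar>Max (range (\<lambda>c. \<bar>G c y\<bar>))\<bar> \<le> \<bar>Max (range (\<lambda>c. \<bar>G c y'\<bar>))\<bar>"
    unfolding c abs_abs by (rule bexI)
qed

lemma Max_good:
  fixes G :: "'c::finite \<Rightarrow> real ^ 'd::finite \<Rightarrow> real"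
  assumes "\<And>c. good j0 x0 \<mu> \<theta> (G c)"
  shows "good j0 x0 \<mu> \<theta> (\<lambda>x. Max (range (\<lambda>c. \<bar>G c x\<bar>)))"
  unfolding good_def sublevel_small_def
proof (intro allI impI ballI)
  fix i j x y assume *: "j0 \<le> j" "x \<in> cell j0 x0" "y \<in> cell j x"
  have "Max (range (\<lambda>c. \<bar>G c y\<bar>)) \<in> range (\<lambda>c. \<bar>G c y\<bar>)" by (intro Max_in) auto
  then obtain c where c: "Max (range (\<lambda>c. \<bar>G c y\<bar>)) = \<bar>G c y\<bar>" by (elim imageE) blast
  have "outer_le {x' \<in> cell j x. \<bar>G c x'\<bar> < \<mu> ^ i * \<bar>G c y\<bar>} (\<theta> ^ i * emeasure lborel (cell j x))"
    using assms[of c] * unfolding good_def sublevel_small_def by blast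
  moreover have "{x' \<in> cell j x. \<bar>Max (range (\<lambda>c. \<bar>G c x'\<bar>))\<bar> < \<mu> ^ i * \<bar>Max (range (\<lambda>c. \<bar>G c y\<bar>))\<bar>}
      \<subseteq> {x' \<in> cell j x. \<bar>G c x'\<bar> < \<mu> ^ i * \<bar>G c y\<bar>}"
  proof clarify
    fix x' assume "\<bar>Max (range (\<lambda>c. \<bar>G c x'\<bar>))\<bar> < \<mu> ^ i * \<bar>Max (range (\<lambda>c. \<bar>G c y\<bar>))\<bar>"
    moreover have "\<bar>G c x'\<bar> \<le> Max (range (\<lambda>c. \<bar>G c x'\<bar>))" by (intro Max_ge) auto
    ultimately show "\<bar>G c x'\<bar> < \<mu> ^ i * \<bar>G c y\<bar>" unfolding c by simp
  qed
  ultimately show "outer_le {x' \<in> cell j x. \<bar>Max (range (\<lambda>c. \<bar>G c x'\<bar>))\<bar> < \<mu> ^ i * \<bar>Max (range (\<lambda>c. \<bar>G c y\<bar>))\<bar>}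
      (\<theta> ^ i * emeasure lborel (cell j x))"
    by (rule outer_le_mono) simp
qed

text \<open>
  Nondivergence for the poset of nonzero rational subspaces ordered by inclusion and
  ranked by dimension.
\<close>

theorem short_vectors_small:
  fixes f :: "real ^ 'd::finite \<Rightarrow> real ^ 'n::finite"
  assumes tame: "tame f j0 x0 \<kappa> \<mu> \<theta> \<rho>"
    and \<kappa>: "0 < \<kappa>" "\<kappa> \<le> 1" and \<mu>: "0 < \<mu>" "\<mu> \<le> 1" and \<rho>: "0 < \<rho>" "\<rho> \<le> 1"
  shows "outer_le {x \<in> cell j0 x0. \<exists>u. int_vec u \<and> u \<noteq> 0 \<and>
             (\<Sum>r\<in>UNIV. \<bar>flow t (f x) u $ r\<bar>) < \<mu> ^ i * (\<kappa> ^ CARD('n option) * \<rho>)}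
           (of_nat CARD('n option) * \<theta> ^ i * emeasure lborel (cell j0 x0))"
proof -
  let ?K = "CARD('n option)"
  let ?r0 = "\<kappa> ^ ?K * \<rho>"
  let ?S = "rational_subspaces - {{0}} :: (real ^ ('n option)) set set"
  let ?\<psi> = "\<lambda>W x. covol (flow t (f x)) W"
  let ?cmp = "\<lambda>W W' :: (real ^ ('n option)) set. W \<subseteq> W' \<or> W' \<subseteq> W"
  have props: "continuous_on (cell j0 x0) (?\<psi> W) \<and> doubling j0 x0 \<kappa> (?\<psi> W) \<and> good j0 x0 \<mu> \<theta> (?\<psi> W) \<and>
      (\<exists>x\<in>cell j0 x0. \<rho> \<le> ?\<psi> W x)" if W: "W \<in> ?S" for W
  proof -
    obtain c0 :: "('n option \<Rightarrow> 'n option) \<Rightarrow> real" and a where cv: "\<And>y. covol (flow t y) W = Max (range (\<lambda>c. \<bar>c0 c + a c \<bullet> y\<bar>))"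
      and big: "W \<noteq> {0} \<Longrightarrow> \<exists>c. 1 \<le> \<bar>c0 c\<bar> \<or> 1 \<le> norm (a c)"
      by (rule covol_flow_conv[OF DiffD1[OF W], of t], rule that)
    obtain c where "1 \<le> \<bar>c0 c\<bar> \<or> 1 \<le> norm (a c)" using big W by auto
    then obtain x where x: "x \<in> cell j0 x0" "\<rho> \<le> \<bar>c0 c + a c \<bullet> f x\<bar>"
      using tame unfolding tame_def by blast
    have "\<bar>c0 c + a c \<bullet> f x\<bar> \<le> Max (range (\<lambda>c. \<bar>c0 c + a c \<bullet> f x\<bar>))" by (intro Max_ge) auto
    from order_trans[OF x(2) this] x(1) have "\<exists>x\<in>cell j0 x0. \<rho> \<le> ?\<psi> W x"
      unfolding cv by (rule bexI)
    moreover have "continuous_on (cell j0 x0) (?\<psi> W)"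
      unfolding cv using tame by (intro continuous_on_Max_finite continuous_intros) (auto simp: tame_def)
    moreover have "doubling j0 x0 \<kappa> (?\<psi> W)"
      unfolding cv using tame by (intro Max_doubling) (auto simp: tame_def)
    moreover have "good j0 x0 \<mu> \<theta> (?\<psi> W)"
      unfolding cv using tame by (intro Max_good) (auto simp: tame_def)
    ultimately show ?thesis by blast
  qed
  have dims: "dim ` ?S \<subseteq> {1..?K}"
  proof (rule image_subsetI)
    fix W :: "(real ^ ('n option)) set" assume "W \<in> ?S"
    then have W: "W \<in> rational_subspaces" "W \<noteq> {0}" by auto
    have "subspace W" using W(1) by (auto simp: rational_subspaces_def)
    then have "dim W \<noteq> 0" using W(2) subspace_0 by (metis dim_eq_0 subset_singleton_iff empty_iff)
    then have "1 \<le> dim W" by arith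
    then show "dim W \<in> {1..?K}" using dim_le_CARD[of W] by simp
  qed
  have r0: "0 < ?r0" using \<kappa> \<rho> by simp
  have "outer_le {y \<in> cell j0 x0. \<not> marked ?\<psi> ?cmp ?S (\<mu> ^ i * ?r0) ?r0 y}
      (of_nat ?K * \<theta> ^ i * emeasure lborel (cell j0 x0))"
  proof (rule nondivergence[where S = ?S and rk = dim and \<rho> = \<rho> and \<kappa> = \<kappa>])
    show "dim W \<noteq> dim W'" if "W \<in> ?S" "W' \<in> ?S" "?cmp W W'" "W \<noteq> W'" for W W'
    proof
      assume d: "dim W = dim W'"
      have s: "subspace W" "subspace W'" using that by (auto simp: rational_subspaces_def)
      show False
        using that(3,4) subspace_dim_equal[OF s] subspace_dim_equal[OF s(2,1)] d by auto
    qed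
    show "finite (dim ` ?S)" using dims finite_subset by blast
    show "card (dim ` ?S) \<le> ?K" using card_mono[OF _ dims] by simp
    show "0 \<le> ?\<psi> W x" for W x by (simp add: covol_def wedge_norm_nonneg)
    show "\<exists>y\<in>cell j0 x0. \<rho> \<le> ?\<psi> W y" if "W \<in> ?S" for W using props[OF that] by blast
  qed (use props \<kappa> \<mu> r0 \<rho> in auto)
  moreover have "{x \<in> cell j0 x0. \<exists>u. int_vec u \<and> u \<noteq> 0 \<and> (\<Sum>r\<in>UNIV. \<bar>flow t (f x) u $ r\<bar>) < \<mu> ^ i * ?r0}
      \<subseteq> {y \<in> cell j0 x0. \<not> marked ?\<psi> ?cmp ?S (\<mu> ^ i * ?r0) ?r0 y}"
  proof clarify
    fix x u
    assume u: "int_vec u" "u \<noteq> 0" and lt: "(\<Sum>r\<in>UNIV. \<bar>flow t (f x) u $ r\<bar>) < \<mu> ^ i * ?r0"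
      and m: "marked ?\<psi> ?cmp ?S (\<mu> ^ i * ?r0) ?r0 x"
    have "marked (\<lambda>W y. covol (flow t (f x)) W) ?cmp ?S (\<mu> ^ i * ?r0) ?r0 x"
      using m unfolding marked_def .
    moreover have "\<mu> ^ i * ?r0 \<le> ?r0"
      using \<mu> r0 by (intro mult_left_le_one_le) (auto intro: power_le_one)
    ultimately have "\<mu> ^ i * ?r0 \<le> (\<Sum>r\<in>UNIV. \<bar>flow t (f x) u $ r\<bar>)"
      using u by (intro marked_imp_no_short_vector[OF linear_flow])
    then show False using lt by simp
  qed
  ultimately show ?thesis by (rule outer_le_mono) simp
qed

lemma outer_le_UN_finite:
  assumes "finite I" "\<And>i. i \<in> I \<Longrightarrow> outer_le (E i) c"
  shows "outer_le (\<Union>i\<in>I. E i) (of_nat (card I) * c)"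
  using assms
proof (induction rule: finite_induct)
  case empty
  then show ?case by (auto simp: outer_le_def)
next
  case (insert i I)
  have "outer_le (E i \<union> (\<Union>i\<in>I. E i)) (c + of_nat (card I) * c)"
    using insert by (intro outer_le_Un) auto
  then show ?case using insert.hyps by (simp add: distrib_right)
qed

lemma summable_poly_times_geometric:
  fixes \<beta> :: real
  assumes \<beta>: "0 < \<beta>" "\<beta> < 1"
  shows "summable (\<lambda>T. real (Suc T) ^ n * \<beta> ^ T)"
proof -
  have "(\<lambda>T. (1 + inverse (real (Suc T))) ^ n * \<beta>) \<longlonglongrightarrow> (1 + 0) ^ n * \<beta>"
    by (intro tendsto_intros LIMSEQ_inverse_real_of_nat)
  then have "\<forall>\<^sub>F T in sequentially. (1 + inverse (real (Suc T))) ^ n * \<beta> < (1 + \<beta>) / 2"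
    using \<beta> by (intro order_tendstoD(2)) auto
  then obtain N where N: "\<And>T. T \<ge> N \<Longrightarrow> (1 + inverse (real (Suc T))) ^ n * \<beta> < (1 + \<beta>) / 2"
    by (auto simp: eventually_sequentially)
  show ?thesis
  proof (rule summable_ratio_test)
    show "(1 + \<beta>) / 2 < 1" using \<beta> by simp
    fix T assume T: "N \<le> T"
    have "real (Suc (Suc T)) = (1 + inverse (real (Suc T))) * real (Suc T)" by (simp add: field_simps)
    then have "real (Suc (Suc T)) ^ n * \<beta> ^ Suc T = ((1 + inverse (real (Suc T))) ^ n * \<beta>) * (real (Suc T) ^ n * \<beta> ^ T)"
      by (simp only: power_mult_distrib) simp
    also have "\<dots> \<le> (1 + \<beta>) / 2 * (real (Suc T) ^ n * \<beta> ^ T)"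
      using N[OF T] \<beta> by (intro mult_right_mono) auto
    finally show "norm (real (Suc (Suc T)) ^ n * \<beta> ^ Suc T) \<le> (1 + \<beta>) / 2 * norm (real (Suc T) ^ n * \<beta> ^ T)"
      using \<beta> by (simp add: abs_mult)
  qed
qed

text \<open>
  The rates of decay are restricted to \<open>1 / (N + 1)\<close> so that only countably many exceptional sets occur.
\<close>

definition short_at :: "real ^ 'n::finite \<Rightarrow> nat \<Rightarrow> nat \<Rightarrow> bool" where
  "short_at y N T \<longleftrightarrow> (\<exists>t u. (\<Sum>i\<in>UNIV. t i) = T \<and> int_vec u \<and> u \<noteq> 0 \<and>
     (\<Sum>r\<in>UNIV. \<bar>flow t y u $ r\<bar>) \<le> 2 powr (- real T / real (Suc N)))"

text \<open>
  Borel-Cantelli.  With \<open>i = T div M\<close>, the threshold \<open>\<mu>\<^sup>i\<close> decays more slowly than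
  \<open>2\<^bsup>-T/(N+1)\<^esup>\<close>, so the points with a short vector at time \<open>T\<close> are covered, over all
  \<open>(T + 1)\<^sup>n\<close> possible \<open>t\<close>, by sets of measure proportional to \<open>\<theta>\<^sup>i\<close>.
\<close>

theorem tame_imp_AE_not_short:
  fixes f :: "real ^ 'd::finite \<Rightarrow> real ^ 'n::finite"
  assumes tame: "tame f j0 x0 \<kappa> \<mu> (ennreal \<theta>) \<rho>"
    and \<kappa>: "0 < \<kappa>" "\<kappa> \<le> 1" and \<mu>: "0 < \<mu>" "\<mu> \<le> 1" and \<theta>: "0 < \<theta>" "\<theta> < 1" and \<rho>: "0 < \<rho>" "\<rho> \<le> 1"
  shows "AE x in lborel. x \<in> cell j0 x0 \<longrightarrow> (\<forall>\<^sub>F T in sequentially. \<not> short_at (f x) N T)"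
proof -
  let ?K = "CARD('n option)" and ?n = "CARD('n)"
  define r0 where "r0 = \<kappa> ^ ?K * \<rho>"
  have r0: "0 < r0" using \<kappa> \<rho> by (simp add: r0_def)
  obtain D where D: "1 / \<mu> < 2 ^ D" using real_arch_pow[of 2 "1 / \<mu>"] by auto
  then have D\<mu>: "1 / 2 ^ D \<le> \<mu>" using \<mu> by (simp add: field_simps)
  \<comment> \<open>Since \<open>\<mu> \<ge> 2\<^bsup>-D\<^esup>\<close>, this makes \<open>\<mu>\<^bsup>T div M\<^esup>\<close> at least \<open>2\<^bsup>-T/(2(N+1))\<^esup>\<close>; the other half of the decay beats the constant \<open>r0\<close>.\<close>
  define M where "M = 2 * Suc D * Suc N"
  have M: "0 < M" by (simp add: M_def)
  \<comment> \<open>The geometric rate per unit of \<open>T\<close>.\<close>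
  define \<beta> where "\<beta> = root M \<theta>"
  have \<beta>: "0 < \<beta>" "\<beta> < 1" "\<beta> ^ M = \<theta>"
    using \<theta> M by (auto simp: \<beta>_def real_root_pow_pos2)
  define V :: real where "V = (1 / 2 ^ j0) ^ CARD('d)"
  have V: "emeasure lborel (cell j0 x0) = ennreal V" "0 \<le> V"
    by (simp_all add: V_def emeasure_cell)
  define bnd where "bnd T = real (Suc T) ^ ?n * (real ?K * \<theta> ^ (T div M) * V)" for T
  have bnd0: "0 \<le> bnd T" for T using V \<theta> by (simp add: bnd_def)
  define Bad where "Bad T = {x \<in> cell j0 x0. short_at (f x) N T}" for T
  have "(\<lambda>T. 2 powr (- (1 / (2 * real (Suc N))) * real T)) \<longlonglongrightarrow> 0"
  proof -
    have "(\<lambda>T. (2 powr (- (1 / (2 * real (Suc N))))) ^ T) \<longlonglongrightarrow> 0"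
      by (rule LIMSEQ_power_zero) (simp add: powr_less_one)
    moreover have "(2 powr (- (1 / (2 * real (Suc N))))) ^ T = 2 powr (- (1 / (2 * real (Suc N))) * real T)" for T
      by (subst powr_powr[symmetric]) (simp add: powr_realpow del: of_nat_Suc)
    ultimately show ?thesis by simp
  qed
  then have "\<forall>\<^sub>F T in sequentially. 2 powr (- (1 / (2 * real (Suc N))) * real T) < r0"
    using r0 by (rule order_tendstoD(2))
  then obtain T1 where T1: "\<And>T. T \<ge> T1 \<Longrightarrow> 2 powr (- (1 / (2 * real (Suc N))) * real T) < r0"
    by (auto simp: eventually_sequentially)
  have outer_le_Bad: "outer_le (Bad T) (ennreal (bnd T))" if T: "T1 \<le> T" for T
  proof -
    let ?i = "T div M"
    let ?I = "PiE (UNIV :: 'n set) (\<lambda>_. {0..T})"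
    have less: "2 powr (- real T / real (Suc N)) < \<mu> ^ ?i * r0"
    proof -
      have "real D * real ?i \<le> real T / (2 * real (Suc N))"
      proof -
        have "?i * M \<le> T" by simp
        then have "real (?i * M) \<le> real T" by (simp only: of_nat_le_iff)
        moreover have "real ?i * (2 * real D * real (Suc N)) \<le> real (?i * M)"
          unfolding M_def by (simp add: algebra_simps)
        ultimately have "real D * real ?i * (2 * real (Suc N)) \<le> real T" by (simp add: algebra_simps)
        then show ?thesis by (simp add: pos_le_divide_eq del: of_nat_Suc)
      qed
      then have "2 powr (- (real T / (2 * real (Suc N)))) \<le> 2 powr (- (real D * real ?i))"
        by (intro powr_mono) auto
      also have "\<dots> = (1 / 2 ^ D) ^ ?i"
        by (simp add: powr_minus_divide powr_realpow power_divide power_mult powr_powr[symmetric] flip: of_nat_mult)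
      also have "\<dots> \<le> \<mu> ^ ?i" using D\<mu> by (intro power_mono) auto
      finally have 1: "2 powr (- (real T / (2 * real (Suc N)))) \<le> \<mu> ^ ?i" .
      have "2 powr (- real T / real (Suc N)) = 2 powr (- (real T / (2 * real (Suc N)))) * 2 powr (- (1 / (2 * real (Suc N))) * real T)"
        unfolding powr_add[symmetric] by (rule arg_cong2[where f = "(powr)"]) (simp_all add: field_simps del: of_nat_Suc)
      also have "\<dots> < 2 powr (- (real T / (2 * real (Suc N)))) * r0"
        using T1[OF T] by (intro mult_strict_left_mono) auto
      also have "\<dots> \<le> \<mu> ^ ?i * r0" using 1 r0 by (intro mult_right_mono) auto
      finally show ?thesis .
    qed
    define E where "E t = {x \<in> cell j0 x0. \<exists>u. int_vec u \<and> u \<noteq> 0 \<and> (\<Sum>r\<in>UNIV. \<bar>flow t (f x) u $ r\<bar>) < \<mu> ^ ?i * r0}" for t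
    have "outer_le (\<Union>t\<in>?I. E t) (of_nat (card ?I) * (of_nat ?K * ennreal \<theta> ^ ?i * emeasure lborel (cell j0 x0)))"
      unfolding E_def r0_def
      by (intro outer_le_UN_finite short_vectors_small[OF tame \<kappa> \<mu> \<rho>] finite_PiE) auto
    moreover have "Bad T \<subseteq> (\<Union>t\<in>?I. E t)"
    proof
      fix x assume "x \<in> Bad T"
      then obtain t u where x: "x \<in> cell j0 x0" and t: "(\<Sum>i\<in>UNIV. t i) = T" and u: "int_vec u" "u \<noteq> 0"
        "(\<Sum>r\<in>UNIV. \<bar>flow t (f x) u $ r\<bar>) \<le> 2 powr (- real T / real (Suc N))"
        by (auto simp: Bad_def short_at_def)
      have "t i \<le> T" for i unfolding t[symmetric] by (rule member_le_sum) auto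
      then have "t \<in> ?I" by auto
      moreover have "x \<in> E t" using x u less unfolding E_def by (auto intro!: exI[of _ u])
      ultimately show "x \<in> (\<Union>t\<in>?I. E t)" by blast
    qed
    moreover have "of_nat (card ?I) * (of_nat ?K * ennreal \<theta> ^ ?i * emeasure lborel (cell j0 x0)) = ennreal (bnd T)"
    proof -
      have "card ?I = Suc T ^ ?n" by (simp add: card_PiE)
      then show ?thesis
        unfolding bnd_def V(1) using \<theta> V(2)
        by (simp add: ennreal_power ennreal_of_nat_eq_real_of_nat ennreal_mult[symmetric] del: of_nat_Suc card_option)
    qed
    ultimately show ?thesis by (metis outer_le_mono order_refl)
  qed
  then have "\<forall>T. \<exists>A. A \<in> sets lborel \<and> emeasure lborel A \<le> ennreal (bnd T) \<and> (T1 \<le> T \<longrightarrow> Bad T \<subseteq> A)"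
  proof -
    have "\<exists>A. A \<in> sets lborel \<and> emeasure lborel A \<le> ennreal (bnd T) \<and> (T1 \<le> T \<longrightarrow> Bad T \<subseteq> A)" for T
    proof (cases "T1 \<le> T")
      case True
      then show ?thesis using outer_le_Bad[OF True] unfolding outer_le_def by auto
    next
      case False
      then show ?thesis by (intro exI[of _ "{}"]) auto
    qed
    then show ?thesis by blast
  qed
  then obtain A where A: "\<And>T. A T \<in> sets lborel" "\<And>T. emeasure lborel (A T) \<le> ennreal (bnd T)"
      "\<And>T. T1 \<le> T \<Longrightarrow> Bad T \<subseteq> A T"
    by metis
  have sb: "summable bnd"
  proof (rule summable_comparison_test)
    show "summable (\<lambda>T. real ?K * V / \<theta> * (real (Suc T) ^ ?n * \<beta> ^ T))"
      by (intro summable_mult summable_poly_times_geometric \<beta>)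
    have "norm (bnd T) \<le> real ?K * V / \<theta> * (real (Suc T) ^ ?n * \<beta> ^ T)" for T
    proof -
      have "\<theta> ^ (T div M) * \<theta> \<le> \<beta> ^ T"
      proof -
        have "\<theta> ^ (T div M) * \<theta> = \<beta> ^ (M * (T div M) + M)" by (simp add: power_add power_mult \<beta>(3))
        also have "\<dots> \<le> \<beta> ^ (M * (T div M) + T mod M)"
          by (intro power_decreasing add_left_mono less_imp_le mod_less_divisor M) (use \<beta> in auto)
        finally show ?thesis by simp
      qed
      then have "\<theta> ^ (T div M) \<le> \<beta> ^ T / \<theta>" using \<theta> by (simp add: field_simps)
      then have "bnd T \<le> real (Suc T) ^ ?n * (real ?K * (\<beta> ^ T / \<theta>) * V)"
        unfolding bnd_def using V by (intro mult_left_mono mult_right_mono) auto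
      then show ?thesis using bnd0 by (simp add: mult_ac)
    qed
    then show "\<exists>N. \<forall>T\<ge>N. norm (bnd T) \<le> real ?K * V / \<theta> * (real (Suc T) ^ ?n * \<beta> ^ T)" by blast
  qed
  have mA: "measure lborel (A T) \<le> bnd T" for T
    using A(2)[of T] bnd0[of T] by (simp add: measure_def enn2real_leI)
  have "summable (\<lambda>T. measure lborel (A T))"
    by (rule summable_comparison_test'[OF sb, of 0]) (simp add: mA)
  moreover have "emeasure lborel (A T) < \<infinity>" for T
    using A(2)[of T] by (simp add: le_less_trans)
  ultimately have "AE x in lborel. \<forall>\<^sub>F T in sequentially. x \<in> space lborel - A T"
    using A(1) by (intro borel_cantelli_AE1)
  then show ?thesis
  proof (rule AE_mp, intro AE_I2 impI)
    fix x assume ev: "\<forall>\<^sub>F T in sequentially. x \<in> space lborel - A T" and x: "x \<in> cell j0 x0"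
    have "\<forall>\<^sub>F T in sequentially. T1 \<le> T" by (rule eventually_ge_at_top)
    then show "\<forall>\<^sub>F T in sequentially. \<not> short_at (f x) N T"
      using ev
    proof eventually_elim
      case (elim T)
      then show ?case using A(3)[of T] x by (auto simp: Bad_def)
    qed
  qed
qed

section \<open>From approximations to short vectors\<close>

lemma Pi_plus_ge_1: "1 \<le> Pi_plus x"
  unfolding Pi_plus_def by (intro prod_ge_1) auto

lemma abs_le_Pi_plus: "\<bar>x $ i\<bar> \<le> Pi_plus x"
proof -
  have "1 \<le> (\<Prod>j\<in>UNIV - {i}. max \<bar>x $ j\<bar> 1)" by (intro prod_ge_1) auto
  from mult_left_mono[OF this, of "max \<bar>x $ i\<bar> 1"]
  have "max \<bar>x $ i\<bar> 1 \<le> Pi_plus x"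
    unfolding Pi_plus_def by (subst prod.remove[of _ i]) auto
  then show ?thesis by simp
qed

lemma finite_Pi_plus_le: "finite {q :: int ^ 'n::finite. Pi_plus (real_vec q) \<le> B}"
proof (rule finite_subset)
  show "{q :: int ^ 'n. Pi_plus (real_vec q) \<le> B} \<subseteq> vec_lambda ` PiE UNIV (\<lambda>_. {- \<lceil>B\<rceil>..\<lceil>B\<rceil>})"
  proof
    fix q :: "int ^ 'n" assume "q \<in> {q. Pi_plus (real_vec q) \<le> B}"
    then have "\<bar>real_vec q $ i\<bar> \<le> B" for i using abs_le_Pi_plus[of "real_vec q" i] by simp
    then have "\<bar>real_of_int (q $ i)\<bar> \<le> B" for i by (simp add: real_vec_def)
    then have "q $ i \<in> {- \<lceil>B\<rceil>..\<lceil>B\<rceil>}" for i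
      by (auto simp: le_ceiling_iff ceiling_le_iff abs_le_iff) (smt (verit) le_of_int_ceiling of_int_le_iff of_int_minus)+
    then show "q \<in> vec_lambda ` PiE UNIV (\<lambda>_. {- \<lceil>B\<rceil>..\<lceil>B\<rceil>})"
      by (intro image_eqI[of _ _ "vec_nth q"]) auto
  qed
qed (intro finite_imageI finite_PiE, auto)

lemma infinite_iff_Pi_plus_unbounded:
  "infinite A \<longleftrightarrow> (\<forall>B :: nat. \<exists>q\<in>A. real B < Pi_plus (real_vec q))"
proof
  assume inf: "infinite A"
  show "\<forall>B :: nat. \<exists>q\<in>A. real B < Pi_plus (real_vec q)"
  proof (rule ccontr)
    assume "\<not> ?thesis"
    then obtain B :: nat where "A \<subseteq> {q. Pi_plus (real_vec q) \<le> real B}" by (auto simp: not_less)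
    then show False using inf finite_Pi_plus_le finite_subset by blast
  qed
next
  assume unb: "\<forall>B :: nat. \<exists>q\<in>A. real B < Pi_plus (real_vec q)"
  show "infinite A"
  proof
    assume fin: "finite A"
    obtain B :: nat where B: "Max ((\<lambda>q. Pi_plus (real_vec q)) ` A) \<le> real B"
      using real_arch_simple by blast
    obtain q where "q \<in> A" "real B < Pi_plus (real_vec q)" using unb by blast
    moreover have "Pi_plus (real_vec q) \<le> Max ((\<lambda>q. Pi_plus (real_vec q)) ` A)"
      using fin \<open>q \<in> A\<close> by (intro Max_ge) auto
    ultimately show False using B by linarith
  qed
qed

text \<open>
  Choose \<open>2\<^bsup>t i\<^esup>\<close> close to \<open>\<bar>q\<^sub>i\<bar>\<^sub>+ R\<^sup>\<eta>\<close>, so that the coordinates \<open>q\<^sub>i\<close> shrink to size \<open>R\<^bsup>-\<eta>\<^esup>\<close>.  Then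
  \<open>2\<^sup>T\<close> is about \<open>R\<^bsup>1+n\<eta>\<^esup>\<close>, and with \<open>n \<eta> = \<epsilon> / 2\<close> half of the exponent \<open>\<epsilon>\<close> of the
  approximation is left for the first coordinate.
\<close>

lemma approximation_gives_short_vector:
  fixes q :: "int ^ 'n::finite" and p :: int and y :: "real ^ 'n"
  defines "R \<equiv> Pi_plus (real_vec q)" and "n \<equiv> real CARD('n)"
  assumes \<epsilon>: "0 < \<epsilon>" and R: "1 < R"
    and approx: "\<bar>real_vec q \<bullet> y + real_of_int p\<bar> * R \<le> R powr (- \<epsilon>)"
  shows "\<exists>t u. R \<le> 2 ^ (\<Sum>i\<in>UNIV. t i) \<and> int_vec u \<and> u \<noteq> 0 \<and>
    (\<Sum>r\<in>UNIV. \<bar>flow t y u $ r\<bar>) \<le>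
      (2 powr n + n) * 2 powr n * 2 powr (- (\<epsilon> / (2 * n) / (1 + \<epsilon> / 2)) * real (\<Sum>i\<in>UNIV. t i))"
proof -
  have n: "1 \<le> n" by (simp add: n_def Suc_le_eq)
  define \<eta> where "\<eta> = \<epsilon> / (2 * n)"
  define \<gamma> where "\<gamma> = \<eta> / (1 + \<epsilon> / 2)"
  have \<eta>: "0 < \<eta>" "n * \<eta> = \<epsilon> / 2" using \<epsilon> n by (simp_all add: \<eta>_def)
  have \<gamma>: "0 < \<gamma>" "\<gamma> * (1 + \<epsilon> / 2) = \<eta>" using \<eta> \<epsilon> by (simp_all add: \<gamma>_def)
  have \<gamma>1: "\<gamma> \<le> 1"
  proof -
    have "1 * \<eta> \<le> n * \<eta>" using n \<eta> by (intro mult_right_mono) auto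
    then have "\<eta> \<le> 1 + \<epsilon> / 2" using \<eta> by simp
    then show ?thesis using \<epsilon> by (simp add: \<gamma>_def)
  qed
  define a where "a i = max \<bar>real_of_int (q $ i)\<bar> 1 * R powr \<eta>" for i
  have a1: "1 \<le> a i" for i
  proof -
    have "1 \<le> R powr \<eta>" using R \<eta> by (intro ge_one_powr_ge_zero) auto
    then have "1 * 1 \<le> a i" unfolding a_def by (intro mult_mono) auto
    then show ?thesis by simp
  qed
  define t where "t i = nat \<lceil>log 2 (a i)\<rceil>" for i
  have t: "a i \<le> 2 ^ t i" "2 ^ t i \<le> 2 * a i" for i
  proof -
    have l0: "0 \<le> log 2 (a i)" using a1[of i] by simp
    then have rt: "real (t i) = of_int \<lceil>log 2 (a i)\<rceil>" by (simp add: t_def)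
    have "a i = 2 powr (log 2 (a i))" using a1[of i] by simp
    also have "\<dots> \<le> 2 powr (real (t i))" unfolding rt by (intro powr_mono) auto
    finally show "a i \<le> 2 ^ t i" by (simp add: powr_realpow)
    have "2 powr (real (t i)) \<le> 2 powr (1 + log 2 (a i))"
      unfolding rt by (intro powr_mono) linarith+
    also have "\<dots> = 2 * a i" using a1[of i] by (simp add: powr_add)
    finally show "2 ^ t i \<le> 2 * a i" by (simp add: powr_realpow)
  qed
  define T where "T = (\<Sum>i\<in>UNIV. t i)"
  have prod_a: "(\<Prod>i\<in>UNIV. a i) = R powr (1 + \<epsilon> / 2)"
  proof -
    have "(\<Prod>i\<in>UNIV. a i) = R * (R powr \<eta>) ^ CARD('n)"
      by (simp add: a_def prod.distrib R_def Pi_plus_def real_vec_def)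
    also have "(R powr \<eta>) ^ CARD('n) = R powr (\<epsilon> / 2)"
    proof -
      have "\<eta> * real CARD('n) = \<epsilon> / 2" using \<eta>(2) by (simp add: n_def mult.commute)
      moreover have "(R powr \<eta>) ^ CARD('n) = R powr (\<eta> * real CARD('n))"
        using R by (simp add: powr_realpow[symmetric] powr_powr)
      ultimately show ?thesis by (simp only:)
    qed
    finally show ?thesis using R by (simp add: powr_add)
  qed
  have T_lower: "R powr (1 + \<epsilon> / 2) \<le> 2 ^ T"
    unfolding T_def power_sum prod_a[symmetric] using t(1) a1 by (intro prod_mono) (meson order_trans zero_le_one)
  have "(2 :: real) ^ T \<le> (\<Prod>i\<in>UNIV. 2 * a i)"
    unfolding T_def power_sum using t(2) by (intro prod_mono) auto
  also have "\<dots> = 2 powr n * R powr (1 + \<epsilon> / 2)"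
    by (simp add: prod.distrib prod_a powr_realpow n_def)
  finally have T_upper: "2 ^ T \<le> 2 powr n * R powr (1 + \<epsilon> / 2)" .
  have "R powr 1 \<le> R powr (1 + \<epsilon> / 2)" using R \<epsilon> by (intro powr_mono) auto
  then have RT: "R \<le> 2 ^ T" using T_lower R by simp
  have R\<eta>: "R powr (- \<eta>) \<le> 2 powr n * 2 powr (- \<gamma> * real T)"
  proof -
    have "2 powr (\<gamma> * real T) = (2 ^ T) powr \<gamma>" by (simp add: powr_realpow[symmetric] powr_powr mult.commute)
    also have "\<dots> \<le> (2 powr n * R powr (1 + \<epsilon> / 2)) powr \<gamma>"
      using T_upper \<gamma> by (intro powr_mono2) auto
    also have "\<dots> = 2 powr (n * \<gamma>) * R powr \<eta>"
      using \<gamma>(2) by (simp add: powr_mult powr_powr mult.commute)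
    also have "\<dots> \<le> 2 powr n * R powr \<eta>"
      using \<gamma>1 n by (intro mult_right_mono powr_mono) (auto simp: mult_left_le)
    finally show ?thesis using R by (simp add: powr_minus divide_simps mult_ac)
  qed
  define u :: "real ^ ('n option)" where
    "u = (\<chi> r. case r of None \<Rightarrow> real_of_int p | Some i \<Rightarrow> real_of_int (q $ i))"
  have "int_vec u" unfolding int_vec_def u_def by (auto split: option.split)
  moreover have "u \<noteq> 0"
  proof
    assume "u = 0"
    then have "u $ Some i = 0" for i by simp
    then have "q $ i = 0" for i by (simp add: u_def)
    then show False using R by (simp add: R_def Pi_plus_def real_vec_def)
  qed
  moreover have "(\<Sum>r\<in>UNIV. \<bar>flow t y u $ r\<bar>) \<le> (2 powr n + n) * 2 powr n * 2 powr (- \<gamma> * real T)"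
  proof -
    have "\<bar>flow t y u $ None\<bar> \<le> 2 powr n * R powr (- \<eta>)"
    proof -
      have fl: "flow t y u $ None = 2 ^ T * (real_vec q \<bullet> y + real_of_int p)"
        by (simp add: flow_None T_def u_def inner_vec_def real_vec_def mult.commute add.commute)
      have "\<bar>real_vec q \<bullet> y + real_of_int p\<bar> \<le> R powr (- \<epsilon>) / R"
        using approx R by (simp add: pos_le_divide_eq)
      also have "\<dots> = R powr (- \<epsilon> - 1)" using R by (simp add: powr_diff)
      finally have "\<bar>flow t y u $ None\<bar> \<le> (2 powr n * R powr (1 + \<epsilon> / 2)) * R powr (- \<epsilon> - 1)"
        unfolding fl abs_mult using T_upper by (intro mult_mono) auto
      also have "\<dots> = 2 powr n * R powr (- (\<epsilon> / 2))"
        by (simp add: mult.assoc powr_add[symmetric])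
      also have "\<dots> \<le> 2 powr n * R powr (- \<eta>)"
      proof -
        have "1 * \<eta> \<le> n * \<eta>" using n \<eta> by (intro mult_right_mono) auto
        then have "\<eta> \<le> \<epsilon> / 2" using \<eta> by simp
        then show ?thesis using R by (intro mult_left_mono powr_mono) auto
      qed
      finally show ?thesis .
    qed
    moreover have "\<bar>flow t y u $ Some i\<bar> \<le> R powr (- \<eta>)" for i
    proof -
      have "\<bar>real_of_int (q $ i)\<bar> * R powr \<eta> \<le> a i" unfolding a_def by (intro mult_right_mono) auto
      also have "\<dots> \<le> 2 ^ t i" by (rule t(1))
      finally show ?thesis using R by (simp add: flow_Some u_def powr_minus divide_simps mult_ac)
    qed
    then have "(\<Sum>i\<in>UNIV. \<bar>flow t y u $ Some i\<bar>) \<le> n * R powr (- \<eta>)"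
      unfolding n_def by (intro sum_bounded_above)
    ultimately have "(\<Sum>r\<in>UNIV. \<bar>flow t y u $ r\<bar>) \<le> (2 powr n + n) * R powr (- \<eta>)"
      unfolding sum_UNIV_option by (simp add: distrib_right)
    also have "\<dots> \<le> (2 powr n + n) * (2 powr n * 2 powr (- \<gamma> * real T))"
      using R\<eta> n by (intro mult_left_mono) auto
    finally show ?thesis by (simp add: mult.assoc)
  qed
  ultimately show ?thesis
    using RT unfolding \<gamma>_def \<eta>_def T_def by blast
qed

lemma VWMA_imp_short:
  fixes y :: "real ^ 'n::finite"
  assumes "VWMA y"
  shows "\<exists>N. \<exists>\<^sub>F T in sequentially. short_at y N T"
proof -
  obtain \<epsilon> where \<epsilon>: "0 < \<epsilon>" and inf: "infinite {q :: int ^ 'n. \<exists>p :: int.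
        \<bar>real_vec q \<bullet> y + real_of_int p\<bar> * Pi_plus (real_vec q) \<le> Pi_plus (real_vec q) powr (- \<epsilon>)}"
    using assms unfolding VWMA_def by blast
  define n where "n = real CARD('n)"
  define \<gamma> where "\<gamma> = \<epsilon> / (2 * n) / (1 + \<epsilon> / 2)"
  define C where "C = (2 powr n + n) * 2 powr n"
  have n: "0 < n" by (simp add: n_def)
  have \<gamma>: "0 < \<gamma>" using \<epsilon> n by (simp add: \<gamma>_def)
  have C: "0 < C" using n by (simp add: C_def add_pos_pos)
  obtain N where N: "inverse (real (Suc N)) < \<gamma> / 2"
    using reals_Archimedean[of "\<gamma> / 2"] \<gamma> by auto
  obtain T1 :: nat where T1: "log 2 C / (\<gamma> / 2) \<le> real T1" using real_arch_simple by blast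
  have "\<exists>T\<ge>T0. short_at y N T" for T0
  proof -
    let ?B = "2 ^ max T0 T1 :: nat"
    obtain q :: "int ^ 'n" and p :: int where
      ap: "\<bar>real_vec q \<bullet> y + real_of_int p\<bar> * Pi_plus (real_vec q) \<le> Pi_plus (real_vec q) powr (- \<epsilon>)"
      and B: "real ?B < Pi_plus (real_vec q)"
      using inf unfolding infinite_iff_Pi_plus_unbounded by blast
    have B1: "1 \<le> real ?B" by simp
    then have "1 < Pi_plus (real_vec q)" using B by linarith
    from approximation_gives_short_vector[OF \<epsilon> this ap]
    obtain t u where t: "Pi_plus (real_vec q) \<le> 2 ^ (\<Sum>i\<in>UNIV. t i)" and u: "int_vec u" "u \<noteq> 0"
      and le: "(\<Sum>r\<in>UNIV. \<bar>flow t y u $ r\<bar>) \<le> C * 2 powr (- \<gamma> * real (\<Sum>i\<in>UNIV. t i))"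
      unfolding C_def \<gamma>_def n_def by blast
    define T where "T = (\<Sum>i\<in>UNIV. t i)"
    have "(2 :: real) ^ max T0 T1 < 2 ^ T"
      using less_le_trans[OF B t] unfolding T_def by (simp only: of_nat_power of_nat_numeral)
    then have "max T0 T1 < T" by simp
    then have T: "T0 \<le> T" "T1 \<le> T" by simp_all
    have "C = 2 powr (log 2 C)" using C by simp
    also have "\<dots> \<le> 2 powr (\<gamma> / 2 * real T)"
    proof (intro powr_mono)
      have "log 2 C \<le> \<gamma> / 2 * real T1" using T1 \<gamma> by (simp add: field_simps)
      also have "\<dots> \<le> \<gamma> / 2 * real T" using T(2) \<gamma> by (intro mult_left_mono) auto
      finally show "log 2 C \<le> \<gamma> / 2 * real T" .
    qed simp
    finally have "C * 2 powr (- \<gamma> * real T) \<le> 2 powr (\<gamma> / 2 * real T) * 2 powr (- \<gamma> * real T)"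
      by (intro mult_right_mono) auto
    also have "\<dots> = 2 powr (- (\<gamma> / 2) * real T)"
      unfolding powr_add[symmetric] by (rule arg_cong2[where f = "(powr)"]) (simp_all add: field_simps)
    also have "\<dots> \<le> 2 powr (- real T / real (Suc N))"
    proof (rule powr_mono)
      have "inverse (real (Suc N)) * real T \<le> \<gamma> / 2 * real T"
        by (rule mult_right_mono[OF less_imp_le[OF N]]) simp
      moreover have "- real T / real (Suc N) = - (inverse (real (Suc N)) * real T)"
        by (simp only: divide_inverse mult.commute minus_mult_right)
      ultimately show "- (\<gamma> / 2) * real T \<le> - real T / real (Suc N)" by linarith
    qed simp
    finally have "C * 2 powr (- \<gamma> * real T) \<le> 2 powr (- real T / real (Suc N))" .
    from order_trans[OF le[folded T_def] this] have "short_at y N T"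
      unfolding short_at_def using u T_def by (intro exI[of _ t] exI[of _ u]) simp
    then show ?thesis using T by blast
  qed
  then show ?thesis by (auto simp: frequently_sequentially)
qed

section \<open>Strong extremality\<close>

lemma countable_int_vec: "countable (UNIV :: (int ^ 'n::finite) set)"
proof -
  have "inj (vec_nth :: int ^ 'n \<Rightarrow> 'n \<Rightarrow> int)" by (auto simp: inj_def vec_eq_iff)
  then show ?thesis using countable_image_inj_on[of vec_nth UNIV] by (simp add: countableI_type)
qed

text \<open>
  The image measure lives on Borel sets.  Countable operations describe this set: \<open>\<epsilon>\<close> may be restricted to the
  values \<open>1 / (k + 1)\<close>, and infinitude of a set of integer vectors means that \<open>Pi_plus\<close> is unbounded on it.
\<close>

lemma sets_VWMA: "{y :: real ^ 'n::finite. VWMA y} \<in> sets borel"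
proof -
  define A where "A \<epsilon> y = {q :: int ^ 'n. \<exists>p :: int. \<bar>real_vec q \<bullet> y + real_of_int p\<bar> * Pi_plus (real_vec q)
      \<le> Pi_plus (real_vec q) powr (- \<epsilon>)}" for \<epsilon> and y :: "real ^ 'n"
  have mono: "A \<epsilon> y \<subseteq> A \<delta> y" if "\<delta> \<le> \<epsilon>" for \<epsilon> \<delta> y
  proof -
    have "Pi_plus (real_vec q) powr (- \<epsilon>) \<le> Pi_plus (real_vec q) powr (- \<delta>)" for q :: "int ^ 'n"
      using Pi_plus_ge_1[of "real_vec q"] that by (intro powr_mono) auto
    then show ?thesis unfolding A_def by (blast intro: order_trans)
  qed
  have "VWMA y \<longleftrightarrow> (\<exists>k :: nat. infinite (A (inverse (real (Suc k))) y))" for y :: "real ^ 'n"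
  proof
    assume "VWMA y"
    then obtain \<epsilon> where \<epsilon>: "0 < \<epsilon>" "infinite (A \<epsilon> y)" unfolding VWMA_def A_def by blast
    obtain k where "inverse (real (Suc k)) < \<epsilon>" using reals_Archimedean[OF \<epsilon>(1)] by blast
    then show "\<exists>k. infinite (A (inverse (real (Suc k))) y)"
      using mono[of "inverse (real (Suc k))" \<epsilon> y] \<epsilon>(2) finite_subset less_imp_le by blast
  next
    assume "\<exists>k. infinite (A (inverse (real (Suc k))) y)"
    then obtain k :: nat where "infinite (A (inverse (real (Suc k))) y)" by blast
    moreover have "0 < inverse (real (Suc k))" by simp
    ultimately show "VWMA y" unfolding VWMA_def A_def by blast
  qed
  then have "{y :: real ^ 'n. VWMA y} = (\<Union>k :: nat. \<Inter>B :: nat. \<Union>q\<in>{q :: int ^ 'n. real B < Pi_plus (real_vec q)}.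
      \<Union>p :: int. {y. \<bar>real_vec q \<bullet> y + real_of_int p\<bar> * Pi_plus (real_vec q)
        \<le> Pi_plus (real_vec q) powr (- inverse (real (Suc k)))})"
    unfolding infinite_iff_Pi_plus_unbounded A_def by (auto simp: conj_commute) (rule exI, assumption)+
  also have "\<dots> \<in> sets borel"
  proof (intro sets.countable_UN sets.countable_INT image_subsetI sets.countable_UN'[OF countable_subset[OF subset_UNIV countable_int_vec]])
    fix k :: nat and q :: "int ^ 'n" and p :: int
    show "{y :: real ^ 'n. \<bar>real_vec q \<bullet> y + real_of_int p\<bar> * Pi_plus (real_vec q)
        \<le> Pi_plus (real_vec q) powr (- inverse (real (Suc k)))} \<in> sets borel"
      by measurable
  qed auto
  finally show ?thesis .
qed

lemma tame_imp_AE_not_VWMA: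
  fixes f :: "real ^ 'd::finite \<Rightarrow> real ^ 'n::finite"
  assumes "tame f j0 x0 \<kappa> \<mu> (ennreal \<theta>) \<rho>"
    and "0 < \<kappa>" "\<kappa> \<le> 1" "0 < \<mu>" "\<mu> < 1" "0 < \<theta>" "\<theta> < 1" "0 < \<rho>" "\<rho> \<le> 1"
  shows "AE x in lborel. x \<in> cell j0 x0 \<longrightarrow> \<not> VWMA (f x)"
proof -
  have "AE x in lborel. \<forall>N. x \<in> cell j0 x0 \<longrightarrow> (\<forall>\<^sub>F T in sequentially. \<not> short_at (f x) N T)"
    unfolding AE_all_countable using tame_imp_AE_not_short[OF assms(1)] assms(2-) by simp
  then show ?thesis
  proof (rule AE_mp, intro AE_I2 impI)
    fix x assume "\<forall>N. x \<in> cell j0 x0 \<longrightarrow> (\<forall>\<^sub>F T in sequentially. \<not> short_at (f x) N T)" "x \<in> cell j0 x0"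
    then show "\<not> VWMA (f x)"
      using VWMA_imp_short[of "f x"] by (auto simp: frequently_def)
  qed
qed

lemma nondegenerate_at_image:
  fixes f :: "real ^ 'd::finite \<Rightarrow> real ^ 'n::finite"
  assumes "nondegenerate m U f (f x)" "inj_on f U" "x \<in> U"
  shows "span {multi_deriv \<beta> f x | \<beta>. 1 \<le> (\<Sum>i\<in>UNIV. \<beta> i) \<and> (\<Sum>i\<in>UNIV. \<beta> i) \<le> m} = UNIV"
proof -
  obtain l x' where l: "l \<le> m" and x': "x' \<in> U" "f x = f x'"
    "span {multi_deriv \<beta> f x' | \<beta>. 1 \<le> (\<Sum>i\<in>UNIV. \<beta> i) \<and> (\<Sum>i\<in>UNIV. \<beta> i) \<le> l} = UNIV"
    using assms(1) unfolding nondegenerate_def l_nondegenerate_def by blast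
  have "x' = x" using inj_onD[OF assms(2) x'(2) assms(3) x'(1)] by simp
  have "{multi_deriv \<beta> f x | \<beta>. 1 \<le> (\<Sum>i\<in>UNIV. \<beta> i) \<and> (\<Sum>i\<in>UNIV. \<beta> i) \<le> l} \<subseteq>
      {multi_deriv \<beta> f x | \<beta>. 1 \<le> (\<Sum>i\<in>UNIV. \<beta> i) \<and> (\<Sum>i\<in>UNIV. \<beta> i) \<le> m}"
    using l by (auto intro: order_trans)
  from span_mono[OF this] show ?thesis using x'(3) \<open>x' = x\<close> by auto
qed

theorem theoremA:
  fixes m :: nat
    and U :: "(real ^ 'd::finite) set"
    and f :: "real ^ 'd \<Rightarrow> real ^ 'n::finite"
  assumes "1 \<le> m"
    and "open U"
    and "\<And>j. Ck_on m U (\<lambda>x. f x $ j)"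
    and "Ck_embedding m U f"
    and "AE y in image_measure U f. nondegenerate m U f y"
  shows "strongly_extremal U f"
proof -
  have C: "Ck_on m U f" and inj: "inj_on f U"
    using assms(4) unfolding Ck_embedding_def homeomorphism_def by (auto intro: inj_on_inverseI)
  have U: "U \<in> sets lebesgue" using assms(2) by simp
  have "f \<in> borel_measurable (lebesgue_on U)"
    using continuous_imp_measurable_on_sets_lebesgue[OF Ck_on_continuous[OF C] U] .
  then have meas: "f \<in> lebesgue_on U \<rightarrow>\<^sub>M restrict_space borel (f ` U)"
    by (intro measurable_restrict_space2) (auto simp: space_restrict_space)
  have AE_on_U: "(AE x in lebesgue_on U. P x) \<longleftrightarrow> (AE x in lebesgue. x \<in> U \<longrightarrow> P x)" for P
    using U by (subst AE_restrict_space_iff) auto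
  have nondeg: "AE x in lebesgue. x \<in> U \<longrightarrow> nondegenerate m U f (f x)"
    using AE_distrD[OF meas assms(5)[unfolded image_measure_def]] unfolding AE_on_U .
  define \<G> where "\<G> = {Q \<in> range (\<lambda>(j, x :: real ^ 'd). cell j x). AE x in lborel. x \<in> Q \<longrightarrow> \<not> VWMA (f x)}"
  have "countable \<G>"
    using countable_cells by (rule countable_subset[rotated]) (auto simp: \<G>_def)
  then have "AE x in lborel. \<forall>Q\<in>\<G>. x \<in> Q \<longrightarrow> \<not> VWMA (f x)"
    by (subst AE_ball_countable) (auto simp: \<G>_def)
  then have good: "AE x in lebesgue. \<forall>Q\<in>\<G>. x \<in> Q \<longrightarrow> \<not> VWMA (f x)"
    by (rule AE_completion)
  have "AE x in lebesgue. x \<in> U \<longrightarrow> \<not> VWMA (f x)"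
    using nondeg good
  proof eventually_elim
    case (elim x)
    show ?case
    proof
      assume x: "x \<in> U"
      have "span {multi_deriv \<beta> f x | \<beta>. 1 \<le> (\<Sum>i\<in>UNIV. \<beta> i) \<and> (\<Sum>i\<in>UNIV. \<beta> i) \<le> m} = UNIV"
        using elim(1) x by (intro nondegenerate_at_image[OF _ inj x]) auto
      from nondegenerate_imp_tame[OF C assms(2) x assms(1) this]
      obtain j0 \<kappa> \<mu> \<theta> \<rho> where "0 < \<kappa>" "\<kappa> \<le> 1" "0 < \<mu>" "\<mu> < 1" "0 < \<theta>" "\<theta> < 1" "0 < \<rho>" "\<rho> \<le> 1"
        "tame f j0 x \<kappa> \<mu> (ennreal \<theta>) \<rho>" by blast
      then have "AE z in lborel. z \<in> cell j0 x \<longrightarrow> \<not> VWMA (f z)" by (intro tame_imp_AE_not_VWMA)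
      then have "cell j0 x \<in> \<G>" by (auto simp: \<G>_def)
      then show "\<not> VWMA (f x)" using elim(2) cell_self by blast
    qed
  qed
  then have "AE x in lebesgue_on U. \<not> VWMA (f x)" unfolding AE_on_U .
  moreover have "{y \<in> space (restrict_space borel (f ` U)). \<not> VWMA y} \<in> sets (restrict_space borel (f ` U))"
  proof -
    have "{y \<in> space (restrict_space borel (f ` U)). \<not> VWMA y} = f ` U \<inter> (- {y. VWMA y})"
      by (auto simp: space_restrict_space)
    moreover have "- {y :: real ^ 'n. VWMA y} \<in> sets borel" using sets_VWMA by (rule borel_comp)
    ultimately show ?thesis unfolding sets_restrict_space by blast
  qed
  ultimately show ?thesis
    unfolding strongly_extremal_def image_measure_def by (subst AE_distr_iff[OF meas]) auto
qed

end
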